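(* Let $d\ge 1$ be an integer, $\alpha\in(0,2)$, let $f:\mathbb{R}^d\times\mathbb{R}^d\to[0,\infty]$ be a Borel function and $\phi:[0,\infty)\to(0,1]$ a Borel function. Assume: (A.1) There is a constant $M>0$ with $f(x,y)\le M\,\phi(|y-x|)\,|y-x|^{-\alpha-d}$ for all $x\ne y$ in $\mathbb{R}^d$, where $\phi$ satisfies: (a) $\phi(a)=1$ for $a\in[0,1]$ and there is a constant $c_1$ with $\phi(a)\le c_1\phi(b)$ whenever $a,b\ge 0$, $|a-b|\le 1$; (b) $\phi\in C^2(1,\infty)$ and there is a constant $c_2$ with $\max(|\phi'(a)|,|\phi''(a)|)\le c_2\phi(a)$ for every $a>1$; (c) there is a constant $c_3$ such that for all $x,y\in\mathbb{R}^d$ with $|x-y|>2$, $$\int_{|x-z|\ge 1,\,|y-z|\ge 1}\frac{\phi(|y-z|)}{|y-z|^{\alpha+d}}\,\frac{\phi(|z-x|)}{|z-x|^{\alpha+d}}\,dz\le c_3\,\frac{\phi(|y-x|)}{|y-x|^{\alpha+d}}.$$ (A.2) $f(x,x+h)=f(x,x-h)$ for all $x,h\in\mathbb{R}^d$, or $\alpha<1$. (A.3) $f(x,y)=f(y,x)$ for all $x,y\in\mathbb{R}^d$. (A.4) There is a constant $c_4>0$ with $\inf_{x\in\mathbb{R}^d}\int_{|y-x|>\varepsilon}\frac{f(x,y)}{\phi(|y-x|)}\,dy\ge c_4\varepsilon^{-\alpha}$ for every $\varepsilon>0$. Let $\varepsilon_0,c_6>0$ be constants, depending only on $d,\alpha,\phi,M,c_4$,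 such that $\inf_{x}b_\varepsilon(x)\ge c_6\varepsilon^{-\alpha}$ for all $0<\varepsilon\le\varepsilon_0$ (these exist by (A.1) and (A.4)). Then there exist constants $C_1,C_2>0$, depending only on $d,\alpha,\phi,M,c_4$ (and the chosen $\varepsilon_0,c_6$), such that for every nonnegative bounded Borel function $\varphi:\mathbb{R}^d\to\mathbb{R}$, every $\varepsilon\in(0,\varepsilon_0\wedge 1)$, every $t>0$ and every $x\in\mathbb{R}^d$, $$e^{t\mathcal{A}_\varepsilon}\varphi(x)\le C_1e^{C_2t}\int_{\mathbb{R}^d}\varphi(y)\min\left(t^{-d/\alpha},\frac{t\,\phi(|y-x|)}{|y-x|^{\alpha+d}}\right)dy+e^{-tb_\varepsilon(x)}\varphi(x).$$
   Context: For $\varepsilon>0$ and $x\in\mathbb{R}^d$: $b_\varepsilon(x)=\int_{|y-x|>\varepsilon}f(x,y)\,dy$; $f_\varepsilon(x,y)=\mathbf{1}_{\{|y-x|\ge\varepsilon\}}f(x,y)$. The operator $\mathcal{A}_\varepsilon$ acts on the space $B_b(\mathbb{R}^d)$ of bounded Borel functions by $\mathcal{A}_\varepsilon\varphi(x)=\int_{\mathbb{R}^d}(\varphi(y)-\varphi(x))f_\varepsilon(x,y)\,dy$. Under (A.1) it is bounded on $B_b(\mathbb{R}^d)$ with the supremum norm, and $e^{t\mathcal{A}_\varepsilon}=\sum_{n=0}^\infty \frac{t^n\mathcal{A}_\varepsilon^n}{n!}$. *)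

theory Defs
  imports "HOL-Analysis.Analysis"
begin

text \<open>
  Throughout, \<open>\<real>\<^sup>d\<close> is a type \<open>'a :: euclidean_space\<close> with \<open>d = DIM('a) \<ge> 1\<close>. The function
  \<open>\<phi>\<close> is only ever evaluated on \<open>[0,\<infinity>)\<close>.
\<close>

text \<open>
  The function \<open>\<phi>(|h|) / |h|\<^bsup>\<alpha>+d\<^esup>\<close>. At \<open>h = 0\<close> its value is \<open>0\<close> by the convention for division;
  this is only seen by integrals in which a single point is negligible.
\<close>
definition jump_bound :: "real \<Rightarrow> (real \<Rightarrow> real) \<Rightarrow> 'a::euclidean_space \<Rightarrow> real" where
  "jump_bound \<alpha> \<phi> h = \<phi> (norm h) / norm h powr (\<alpha> + real DIM('a))"

definition C2_on :: "real set \<Rightarrow> (real \<Rightarrow> real) \<Rightarrow> bool" where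
  "C2_on S u \<longleftrightarrow>
     (\<forall>a\<in>S. u differentiable (at a)) \<and>
     (\<forall>a\<in>S. deriv u differentiable (at a)) \<and>
     continuous_on S (deriv (deriv u))"

definition b_eps :: "('a::euclidean_space \<times> 'a \<Rightarrow> ennreal) \<Rightarrow> real \<Rightarrow> 'a \<Rightarrow> ennreal" where
  "b_eps f \<epsilon> x = (\<integral>\<^sup>+y\<in>{y. norm (y - x) > \<epsilon>}. f (x, y) \<partial>lborel)"

definition f_eps :: "('a::euclidean_space \<times> 'a \<Rightarrow> ennreal) \<Rightarrow> real \<Rightarrow> 'a \<times> 'a \<Rightarrow> ennreal" where
  "f_eps f \<epsilon> = (\<lambda>(x, y). indicator {y. norm (y - x) \<ge> \<epsilon>} y * f (x, y))"

text \<open>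
  For \<open>\<epsilon> > 0\<close> the bound on \<open>f\<close> off the diagonal makes \<open>f_eps f \<epsilon>\<close> finite everywhere, so that
  \<^const>\<open>enn2real\<close> loses nothing.
\<close>
definition A_eps ::
  "('a::euclidean_space \<times> 'a \<Rightarrow> ennreal) \<Rightarrow> real \<Rightarrow> ('a \<Rightarrow> real) \<Rightarrow> 'a \<Rightarrow> real" where
  "A_eps f \<epsilon> g x = (\<integral>y. (g y - g x) * enn2real (f_eps f \<epsilon> (x, y)) \<partial>lborel)"

text \<open>
  The exponential series of an operator \<open>A\<close> on functions, evaluated at a function and a point. When
  \<open>A\<close> is bounded on the bounded Borel functions with the supremum norm, the series converges in
  operator norm, and the pointwise sums below are the values of its limit.
\<close>
definition exp_op :: "real \<Rightarrow> (('a \<Rightarrow> real) \<Rightarrow> 'a \<Rightarrow> real) \<Rightarrow> ('a \<Rightarrow> real) \<Rightarrow> 'a \<Rightarrow> real" where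
  "exp_op t A g x = (\<Sum>n. t ^ n * (A ^^ n) g x / fact n)"

end

theory Submission
  imports Defs
begin

text \<open>
  Put \<open>s = \<alpha> + d\<close>, \<open>\<delta> = min (t powr (1/\<alpha>)) (min 1 \<epsilon>0)\<close> and let \<open>H h = \<phi> |h| * max |h| \<delta> powr -s\<close>, which is the
  jump bound capped at scale \<open>\<delta>\<close>. For a constant \<open>\<Lambda>\<close> above all \<open>b_eps f \<epsilon> x\<close>, the operator \<open>P = A_eps f \<epsilon> + \<Lambda>\<close> is
  positive and \<open>exp (t A) = exp (-\<Lambda> t) * (\<Sum>n. t^n P^n / n!)\<close>, so it suffices to compare powers. If \<open>P\<close> is split as
  \<open>S + B\<close>, then \<open>P^n = S^n + (\<Sum>i<n. S^i B P^(n-1-i))\<close>. Let \<open>S_r\<close> keep only the jumps of length at most \<open>r\<close> and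
  the multiplication part \<open>\<Lambda> - b\<close>; remove first the jumps longer than \<open>\<delta>\<close>, and then, dyadically, those with length in
  \<open>(\<delta>/2^(j+1), \<delta>/2^j]\<close>, until no jump is left. What remains at the end is multiplication by \<open>(\<Lambda> - b)^n\<close>, the source of
  the term \<open>exp (-t b)\<close>.

  Each removed piece has a kernel below a multiple of \<open>H\<close>, with a factor \<open>2^((j+1) s)\<close> for the dyadic ones. By symmetry
  of \<open>f\<close> in small jumps (or \<open>\<alpha> < 1\<close>), the exponentials \<open>exp (\<kappa> (x \<bullet> e) / \<delta>)\<close> are supersolutions of \<open>S_r\<close> with rate
  \<open>\<Lambda> - c6 r^-\<alpha> + C \<delta>^-\<alpha>\<close>. As \<open>H\<close> changes at most exponentially at scale \<open>\<delta>\<close>, the powers of \<open>S_r\<close> applied to \<open>H\<close>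
  grow with the same rate, without any smoothness of \<open>H\<close>, and for the powers of \<open>P\<close> one adds the bound \<open>H * H \<le> K \<delta>^-\<alpha> H\<close>
  for the convolution. After summation over \<open>n\<close> the dyadic pieces carry \<open>2^((j+1) s) exp (-c6 2^(j \<alpha>))\<close>, which
  is summable in \<open>j\<close>.
\<close>

subsection \<open>Positive jump operators\<close>

text \<open>Values in \<open>ennreal\<close> give a meaning to every integral and power at once, and
  positivity makes the later comparisons plain monotonicity. The factor \<open>m\<close> holds the
  mass that stays in place.\<close>

definition jump_op ::
  "('a::euclidean_space \<Rightarrow> 'a \<Rightarrow> ennreal) \<Rightarrow> ('a \<Rightarrow> ennreal) \<Rightarrow> ('a \<Rightarrow> ennreal) \<Rightarrow> 'a \<Rightarrow> ennreal"
  where "jump_op k m u x = (\<integral>\<^sup>+y. k x y * u y \<partial>lborel) + m x * u x"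

lemma jump_op_measurable [measurable]:
  assumes [measurable]: "case_prod k \<in> borel_measurable (lborel \<Otimes>\<^sub>M lborel)"
    "m \<in> borel_measurable borel" "u \<in> borel_measurable borel"
  shows "jump_op k m u \<in> borel_measurable borel"
proof -
  have "(\<lambda>x. \<integral>\<^sup>+y. k x y * u y \<partial>lborel) \<in> borel_measurable lborel"
    by (rule lborel.borel_measurable_nn_integral) measurable
  then show ?thesis
    unfolding jump_op_def[abs_def] by simp
qed

lemma jump_op_pow_measurable [measurable]:
  assumes [measurable]: "case_prod k \<in> borel_measurable (lborel \<Otimes>\<^sub>M lborel)"
    "m \<in> borel_measurable borel" "u \<in> borel_measurable borel"
  shows "(jump_op k m ^^ n) u \<in> borel_measurable borel"
  by (induction n) auto

lemma jump_op_mono: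
  assumes "\<And>x y. k x y \<le> k' x y" "\<And>x. u x \<le> v x"
  shows "jump_op k m u x \<le> jump_op k' m v x"
  unfolding jump_op_def by (intro add_mono nn_integral_mono mult_mono assms) auto

lemma jump_op_pow_mono:
  assumes "\<And>x y. k x y \<le> k' x y" "\<And>x. u x \<le> v x"
  shows "(jump_op k m ^^ n) u x \<le> (jump_op k' m ^^ n) v x"
  by (induction n arbitrary: x) (auto intro: jump_op_mono assms)

lemma measurable_kernel_section:
  assumes "case_prod k \<in> borel_measurable (lborel \<Otimes>\<^sub>M lborel)"
  shows "k x \<in> borel_measurable lborel"
  using measurable_Pair2[OF assms, of x] by simp

lemma jump_op_cmult:
  assumes k: "case_prod k \<in> borel_measurable (lborel \<Otimes>\<^sub>M lborel)"
    and [measurable]: "u \<in> borel_measurable borel"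
  shows "jump_op k m (\<lambda>x. c * u x) = (\<lambda>x. c * jump_op k m u x)"
proof
  fix x
  note [measurable] = measurable_kernel_section[OF k, of x]
  have "(\<integral>\<^sup>+y. k x y * (c * u y) \<partial>lborel) = c * (\<integral>\<^sup>+y. k x y * u y \<partial>lborel)"
    by (subst nn_integral_cmult[symmetric]) (auto simp: mult_ac)
  then show "jump_op k m (\<lambda>x. c * u x) x = c * jump_op k m u x"
    by (simp add: jump_op_def distrib_left mult_ac)
qed

lemma jump_op_add:
  assumes k: "case_prod k \<in> borel_measurable (lborel \<Otimes>\<^sub>M lborel)"
    and [measurable]: "u \<in> borel_measurable borel" "v \<in> borel_measurable borel"
  shows "jump_op k m (\<lambda>x. u x + v x) = (\<lambda>x. jump_op k m u x + jump_op k m v x)"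
proof
  fix x
  note [measurable] = measurable_kernel_section[OF k, of x]
  show "jump_op k m (\<lambda>x. u x + v x) x = jump_op k m u x + jump_op k m v x"
    by (simp add: jump_op_def distrib_left nn_integral_add add_ac)
qed

lemma jump_op_sum:
  assumes k: "case_prod k \<in> borel_measurable (lborel \<Otimes>\<^sub>M lborel)"
    and u: "\<And>i. i \<in> I \<Longrightarrow> u i \<in> borel_measurable borel" and "finite I"
  shows "jump_op k m (\<lambda>x. \<Sum>i\<in>I. u i x) = (\<lambda>x. \<Sum>i\<in>I. jump_op k m (u i) x)"
  using \<open>finite I\<close> u
proof (induction I)
  case empty
  show ?case by (simp add: jump_op_def fun_eq_iff)
next
  case (insert i I)
  have "jump_op k m (\<lambda>x. u i x + (\<Sum>i\<in>I. u i x))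
      = (\<lambda>x. jump_op k m (u i) x + jump_op k m (\<lambda>x. \<Sum>i\<in>I. u i x) x)"
    using insert.prems by (intro jump_op_add k) auto
  with insert show ?case by simp
qed

lemma jump_op_pow_cmult:
  assumes k [measurable]: "case_prod k \<in> borel_measurable (lborel \<Otimes>\<^sub>M lborel)"
    and [measurable]: "m \<in> borel_measurable borel" "u \<in> borel_measurable borel"
  shows "(jump_op k m ^^ n) (\<lambda>x. c * u x) = (\<lambda>x. c * (jump_op k m ^^ n) u x)"
  by (induction n) (simp_all add: jump_op_cmult)

lemma jump_op_pow_sum:
  assumes k [measurable]: "case_prod k \<in> borel_measurable (lborel \<Otimes>\<^sub>M lborel)"
    and [measurable]: "m \<in> borel_measurable borel"
    and u: "\<And>i. i \<in> I \<Longrightarrow> u i \<in> borel_measurable borel" and "finite I"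
  shows "(jump_op k m ^^ n) (\<lambda>x. \<Sum>i\<in>I. u i x) = (\<lambda>x. \<Sum>i\<in>I. (jump_op k m ^^ n) (u i) x)"
proof (induction n)
  case (Suc n)
  then show ?case
    using u by (simp add: jump_op_sum[OF k _ \<open>finite I\<close>])
qed simp

lemma jump_op_pow_supersolution:
  assumes k [measurable]: "case_prod k \<in> borel_measurable (lborel \<Otimes>\<^sub>M lborel)"
    and [measurable]: "m \<in> borel_measurable borel" "u \<in> borel_measurable borel"
    and le: "\<And>x. jump_op k m u x \<le> c * u x"
  shows "(jump_op k m ^^ n) u x \<le> c ^ n * u x"
proof (induction n arbitrary: x)
  case (Suc n)
  have "(jump_op k m ^^ Suc n) u x \<le> jump_op k m (\<lambda>x. c ^ n * u x) x"
    using Suc by (auto intro!: jump_op_mono)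
  also have "\<dots> = c ^ n * jump_op k m u x"
    by (simp add: jump_op_cmult)
  also have "\<dots> \<le> c ^ n * (c * u x)"
    by (intro mult_left_mono le) auto
  finally show ?case by (simp add: mult_ac)
qed simp

text \<open>Tonelli exchanges the two integrations and symmetry of k exchanges its arguments; the
  multiplication part is symmetric by itself.\<close>

lemma jump_op_dual:
  assumes k [measurable]: "case_prod k \<in> borel_measurable (lborel \<Otimes>\<^sub>M lborel)"
    and [measurable]: "m \<in> borel_measurable borel" "u \<in> borel_measurable borel"
      "v \<in> borel_measurable borel"
    and sym: "\<And>x y. k x y = k y x"
  shows "(\<integral>\<^sup>+x. u x * jump_op k m v x \<partial>lborel) = (\<integral>\<^sup>+x. jump_op k m u x * v x \<partial>lborel)"
proof -
  note [measurable] = measurable_kernel_section[OF k]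
  have *: "(\<lambda>x. \<integral>\<^sup>+y. k x y * w y \<partial>lborel) \<in> borel_measurable lborel"
    if [measurable]: "w \<in> borel_measurable borel" for w
    by (rule lborel.borel_measurable_nn_integral) measurable
  note [measurable] = *[OF \<open>u \<in> _\<close>] *[OF \<open>v \<in> _\<close>]
  have "(\<integral>\<^sup>+x. u x * (\<integral>\<^sup>+y. k x y * v y \<partial>lborel) \<partial>lborel)
      = (\<integral>\<^sup>+x. \<integral>\<^sup>+y. u x * (k x y * v y) \<partial>lborel \<partial>lborel)"
    by (intro nn_integral_cong nn_integral_cmult[symmetric]) auto
  also have "\<dots> = (\<integral>\<^sup>+y. \<integral>\<^sup>+x. u x * (k x y * v y) \<partial>lborel \<partial>lborel)"
    by (rule lborel_pair.Fubini'[symmetric]) measurable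
  also have "\<dots> = (\<integral>\<^sup>+y. \<integral>\<^sup>+x. (k y x * u x) * v y \<partial>lborel \<partial>lborel)"
    by (intro nn_integral_cong) (simp add: mult_ac sym)
  also have "\<dots> = (\<integral>\<^sup>+y. (\<integral>\<^sup>+x. k y x * u x \<partial>lborel) * v y \<partial>lborel)"
    by (intro nn_integral_cong nn_integral_multc) auto
  finally show ?thesis
    by (simp add: jump_op_def distrib_left distrib_right nn_integral_add mult_ac)
qed

lemma jump_op_pow_dual:
  assumes k [measurable]: "case_prod k \<in> borel_measurable (lborel \<Otimes>\<^sub>M lborel)"
    and [measurable]: "m \<in> borel_measurable borel" "u \<in> borel_measurable borel"
      "v \<in> borel_measurable borel"
    and sym: "\<And>x y. k x y = k y x"
  shows "(\<integral>\<^sup>+x. u x * (jump_op k m ^^ n) v x \<partial>lborel) = (\<integral>\<^sup>+x. (jump_op k m ^^ n) u x * v x \<partial>lborel)"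
  using assms(4)
proof (induction n arbitrary: v)
  case (Suc n)
  note [measurable] = Suc.prems
  have "(\<integral>\<^sup>+x. u x * (jump_op k m ^^ Suc n) v x \<partial>lborel)
      = (\<integral>\<^sup>+x. u x * (jump_op k m ^^ n) (jump_op k m v) x \<partial>lborel)"
    by (simp add: funpow_swap1)
  also have "\<dots> = (\<integral>\<^sup>+x. (jump_op k m ^^ n) u x * jump_op k m v x \<partial>lborel)"
    by (rule Suc.IH) measurable
  also have "\<dots> = (\<integral>\<^sup>+x. jump_op k m ((jump_op k m ^^ n) u) x * v x \<partial>lborel)"
    by (rule jump_op_dual) (use sym in auto)
  finally show ?case by simp
qed simp

text \<open>Discrete Duhamel formula: expand the product of n factors k + b at its leftmost b,
  leaving the full operator to the right of it. In the induction the outermost factor is peeled off,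
  and its b part becomes the term i = 0.\<close>

lemma jump_op_duhamel:
  assumes k [measurable]: "case_prod k \<in> borel_measurable (lborel \<Otimes>\<^sub>M lborel)"
    and b [measurable]: "case_prod b \<in> borel_measurable (lborel \<Otimes>\<^sub>M lborel)"
    and [measurable]: "m \<in> borel_measurable borel" "u \<in> borel_measurable borel"
    and split: "\<And>x y. l x y = k x y + b x y"
  shows "(jump_op l m ^^ n) u = (\<lambda>x. (jump_op k m ^^ n) u x +
    (\<Sum>i<n. (jump_op k m ^^ i) (\<lambda>z. \<integral>\<^sup>+w. b z w * (jump_op l m ^^ (n - Suc i)) u w \<partial>lborel) x))"
proof (induction n)
  case (Suc n)
  have l: "l = (\<lambda>x y. k x y + b x y)"
    using split by (simp add: fun_eq_iff)
  have lm [measurable]: "case_prod l \<in> borel_measurable (lborel \<Otimes>\<^sub>M lborel)"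
    unfolding l by measurable
  define B where "B i = (\<lambda>z. \<integral>\<^sup>+w. b z w * (jump_op l m ^^ i) u w \<partial>lborel)" for i
  have B [measurable]: "B i \<in> borel_measurable borel" for i
  proof -
    have "B i \<in> borel_measurable lborel"
      unfolding B_def by (rule lborel.borel_measurable_nn_integral) measurable
    then show ?thesis by simp
  qed
  note [measurable] = measurable_kernel_section[OF k] measurable_kernel_section[OF b]
  have "(jump_op l m ^^ Suc n) u = (\<lambda>x. jump_op k m ((jump_op l m ^^ n) u) x + B n x)"
    unfolding B_def by (simp add: fun_eq_iff jump_op_def split distrib_right nn_integral_add add_ac)
  also have "jump_op k m ((jump_op l m ^^ n) u)
      = (\<lambda>x. (jump_op k m ^^ Suc n) u x + (\<Sum>i<n. (jump_op k m ^^ Suc i) (B (n - Suc i)) x))"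
    unfolding Suc.IH B_def[symmetric]
    by (subst jump_op_add; (subst jump_op_sum)?) (auto simp: k)
  finally show ?case
    unfolding B_def[symmetric] sum.lessThan_Suc_shift by (simp add: add_ac)
qed simp

section \<open>Growth of powers on functions of at most exponential variation\<close>

abbreviation directions :: "'a::euclidean_space set"
  where "directions \<equiv> Basis \<union> uminus ` Basis"

text \<open>The l1 norm dominates the Euclidean norm, so some coordinate has at least the fraction
  1/d of it; the sign of that coordinate decides between b and - b.\<close>

lemma norm_le_DIM_mult_inner_direction:
  fixes v :: "'a::euclidean_space"
  obtains e where "e \<in> directions" "norm v \<le> DIM('a) * (v \<bullet> e)"
proof -
  have "\<exists>b\<in>Basis. norm v \<le> DIM('a) * \<bar>v \<bullet> b\<bar>"
  proof (rule ccontr)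
    assume "\<not> ?thesis"
    then have "\<bar>v \<bullet> b\<bar> < norm v / DIM('a)" if "b \<in> Basis" for b
      using that by (force simp: field_simps not_le)
    then have "(\<Sum>b\<in>Basis. \<bar>v \<bullet> b\<bar>) < (\<Sum>b\<in>(Basis::'a set). norm v / DIM('a))"
      by (intro sum_strict_mono) auto
    with norm_le_l1[of v] show False by simp
  qed
  then obtain b where b: "b \<in> Basis" "norm v \<le> DIM('a) * \<bar>v \<bullet> b\<bar>" by blast
  show thesis
  proof (cases "v \<bullet> b \<ge> 0")
    case True
    then show ?thesis using b by (intro that[of b]) auto
  next
    case False
    then show ?thesis using b by (intro that[of "- b"]) auto
  qed
qed

lemma card_directions_le: "card (directions :: 'a::euclidean_space set) \<le> 2 * DIM('a)"
proof -
  have "card (directions :: 'a set) \<le> card (Basis :: 'a set) + card (uminus ` Basis :: 'a set)"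
    by (rule card_Un_le)
  also have "card (uminus ` Basis :: 'a set) \<le> DIM('a)"
    by (rule card_image_le) simp
  finally show ?thesis by simp
qed

text \<open>
  \<open>exp |z - x|\<close> is below a sum of exponentials of linear functions, so it is enough that these are
  supersolutions.
\<close>
lemma jump_op_pow_tempered:
  fixes V :: "'a::euclidean_space \<Rightarrow> ennreal"
  assumes k [measurable]: "case_prod k \<in> borel_measurable (lborel \<Otimes>\<^sub>M lborel)"
    and [measurable]: "m \<in> borel_measurable borel"
    and super: "\<And>e x z. e \<in> directions \<Longrightarrow>
      jump_op k m (\<lambda>z. ennreal (exp (\<kappa> * ((z - x) \<bullet> e)))) z
        \<le> q * ennreal (exp (\<kappa> * ((z - x) \<bullet> e)))"
    and "0 \<le> \<kappa>"
    and V: "\<And>x z. V z \<le> c * ennreal (exp (\<kappa> / DIM('a) * norm (z - x))) * V x"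
  shows "(jump_op k m ^^ n) V x \<le> of_nat (2 * DIM('a)) * c * q ^ n * V x"
proof -
  define u where "u e z = ennreal (exp (\<kappa> * ((z - x) \<bullet> e)))" for e z
  have [measurable]: "u e \<in> borel_measurable borel" for e
    unfolding u_def by measurable
  have "V z \<le> (\<Sum>e\<in>directions. c * V x * u e z)" for z
  proof -
    obtain e where e: "e \<in> directions" "norm (z - x) \<le> DIM('a) * ((z - x) \<bullet> e)"
      by (rule norm_le_DIM_mult_inner_direction)
    have "\<kappa> * (norm (z - x) / DIM('a)) \<le> \<kappa> * ((z - x) \<bullet> e)"
      using e(2) \<open>0 \<le> \<kappa>\<close> by (intro mult_left_mono) (auto simp: field_simps)
    then have *: "exp (\<kappa> / DIM('a) * norm (z - x)) \<le> exp (\<kappa> * ((z - x) \<bullet> e))"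
      by simp
    have "V z \<le> c * ennreal (exp (\<kappa> / DIM('a) * norm (z - x))) * V x"
      by (rule V)
    also have "\<dots> \<le> c * u e z * V x"
      unfolding u_def using * by (intro mult_mono ennreal_leI) auto
    also have "\<dots> \<le> (\<Sum>e\<in>directions. c * V x * u e z)"
      using member_le_sum[OF e(1), of "\<lambda>e. c * V x * u e z"] by (simp add: mult_ac)
    finally show ?thesis .
  qed
  then have "(jump_op k m ^^ n) V x \<le> (jump_op k m ^^ n) (\<lambda>z. \<Sum>e\<in>directions. c * V x * u e z) x"
    by (intro jump_op_pow_mono) auto
  also have "\<dots> = (\<Sum>e\<in>directions. c * V x * (jump_op k m ^^ n) (u e) x)"
    by (simp add: jump_op_pow_sum jump_op_pow_cmult)
  \<comment> \<open>The exponentials are centred at x, so each \<open>u e\<close> is 1 there and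
    only the factor q ^ n is left.\<close>
  also have "\<dots> \<le> (\<Sum>e\<in>(directions :: 'a set). c * V x * (q ^ n * 1))"
  proof (intro sum_mono mult_left_mono)
    fix e :: 'a assume "e \<in> directions"
    then have "(jump_op k m ^^ n) (u e) x \<le> q ^ n * u e x"
      unfolding u_def by (intro jump_op_pow_supersolution super) auto
    then show "(jump_op k m ^^ n) (u e) x \<le> q ^ n * 1"
      by (simp add: u_def)
  qed auto
  also have "\<dots> = of_nat (card (directions :: 'a set)) * (c * V x * q ^ n)"
    by simp
  also have "\<dots> \<le> of_nat (2 * DIM('a)) * (c * V x * q ^ n)"
    using card_directions_le by (intro mult_right_mono of_nat_mono) auto
  finally show ?thesis by (simp add: mult_ac)
qed

section \<open>Powers of an operator split into two kernels\<close>

lemma power_add_duhamel: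
  fixes q d :: "'a::comm_semiring_1"
  shows "q ^ n + d * (\<Sum>i<n. q ^ i * (q + d) ^ (n - Suc i)) = (q + d) ^ n"
proof (induction n)
  case (Suc n)
  have "(\<Sum>i<n. q ^ i * (q + d) ^ (n - i)) = (q + d) * (\<Sum>i<n. q ^ i * (q + d) ^ (n - Suc i))"
    unfolding sum_distrib_left
  proof (intro sum.cong refl)
    fix i assume "i \<in> {..<n}"
    then have "n - i = Suc (n - Suc i)" by auto
    then show "q ^ i * (q + d) ^ (n - i) = (q + d) * (q ^ i * (q + d) ^ (n - Suc i))"
      by (metis mult.left_commute power_Suc)
  qed
  then have "q ^ Suc n + d * (\<Sum>i<Suc n. q ^ i * (q + d) ^ (Suc n - Suc i))
      = (q + d) * (q ^ n + d * (\<Sum>i<n. q ^ i * (q + d) ^ (n - Suc i)))"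
    by (simp add: algebra_simps)
  with Suc show ?case by simp
qed simp

text \<open>Inserting both bounds into the Duhamel expansion reproduces the scalar expansion of a
  power of \<open>q + C * \<beta>\<close>. Each use of b thus costs one factor C inside the rate,
  while the prefactor stays C for all n.\<close>

lemma jump_op_pow_perturbed:
  assumes k [measurable]: "case_prod k \<in> borel_measurable (lborel \<Otimes>\<^sub>M lborel)"
    and b [measurable]: "case_prod b \<in> borel_measurable (lborel \<Otimes>\<^sub>M lborel)"
    and [measurable]: "m \<in> borel_measurable borel" "V \<in> borel_measurable borel"
    and split: "\<And>x y. l x y = k x y + b x y"
    and S: "\<And>n x. (jump_op k m ^^ n) V x \<le> C * q ^ n * V x"
    and B: "\<And>x. (\<integral>\<^sup>+y. b x y * V y \<partial>lborel) \<le> \<beta> * V x"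
  shows "(jump_op l m ^^ n) V x \<le> C * (q + C * \<beta>) ^ n * V x"
proof (induction n arbitrary: x rule: less_induct)
  case (less n)
  let ?Q = "q + C * \<beta>"
  note [measurable] = measurable_kernel_section[OF b]
  have *: "(jump_op k m ^^ i) (\<lambda>z. \<integral>\<^sup>+w. b z w * (jump_op l m ^^ j) V w \<partial>lborel) x
      \<le> C * ?Q ^ j * \<beta> * (C * q ^ i * V x)" if "j < n" for i j
  proof -
    have "(\<integral>\<^sup>+w. b z w * (jump_op l m ^^ j) V w \<partial>lborel) \<le> C * ?Q ^ j * \<beta> * V z" for z
    proof -
      have "(\<integral>\<^sup>+w. b z w * (jump_op l m ^^ j) V w \<partial>lborel)
          \<le> (\<integral>\<^sup>+w. C * ?Q ^ j * (b z w * V w) \<partial>lborel)"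
      proof (intro nn_integral_mono)
        fix w
        have "b z w * (jump_op l m ^^ j) V w \<le> b z w * (C * ?Q ^ j * V w)"
          by (intro mult_left_mono less that) auto
        then show "b z w * (jump_op l m ^^ j) V w \<le> C * ?Q ^ j * (b z w * V w)"
          by (metis mult.left_commute)
      qed
      also have "\<dots> = C * ?Q ^ j * (\<integral>\<^sup>+w. b z w * V w \<partial>lborel)"
        by (rule nn_integral_cmult) measurable
      also have "\<dots> \<le> C * ?Q ^ j * (\<beta> * V z)"
        by (intro mult_left_mono B) auto
      finally show ?thesis by (simp add: mult_ac)
    qed
    then have "(jump_op k m ^^ i) (\<lambda>z. \<integral>\<^sup>+w. b z w * (jump_op l m ^^ j) V w \<partial>lborel) x
        \<le> (jump_op k m ^^ i) (\<lambda>z. C * ?Q ^ j * \<beta> * V z) x"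
      by (intro jump_op_pow_mono) auto
    also have "\<dots> = C * ?Q ^ j * \<beta> * (jump_op k m ^^ i) V x"
      by (subst jump_op_pow_cmult) (auto simp: k)
    finally show ?thesis
      using S[of i x] by (meson dual_order.trans mult_left_mono zero_le)
  qed
  have "(jump_op l m ^^ n) V x \<le> C * q ^ n * V x + (\<Sum>i<n. C * ?Q ^ (n - Suc i) * \<beta> * (C * q ^ i * V x))"
    by (subst jump_op_duhamel[OF k b \<open>m \<in> _\<close> \<open>V \<in> _\<close> split])
      (intro add_mono S sum_mono *, auto)
  also have "\<dots> = C * V x * (q ^ n + C * \<beta> * (\<Sum>i<n. q ^ i * ?Q ^ (n - Suc i)))"
    by (simp add: distrib_left sum_distrib_left mult_ac)
  \<comment> \<open>\<open>power_add_duhamel\<close> is the scalar Duhamel formula; it is free of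
    subtraction, which is truncated on \<open>ennreal\<close>.\<close>
  also have "\<dots> = C * ?Q ^ n * V x"
    unfolding power_add_duhamel by (simp only: mult_ac)
  finally show ?case .
qed

text \<open>In the Duhamel term with i powers of k, replace b by a multiple of h, move the powers of
  l from g to h by self-adjointness, and absorb the powers of k in the potential of g. Growth bounds
  are then needed only for h and for the potential, never for g itself.\<close>

lemma jump_op_pow_split_le:
  assumes k [measurable]: "case_prod k \<in> borel_measurable (lborel \<Otimes>\<^sub>M lborel)"
    and b [measurable]: "case_prod b \<in> borel_measurable (lborel \<Otimes>\<^sub>M lborel)"
    and h [measurable]: "case_prod h \<in> borel_measurable (lborel \<Otimes>\<^sub>M lborel)"
    and [measurable]: "m \<in> borel_measurable borel" "g \<in> borel_measurable borel"
    and split: "\<And>x y. l x y = k x y + b x y"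
    and sym: "\<And>x y. l x y = l y x"
    and b_le: "\<And>x y. b x y \<le> a * h x y"
    and T: "\<And>n x y. (jump_op l m ^^ n) (h x) y \<le> C * q ^ n * h x y"
    and S: "\<And>n x. (jump_op k m ^^ n) (\<lambda>z. \<integral>\<^sup>+w. h z w * g w \<partial>lborel) x
      \<le> C * q ^ n * (\<integral>\<^sup>+w. h x w * g w \<partial>lborel)"
  shows "(jump_op l m ^^ n) g x \<le> (jump_op k m ^^ n) g x +
    of_nat n * (a * C\<^sup>2 * q ^ (n - 1) * (\<integral>\<^sup>+w. h x w * g w \<partial>lborel))"
proof -
  define V where "V = (\<lambda>z. \<integral>\<^sup>+w. h z w * g w \<partial>lborel)"
  note [measurable] = measurable_kernel_section[OF h]
  have "V \<in> borel_measurable lborel"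
    unfolding V_def by (rule lborel.borel_measurable_nn_integral) measurable
  then have [measurable]: "V \<in> borel_measurable borel" by simp
  have l: "l = (\<lambda>x y. k x y + b x y)"
    using split by (simp add: fun_eq_iff)
  have [measurable]: "case_prod l \<in> borel_measurable (lborel \<Otimes>\<^sub>M lborel)"
    unfolding l by measurable
  have B: "(\<integral>\<^sup>+w. b z w * (jump_op l m ^^ j) g w \<partial>lborel) \<le> a * C * q ^ j * V z" for z j
  proof -
    have "(\<integral>\<^sup>+w. b z w * (jump_op l m ^^ j) g w \<partial>lborel)
        \<le> (\<integral>\<^sup>+w. a * (h z w * (jump_op l m ^^ j) g w) \<partial>lborel)"
      using b_le by (intro nn_integral_mono) (auto simp: mult.assoc[symmetric] intro: mult_right_mono)
    also have "\<dots> = a * (\<integral>\<^sup>+w. h z w * (jump_op l m ^^ j) g w \<partial>lborel)"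
      by (rule nn_integral_cmult) measurable
    \<comment> \<open>Duality moves the power from the arbitrary g to the kernel h, whose growth is
      known.\<close>
    also have "(\<integral>\<^sup>+w. h z w * (jump_op l m ^^ j) g w \<partial>lborel)
        = (\<integral>\<^sup>+w. (jump_op l m ^^ j) (h z) w * g w \<partial>lborel)"
      using sym by (intro jump_op_pow_dual) auto
    also have "a * \<dots> \<le> a * (\<integral>\<^sup>+w. C * q ^ j * (h z w * g w) \<partial>lborel)"
      using T by (intro mult_left_mono nn_integral_mono)
        (auto simp: mult.assoc[symmetric] intro: mult_right_mono)
    also have "(\<integral>\<^sup>+w. C * q ^ j * (h z w * g w) \<partial>lborel) = C * q ^ j * V z"
      unfolding V_def by (rule nn_integral_cmult) measurable
    finally show ?thesis by (simp add: mult.assoc)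
  qed
  have *: "(jump_op k m ^^ i) (\<lambda>z. \<integral>\<^sup>+w. b z w * (jump_op l m ^^ (n - Suc i)) g w \<partial>lborel) x
      \<le> a * C\<^sup>2 * q ^ (n - 1) * V x" if "i < n" for i
  proof -
    have "(jump_op k m ^^ i) (\<lambda>z. \<integral>\<^sup>+w. b z w * (jump_op l m ^^ (n - Suc i)) g w \<partial>lborel) x
        \<le> (jump_op k m ^^ i) (\<lambda>z. a * C * q ^ (n - Suc i) * V z) x"
      using B by (intro jump_op_pow_mono) auto
    also have "\<dots> = a * C * q ^ (n - Suc i) * (jump_op k m ^^ i) V x"
      by (subst jump_op_pow_cmult) (auto simp: k)
    also have "\<dots> \<le> a * C * q ^ (n - Suc i) * (C * q ^ i * V x)"
      using S[of i x] by (intro mult_left_mono) (auto simp: V_def)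
    also have "\<dots> = a * C\<^sup>2 * (q ^ (n - Suc i) * q ^ i) * V x"
      by (simp add: power2_eq_square mult_ac)
    \<comment> \<open>The exponents add up to n - 1 for every i, so the n Duhamel terms share one
      bound.\<close>
    also have "q ^ (n - Suc i) * q ^ i = q ^ (n - 1)"
      using that by (simp flip: power_add)
    finally show ?thesis .
  qed
  have "(jump_op l m ^^ n) g x \<le> (jump_op k m ^^ n) g x + (\<Sum>i<n. a * C\<^sup>2 * q ^ (n - 1) * V x)"
    by (subst jump_op_duhamel[OF k b \<open>m \<in> _\<close> \<open>g \<in> _\<close> split])
      (intro add_mono sum_mono *, auto)
  then show ?thesis by (simp add: V_def)
qed

subsection \<open>Integrals of powers of the norm\<close>

lemma nn_integral_lborel_shift:
  fixes F :: "'a::euclidean_space \<Rightarrow> ennreal"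
  assumes [measurable]: "F \<in> borel_measurable borel"
  shows "(\<integral>\<^sup>+z. F (z - x) \<partial>lborel) = (\<integral>\<^sup>+z. F z \<partial>lborel)"
proof -
  have "(\<integral>\<^sup>+z. F z \<partial>lborel) = (\<integral>\<^sup>+z. F z \<partial>distr lborel borel ((+) (- x)))"
    by (simp add: lborel_distr_plus)
  also have "\<dots> = (\<integral>\<^sup>+z. F (- x + z) \<partial>lborel)"
    by (rule nn_integral_distr) auto
  finally show ?thesis by simp
qed

lemma nn_integral_lborel_reflect:
  fixes F :: "'a::euclidean_space \<Rightarrow> ennreal"
  assumes [measurable]: "F \<in> borel_measurable borel"
  shows "(\<integral>\<^sup>+z. F (- z) \<partial>lborel) = (\<integral>\<^sup>+z. F z \<partial>lborel)"
proof -
  have "(lborel :: 'a measure) = distr lborel borel uminus"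
    using lborel_affine[of "-1" "0::'a"] by (simp add: density_1)
  then have "(\<integral>\<^sup>+z. F z \<partial>lborel) = (\<integral>\<^sup>+z. F z \<partial>distr lborel borel uminus)"
    by simp
  also have "\<dots> = (\<integral>\<^sup>+z. F (- z) \<partial>lborel)"
    by (rule nn_integral_distr) auto
  finally show ?thesis by simp
qed

text \<open>F lies below the sum of the constants a n on the balls of radius r n, and the ball
  volumes turn this sum into a geometric series.\<close>

lemma nn_integral_le_geometric_balls:
  fixes F :: "'a::euclidean_space \<Rightarrow> ennreal" and a r :: "nat \<Rightarrow> real"
  assumes a: "\<And>n. 0 \<le> a n" and r: "\<And>n. 0 \<le> r n"
    and cover: "\<And>h. F h \<noteq> 0 \<Longrightarrow> \<exists>n. norm h \<le> r n \<and> F h \<le> ennreal (a n)"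
    and geometric: "\<And>n. a n * r n ^ DIM('a) = c * \<rho> ^ n"
    and "0 \<le> c" "0 \<le> \<rho>" "\<rho> < 1"
  shows "(\<integral>\<^sup>+h. F h \<partial>lborel) \<le> ennreal (unit_ball_vol DIM('a) / (1 - \<rho>) * c)"
proof -
  have "F h \<le> (\<Sum>n. ennreal (a n) * indicator (cball 0 (r n)) h)" for h
  proof (cases "F h = 0")
    case False
    then obtain n where n: "norm h \<le> r n" "F h \<le> ennreal (a n)" using cover by blast
    then have "F h \<le> ennreal (a n) * indicator (cball 0 (r n)) h" by simp
    also have "\<dots> \<le> (\<Sum>n. ennreal (a n) * indicator (cball 0 (r n)) h)"
    proof -
      define t where "t n = ennreal (a n) * indicator (cball 0 (r n)) h" for n
      show ?thesis
        using sum_le_suminf[of t "{n}"] unfolding t_def[symmetric] by simp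
    qed
    finally show ?thesis .
  qed simp
  then have "(\<integral>\<^sup>+h. F h \<partial>lborel)
      \<le> (\<integral>\<^sup>+(h::'a). (\<Sum>n. ennreal (a n) * indicator (cball 0 (r n)) h) \<partial>lborel)"
    by (intro nn_integral_mono) auto
  also have "\<dots> = (\<Sum>n. ennreal (a n) * emeasure lborel (cball (0::'a) (r n)))"
  proof -
    have "(\<integral>\<^sup>+(h::'a). ennreal (a n) * indicator (cball 0 (r n)) h \<partial>lborel)
        = ennreal (a n) * emeasure lborel (cball (0::'a) (r n))" for n
      by (rule nn_integral_cmult_indicator) simp
    moreover have "(\<lambda>h::'a. ennreal (a n) * indicator (cball 0 (r n)) h) \<in> borel_measurable lborel" for n
      by (intro borel_measurable_times_ennreal borel_measurable_const borel_measurable_indicator) simp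
    ultimately show ?thesis
      by (simp only: nn_integral_suminf)
  qed
  also have "\<dots> = (\<Sum>n. ennreal (unit_ball_vol DIM('a) * c * \<rho> ^ n))"
  proof (intro suminf_cong)
    fix n
    have "ennreal (a n) * emeasure lborel (cball (0::'a) (r n))
        = ennreal (a n * (unit_ball_vol DIM('a) * r n ^ DIM('a)))"
      using a r by (simp add: emeasure_cball ennreal_mult')
    also have "a n * (unit_ball_vol DIM('a) * r n ^ DIM('a)) = unit_ball_vol DIM('a) * c * \<rho> ^ n"
      using geometric[of n] by (simp add: mult_ac)
    finally show "ennreal (a n) * emeasure lborel (cball (0::'a) (r n))
        = ennreal (unit_ball_vol DIM('a) * c * \<rho> ^ n)" .
  qed
  also have "\<dots> = ennreal (unit_ball_vol DIM('a) * c * (1 / (1 - \<rho>)))"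
    using assms(5-7) by (intro suminf_ennreal_eq sums_mult geometric_sums) auto
  finally show ?thesis by simp
qed

text \<open>The ball of radius 2^(n+1) \<delta> with height (2^n \<delta>)^-(\<alpha>+d) contributes
  a multiple of 2^(-n \<alpha>) \<delta>^-\<alpha>, which is summable because \<alpha> > 0.\<close>

lemma nn_integral_capped_power:
  fixes \<alpha> :: real
  assumes "0 < \<alpha>"
  shows "\<exists>K>0. \<forall>\<delta>>0. (\<integral>\<^sup>+(h::'a::euclidean_space).
    ennreal (max (norm h) \<delta> powr - (\<alpha> + real DIM('a))) \<partial>lborel) \<le> ennreal (K * \<delta> powr - \<alpha>)"
proof (intro exI conjI allI impI)
  let ?d = "DIM('a)" and ?s = "\<alpha> + real DIM('a)"
  let ?\<rho> = "2 powr - \<alpha>"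
  have \<rho>: "0 \<le> ?\<rho>" "?\<rho> < 1"
    using assms powr_less_mono[of "- \<alpha>" 0 2] by auto
  show "0 < unit_ball_vol ?d / (1 - ?\<rho>) * 2 ^ ?d"
    using \<rho> by simp
  fix \<delta> :: real assume \<delta>: "0 < \<delta>"
  have "(\<integral>\<^sup>+(h::'a). ennreal (max (norm h) \<delta> powr - ?s) \<partial>lborel)
      \<le> ennreal (unit_ball_vol ?d / (1 - ?\<rho>) * (2 ^ ?d * \<delta> powr - \<alpha>))"
  proof (rule nn_integral_le_geometric_balls)
    show "0 \<le> (2 ^ n * \<delta>) powr - ?s" "0 \<le> 2 ^ Suc n * \<delta>" for n
      using \<delta> by auto
    show "(2 ^ n * \<delta>) powr - ?s * (2 ^ Suc n * \<delta>) ^ ?d = 2 ^ ?d * \<delta> powr - \<alpha> * ?\<rho> ^ n" for n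
      using \<delta> by (simp add: powr_mult powr_diff powr_minus powr_add powr_power field_simps
          flip: powr_realpow) (simp add: powr_powr mult_ac flip: powr_add)
    show "\<exists>n. norm h \<le> 2 ^ Suc n * \<delta> \<and> ennreal (max (norm h) \<delta> powr - ?s) \<le> ennreal ((2 ^ n * \<delta>) powr - ?s)"
      for h :: 'a
    proof -
      define P where "P n \<longleftrightarrow> max (norm h) \<delta> \<le> 2 ^ Suc n * \<delta>" for n
      define n where "n = (LEAST n. P n)"
      obtain k where "max (norm h) \<delta> / \<delta> < 2 ^ k"
        using real_arch_pow[of 2] by auto
      moreover have "(2::real) ^ k \<le> 2 ^ Suc k" by simp
      ultimately have "max (norm h) \<delta> / \<delta> \<le> 2 ^ Suc k" by linarith
      then have "P k" using \<delta> by (simp add: P_def pos_divide_le_eq)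
      then have n: "P n" unfolding n_def by (rule LeastI)
      \<comment> \<open>For n > 0 this is minimality of n; for n = 0 the cap at \<delta> supplies
        it.\<close>
      have "2 ^ n * \<delta> \<le> max (norm h) \<delta>"
      proof (cases n)
        case (Suc m)
        then have "\<not> P m" unfolding n_def using not_less_Least[of m P] by simp
        then have "2 ^ n * \<delta> < max (norm h) \<delta>" by (simp add: P_def Suc not_le del: max_less_iff_conj max.bounded_iff less_max_iff_disj)
        then show ?thesis by simp
      qed auto
      then have "max (norm h) \<delta> powr - ?s \<le> (2 ^ n * \<delta>) powr - ?s"
        using \<delta> assms by (intro powr_mono2') auto
      with n show ?thesis
        unfolding P_def by (intro exI[of _ n]) (auto intro: ennreal_leI)
    qed
  qed (use \<rho> in auto)
  then show "(\<integral>\<^sup>+(h::'a). ennreal (max (norm h) \<delta> powr - ?s) \<partial>lborel)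
      \<le> ennreal (unit_ball_vol ?d / (1 - ?\<rho>) * 2 ^ ?d * \<delta> powr - \<alpha>)"
    by (simp add: mult_ac)
qed

text \<open>The shell of outer radius \<delta>/2^n contributes a multiple of 2^(n(\<alpha>-p))
  \<delta>^(p-\<alpha>); the condition p > \<alpha> beats the singularity at the origin.\<close>

lemma nn_integral_small_power:
  fixes \<alpha> p :: real
  assumes "0 < \<alpha>" "\<alpha> < p"
  shows "\<exists>K>0. \<forall>\<delta>>0. (\<integral>\<^sup>+h\<in>{h::'a::euclidean_space. 0 < norm h \<and> norm h \<le> \<delta>}.
    ennreal (norm h powr (p - (\<alpha> + real DIM('a)))) \<partial>lborel) \<le> ennreal (K * \<delta> powr (p - \<alpha>))"
proof (intro exI conjI allI impI)
  let ?d = "DIM('a)" and ?s = "\<alpha> + real DIM('a)"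
  let ?\<rho> = "2 powr (\<alpha> - p)"
  have \<rho>: "0 \<le> ?\<rho>" "?\<rho> < 1"
    using assms powr_less_mono[of "\<alpha> - p" 0 2] by auto
  show "0 < unit_ball_vol ?d / (1 - ?\<rho>) * 2 powr ?s"
    using \<rho> by simp
  fix \<delta> :: real assume \<delta>: "0 < \<delta>"
  let ?F = "\<lambda>h::'a. ennreal (norm h powr (p - ?s)) * indicator {h. 0 < norm h \<and> norm h \<le> \<delta>} h"
  have "(\<integral>\<^sup>+h. ?F h \<partial>lborel)
      \<le> ennreal (unit_ball_vol ?d / (1 - ?\<rho>) * (2 powr ?s * \<delta> powr (p - \<alpha>)))"
  proof (rule nn_integral_le_geometric_balls)
    \<comment> \<open>The factor with exponent p is estimated at the outer radius and the singular
      factor at the inner one, which is correct for either sign of the total exponent.\<close>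
    show "0 \<le> (\<delta> / 2 ^ n) powr p * (\<delta> / 2 ^ Suc n) powr - ?s" "0 \<le> \<delta> / 2 ^ n" for n
      using \<delta> by auto
    show "(\<delta> / 2 ^ n) powr p * (\<delta> / 2 ^ Suc n) powr - ?s * (\<delta> / 2 ^ n) ^ ?d
        = 2 powr ?s * \<delta> powr (p - \<alpha>) * ?\<rho> ^ n" for n
    proof -
      define y where "y = \<delta> / 2 ^ n"
      have y: "0 < y" using \<delta> by (simp add: y_def)
      have "(\<delta> / 2 ^ n) powr p * (\<delta> / 2 ^ Suc n) powr - ?s * (\<delta> / 2 ^ n) ^ ?d
          = y powr p * (y / 2) powr - ?s * y powr ?d"
        using y by (simp add: y_def powr_realpow mult.commute)
      also have "(y / 2) powr - ?s = y powr - ?s * 2 powr ?s"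
        using y powr_add[of 2 "?s" "- ?s"] by (simp add: powr_divide field_simps)
      also have "y powr p * (y powr - ?s * 2 powr ?s) * y powr ?d = 2 powr ?s * y powr (p - \<alpha>)"
        by (simp add: algebra_simps flip: powr_add)
      also have "y powr (p - \<alpha>) = \<delta> powr (p - \<alpha>) * (2 ^ n) powr (\<alpha> - p)"
        using \<delta> by (simp add: y_def powr_divide powr_diff field_simps)
      also have "(2 ^ n) powr (\<alpha> - p) = ?\<rho> ^ n"
        by (simp add: powr_powr mult_ac flip: powr_realpow)
      finally show ?thesis by (simp add: mult_ac)
    qed
    show "\<exists>n. norm h \<le> \<delta> / 2 ^ n \<and> ?F h \<le> ennreal ((\<delta> / 2 ^ n) powr p * (\<delta> / 2 ^ Suc n) powr - ?s)"
      if "?F h \<noteq> 0" for h :: 'a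
    proof -
      have h: "0 < norm h" "norm h \<le> \<delta>"
        using that by (auto simp: indicator_def split: if_splits)
      define P where "P n \<longleftrightarrow> \<delta> / 2 ^ Suc n < norm h" for n
      define n where "n = (LEAST n. P n)"
      obtain k where "\<delta> / norm h < 2 ^ k"
        using real_arch_pow[of 2] by auto
      moreover have "(2::real) ^ k \<le> 2 ^ Suc k" by simp
      ultimately have "\<delta> / norm h < 2 ^ Suc k" by linarith
      then have "P k" using h by (simp add: P_def field_simps)
      then have n: "P n" unfolding n_def by (rule LeastI)
      have n': "norm h \<le> \<delta> / 2 ^ n"
      proof (cases n)
        case (Suc m)
        then have "\<not> P m" unfolding n_def using not_less_Least[of m P] by simp
        then show ?thesis using Suc by (simp add: P_def)
      qed (use h in auto)
      have "norm h powr (p - ?s) = norm h powr p * norm h powr - ?s"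
        by (simp add: algebra_simps flip: powr_add)
      also have "\<dots> \<le> (\<delta> / 2 ^ n) powr p * (\<delta> / 2 ^ Suc n) powr - ?s"
        using n n' h \<delta> assms unfolding P_def by (intro mult_mono powr_mono2 powr_mono2') auto
      finally show ?thesis
        using h n' by (intro exI[of _ n]) (auto intro: ennreal_leI)
    qed
  qed (use \<rho> in auto)
  then show "(\<integral>\<^sup>+h. ?F h \<partial>lborel)
      \<le> ennreal (unit_ball_vol ?d / (1 - ?\<rho>) * 2 powr ?s * \<delta> powr (p - \<alpha>))"
    by (simp add: mult_ac)
qed

subsection \<open>The capped jump bound\<close>

locale jump_profile =
  fixes \<alpha> c1 :: real and \<phi> :: "real \<Rightarrow> real"
  assumes alpha_pos: "0 < \<alpha>"
    and phi_borel: "\<phi> \<in> borel_measurable (restrict_space borel {0..})"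
    and phi_pos: "\<And>a. 0 \<le> a \<Longrightarrow> 0 < \<phi> a"
    and phi_le_1: "\<And>a. 0 \<le> a \<Longrightarrow> \<phi> a \<le> 1"
    and phi_eq_1: "\<And>a. 0 \<le> a \<Longrightarrow> a \<le> 1 \<Longrightarrow> \<phi> a = 1"
    and phi_growth: "\<And>a b. 0 \<le> a \<Longrightarrow> 0 \<le> b \<Longrightarrow> \<bar>a - b\<bar> \<le> 1 \<Longrightarrow> \<phi> a \<le> c1 * \<phi> b"
begin

lemma c1_ge_1: "1 \<le> c1"
  using phi_growth[of 0 0] phi_pos[of 0] by simp

lemma phi_growth_nat:
  assumes "0 \<le> a" "0 \<le> b" "\<bar>a - b\<bar> \<le> real n"
  shows "\<phi> a \<le> c1 ^ n * \<phi> b"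
  using assms
proof (induction n arbitrary: a)
  case (Suc n)
  \<comment> \<open>Going the fraction 1/(n+1) of the way to b costs one factor c1 and leaves a
    distance of at most n.\<close>
  define c where "c = a + (b - a) / real (Suc n)"
  have "\<bar>a - c\<bar> = \<bar>a - b\<bar> / real (Suc n)"
    unfolding c_def by (simp add: abs_minus_commute)
  also have "\<dots> \<le> 1"
    using Suc.prems by simp
  finally have 1: "\<bar>a - c\<bar> \<le> 1" .
  have eq: "c - b = (a - b) * (real n / real (Suc n))"
    unfolding c_def by (simp add: field_simps)
  have "\<bar>c - b\<bar> = \<bar>a - b\<bar> * (real n / real (Suc n))"
    unfolding eq abs_mult by simp
  also have "\<dots> \<le> real (Suc n) * (real n / real (Suc n))"
    using Suc.prems by (intro mult_right_mono) auto
  finally have 2: "\<bar>c - b\<bar> \<le> real n" by simp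
  have "c * real (Suc n) = a * real n + b"
    unfolding c_def by (simp add: field_simps del: of_nat_Suc) (simp add: algebra_simps)
  then have "0 \<le> c * real (Suc n)" using Suc.prems by simp
  then have "0 \<le> c" by (simp add: zero_le_mult_iff)
  then have "\<phi> a \<le> c1 * \<phi> c" "\<phi> c \<le> c1 ^ n * \<phi> b"
    using Suc 1 2 by (auto intro: phi_growth)
  then have "\<phi> a \<le> c1 * (c1 ^ n * \<phi> b)"
    using c1_ge_1 by (meson dual_order.trans mult_left_mono order.trans zero_le_one)
  then show ?case by (simp add: mult_ac)
qed simp

text \<open>Cover the distance by unit steps; rounding their number up causes the extra factor
  c1.\<close>

lemma phi_growth_exp:
  assumes "0 \<le> a" "0 \<le> b"
  shows "\<phi> a \<le> c1 * exp (ln c1 * \<bar>a - b\<bar>) * \<phi> b"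
proof -
  define n where "n = nat \<lceil>\<bar>a - b\<bar>\<rceil>"
  have n: "\<bar>a - b\<bar> \<le> real n" "real n \<le> \<bar>a - b\<bar> + 1"
    unfolding n_def by linarith+
  have "c1 ^ n = exp (ln c1 * real n)"
    using c1_ge_1 by (simp add: exp_of_nat2_mult)
  also have "\<dots> \<le> exp (ln c1 * (\<bar>a - b\<bar> + 1))"
    using n c1_ge_1 by (auto intro: mult_left_mono)
  also have "\<dots> = c1 * exp (ln c1 * \<bar>a - b\<bar>)"
    using c1_ge_1 by (simp add: distrib_left exp_add)
  finally have "c1 ^ n * \<phi> b \<le> c1 * exp (ln c1 * \<bar>a - b\<bar>) * \<phi> b"
    using phi_pos[OF assms(2)] by (intro mult_right_mono) auto
  with phi_growth_nat[OF assms n(1)] show ?thesis by linarith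
qed

lemma phi_norm_measurable [measurable]: "(\<lambda>h::'a::euclidean_space. \<phi> (norm h)) \<in> borel_measurable borel"
proof -
  have "norm \<in> (borel :: 'a measure) \<rightarrow>\<^sub>M restrict_space borel {0..}"
    by (rule measurable_restrict_space2) auto
  from measurable_compose[OF this phi_borel] show ?thesis .
qed

text \<open>Off the origin this is \<open>min (\<delta> powr - (\<alpha> + d)) (jump_bound \<alpha> \<phi> h)\<close> when \<open>\<delta> \<le> 1\<close>.\<close>
definition capped :: "real \<Rightarrow> 'a::euclidean_space \<Rightarrow> real"
  where "capped \<delta> h = \<phi> (norm h) * max (norm h) \<delta> powr - (\<alpha> + real DIM('a))"

lemma capped_nonneg [simp]: "0 \<le> capped \<delta> h"
  using phi_pos[of "norm h"] by (simp add: capped_def)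

lemma capped_measurable [measurable]: "capped \<delta> \<in> borel_measurable borel"
  unfolding capped_def[abs_def] by measurable

lemma capped_minus_commute: "capped \<delta> (x - y) = capped \<delta> (y - x)"
  by (simp add: capped_def norm_minus_commute)

lemma capped_le_powr: "capped \<delta> (h :: 'a::euclidean_space) \<le> max (norm h) \<delta> powr - (\<alpha> + real DIM('a))"
  using phi_le_1[of "norm h"] unfolding capped_def by (simp add: mult_left_le_one_le phi_pos less_imp_le)

lemma capped_le:
  assumes "0 < \<delta>"
  shows "capped \<delta> (h :: 'a::euclidean_space) \<le> \<delta> powr - (\<alpha> + real DIM('a))"
  using capped_le_powr[of \<delta> h] powr_mono2'[of "- (\<alpha> + real DIM('a))" \<delta> "max (norm h) \<delta>"]
    alpha_pos assms by linarith

lemma capped_eq_jump_bound: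
  assumes "0 < \<delta>" "\<delta> \<le> norm h"
  shows "capped \<delta> h = jump_bound \<alpha> \<phi> (h :: 'a::euclidean_space)"
  using assms powr_minus_divide[of "norm h" "\<alpha> + real DIM('a)"]
  by (simp add: capped_def jump_bound_def max_absorb1)

lemma jump_bound_nonneg: "0 \<le> jump_bound \<alpha> \<phi> h"
  using phi_pos[of "norm h"] by (simp add: jump_bound_def)

lemma jump_bound_le_powr:
  "jump_bound \<alpha> \<phi> (h :: 'a::euclidean_space) \<le> norm h powr - (\<alpha> + real DIM('a))"
  using phi_le_1[of "norm h"] powr_minus_divide[of "norm h" "\<alpha> + real DIM('a)"]
  by (simp add: jump_bound_def divide_right_mono)

lemma capped_small:
  assumes "\<delta> \<le> 1" "norm h \<le> \<delta>"
  shows "capped \<delta> (h :: 'a::euclidean_space) = \<delta> powr - (\<alpha> + real DIM('a))"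
  using assms by (simp add: capped_def phi_eq_1 max_absorb2)

lemma capped_le_jump_bound:
  assumes "0 < \<delta>" "\<delta> \<le> 1" "h \<noteq> 0"
  shows "capped \<delta> h \<le> jump_bound \<alpha> \<phi> (h :: 'a::euclidean_space)"
proof (cases "\<delta> \<le> norm h")
  case False
  then have "jump_bound \<alpha> \<phi> h = norm h powr - (\<alpha> + real DIM('a))"
    using assms powr_minus_divide[of "norm h" "\<alpha> + real DIM('a)"]
    by (simp add: jump_bound_def phi_eq_1)
  moreover have "\<delta> powr - (\<alpha> + real DIM('a)) \<le> norm h powr - (\<alpha> + real DIM('a))"
    using False assms alpha_pos by (intro powr_mono2') auto
  ultimately show ?thesis
    using False assms by (simp add: capped_small)
qed (use assms in \<open>simp add: capped_eq_jump_bound\<close>)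

text \<open>Both factors are controlled by norm (z - x) / \<delta>: \<phi> varies at most
  exponentially at unit scale, hence also at the finer scale \<delta>, and since the cap keeps max
  (norm z) \<delta> above \<delta>, its relative change is at most exponential as well.\<close>

lemma capped_tempered:
  fixes x z :: "'a::euclidean_space"
  assumes "0 < \<delta>" "\<delta> \<le> 1"
  shows "capped \<delta> z \<le> c1 * exp ((ln c1 + (\<alpha> + real DIM('a))) / \<delta> * norm (z - x)) * capped \<delta> x"
proof -
  let ?s = "\<alpha> + real DIM('a)" and ?r = "norm (z - x) / \<delta>"
  have s: "0 < ?s" using alpha_pos by simp
  have "ln c1 * \<bar>norm z - norm x\<bar> \<le> ln c1 * ?r"
  proof (intro mult_left_mono)
    have "norm (z - x) * \<delta> \<le> norm (z - x) * 1"
      using assms by (intro mult_left_mono) auto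
    then have "norm (z - x) \<le> ?r" using assms by (simp add: field_simps)
    then show "\<bar>norm z - norm x\<bar> \<le> ?r"
      using norm_triangle_ineq3[of z x] by linarith
  qed (use c1_ge_1 in auto)
  then have "c1 * exp (ln c1 * \<bar>norm z - norm x\<bar>) * \<phi> (norm x) \<le> c1 * exp (ln c1 * ?r) * \<phi> (norm x)"
    using c1_ge_1 phi_pos[of "norm x"] by (intro mult_right_mono mult_left_mono) auto
  then have 1: "\<phi> (norm z) \<le> c1 * exp (ln c1 * ?r) * \<phi> (norm x)"
    using phi_growth_exp[of "norm z" "norm x"] by simp
  have "max (norm x) \<delta> \<le> max (norm z) \<delta> + norm (z - x)"
    using norm_triangle_ineq4[of z "z - x"] norm_ge_zero[of "z - x"] by (auto simp del: norm_ge_zero)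
  also have "\<dots> \<le> max (norm z) \<delta> + max (norm z) \<delta> * ?r"
  proof -
    have "\<delta> * ?r \<le> max (norm z) \<delta> * ?r"
      using assms by (intro mult_right_mono) auto
    then show ?thesis using assms by simp
  qed
  also have "\<dots> = max (norm z) \<delta> * (1 + ?r)"
    by (simp add: distrib_left)
  also have "\<dots> \<le> max (norm z) \<delta> * exp ?r"
    using assms by (intro mult_left_mono exp_ge_add_one_self) auto
  finally have "(max (norm z) \<delta> * exp ?r) powr - ?s \<le> max (norm x) \<delta> powr - ?s"
    using assms s by (intro powr_mono2') auto
  also have "(max (norm z) \<delta> * exp ?r) powr - ?s = max (norm z) \<delta> powr - ?s * exp (- (?r * ?s))"
    using assms by (subst powr_mult) (simp_all only: exp_powr_real mult_minus_right)
  finally have 2: "max (norm z) \<delta> powr - ?s \<le> exp (?r * ?s) * max (norm x) \<delta> powr - ?s"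
    by (simp only: exp_minus) (simp add: field_simps)
  have "capped \<delta> z \<le> (c1 * exp (ln c1 * ?r) * \<phi> (norm x)) * (exp (?r * ?s) * max (norm x) \<delta> powr - ?s)"
    unfolding capped_def using c1_ge_1 phi_pos[of "norm x"] by (intro mult_mono 1 2) auto
  also have "\<dots> = c1 * (exp (ln c1 * ?r) * exp (?r * ?s)) * capped \<delta> x"
    by (simp add: capped_def mult_ac)
  also have "exp (ln c1 * ?r) * exp (?r * ?s) = exp ((ln c1 + ?s) / \<delta> * norm (z - x))"
    using assms by (simp add: field_simps flip: exp_add)
  finally show ?thesis .
qed

section \<open>Total mass and self-convolution of the capped bound\<close>

lemma nn_integral_capped:
  "\<exists>K>0. \<forall>\<delta>>0. (\<integral>\<^sup>+(h::'a::euclidean_space). ennreal (capped \<delta> h) \<partial>lborel) \<le> ennreal (K * \<delta> powr - \<alpha>)"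
proof -
  obtain K where K: "0 < K" "\<And>\<delta>. 0 < \<delta> \<Longrightarrow> (\<integral>\<^sup>+(h::'a).
    ennreal (max (norm h) \<delta> powr - (\<alpha> + real DIM('a))) \<partial>lborel) \<le> ennreal (K * \<delta> powr - \<alpha>)"
    using nn_integral_capped_power[OF alpha_pos, where 'a = 'a] by blast
  have "(\<integral>\<^sup>+(h::'a). ennreal (capped \<delta> h) \<partial>lborel)
      \<le> (\<integral>\<^sup>+(h::'a). ennreal (max (norm h) \<delta> powr - (\<alpha> + real DIM('a))) \<partial>lborel)" for \<delta>
    by (intro nn_integral_mono ennreal_leI capped_le_powr)
  with K show ?thesis by (meson order.trans)
qed

text \<open>A power of the norm tolerates halving its argument, but \<phi> may decay exponentially.
  So \<phi> is compared only for norm x \<le> 2, where it is bounded below, or across a distance of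
  at most 1.\<close>

lemma capped_half:
  fixes x z :: "'a::euclidean_space"
  assumes "0 < \<delta>" "norm x \<le> 2 * norm z" "norm x \<le> 2 \<or> norm (x - z) \<le> 1"
  shows "capped \<delta> z \<le> c1 ^ 2 * 2 powr (\<alpha> + real DIM('a)) * capped \<delta> x"
proof -
  let ?s = "\<alpha> + real DIM('a)"
  have "\<phi> (norm z) \<le> c1 ^ 2 * \<phi> (norm x)"
  proof (cases "norm x \<le> 2")
    case True
    have "\<phi> (norm z) \<le> \<phi> 0" using phi_le_1[of "norm z"] phi_eq_1[of 0] by simp
    also have "\<dots> \<le> c1 ^ 2 * \<phi> (norm x)" using True by (intro phi_growth_nat) auto
    finally show ?thesis .
  next
    case False
    then have "\<bar>norm z - norm x\<bar> \<le> real 2"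
      using assms norm_triangle_ineq3[of x z] by (auto simp: abs_minus_commute)
    then show ?thesis by (intro phi_growth_nat) auto
  qed
  moreover have "max (norm z) \<delta> powr - ?s \<le> 2 powr ?s * max (norm x) \<delta> powr - ?s"
  proof -
    have "max (norm z) \<delta> powr - ?s \<le> (max (norm x) \<delta> / 2) powr - ?s"
      using assms alpha_pos by (intro powr_mono2') auto
    also have "\<dots> = 2 powr ?s * max (norm x) \<delta> powr - ?s"
      using assms powr_add[of 2 ?s "- ?s"] by (simp add: powr_divide field_simps)
    finally show ?thesis .
  qed
  ultimately have "capped \<delta> z \<le> (c1 ^ 2 * \<phi> (norm x)) * (2 powr ?s * max (norm x) \<delta> powr - ?s)"
    unfolding capped_def using c1_ge_1 phi_pos[of "norm x"] by (intro mult_mono) auto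
  then show ?thesis by (simp add: capped_def mult_ac)
qed

text \<open>If \<open>capped_half\<close> applies to z - w or to z - x, one factor is below a
  multiple of capped \<delta> (x - w) and the other integrates to order \<delta>^-\<alpha>. In the
  remaining case z has distance at least 1 from both points, so neither factor is affected by the
  cap and the hypothesis on \<phi> applies.\<close>

lemma nn_integral_capped_convolution:
  assumes conv: "\<forall>x y :: 'a::euclidean_space. norm (x - y) > 2 \<longrightarrow>
      (\<integral>\<^sup>+z\<in>{z. norm (x - z) \<ge> 1 \<and> norm (y - z) \<ge> 1}.
          ennreal (jump_bound \<alpha> \<phi> (y - z) * jump_bound \<alpha> \<phi> (z - x)) \<partial>lborel)
        \<le> ennreal (c3 * jump_bound \<alpha> \<phi> (y - x))"
  shows "\<exists>K>0. \<forall>\<delta> x w. 0 < \<delta> \<longrightarrow> \<delta> \<le> 1 \<longrightarrow>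
    (\<integral>\<^sup>+(z::'a). ennreal (capped \<delta> (z - x)) * ennreal (capped \<delta> (z - w)) \<partial>lborel)
      \<le> ennreal (K * \<delta> powr - \<alpha> * capped \<delta> (x - w))"
proof -
  obtain K0 where K0: "0 < K0" "\<And>\<delta>. 0 < \<delta> \<Longrightarrow>
      (\<integral>\<^sup>+(h::'a). ennreal (capped \<delta> h) \<partial>lborel) \<le> ennreal (K0 * \<delta> powr - \<alpha>)"
    using nn_integral_capped[where 'a = 'a] by blast
  let ?c = "c1 ^ 2 * 2 powr (\<alpha> + real DIM('a))"
  have c: "0 < ?c" using c1_ge_1 by simp
  show ?thesis
  proof (intro exI[of _ "2 * ?c * K0 + max c3 0"] conjI allI impI)
    show "0 < 2 * ?c * K0 + max c3 0"
      using c K0 by (simp add: add_pos_nonneg)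
    fix \<delta> :: real and x w :: 'a assume \<delta>: "0 < \<delta>" "\<delta> \<le> 1"
    let ?h = "capped \<delta>" and ?A = "{z. norm (x - z) \<ge> 1 \<and> norm (w - z) \<ge> 1}"
    let ?J = "\<lambda>z. ennreal (jump_bound \<alpha> \<phi> (w - z) * jump_bound \<alpha> \<phi> (z - x)) * indicator ?A z
      * indicator {z. norm (x - w) > 2} z"
    have [measurable]: "?A \<in> sets borel" by measurable
    have [measurable]: "jump_bound \<alpha> \<phi> \<in> borel_measurable (borel :: 'a measure)"
      unfolding jump_bound_def[abs_def] by measurable
    have pointwise: "ennreal (?h (z - x)) * ennreal (?h (z - w))
      \<le> ennreal (?c * ?h (x - w)) * ennreal (?h (z - x))
        + ennreal (?c * ?h (x - w)) * ennreal (?h (z - w)) + ?J z" for z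
    proof -
      consider "norm (x - w) \<le> 2 * norm (z - w)" "norm (x - w) \<le> 2 \<or> norm ((x - w) - (z - w)) \<le> 1"
        | "norm (x - w) \<le> 2 * norm (z - x)" "norm (x - w) \<le> 2 \<or> norm ((w - x) - (z - x)) \<le> 1"
        | "norm (x - w) > 2" "z \<in> ?A"
      proof (cases "norm (x - w) \<le> 2")
        case True
        have "norm (x - w) \<le> norm (z - w) + norm (z - x)"
          using norm_triangle_ineq4[of "z - w" "z - x"] by simp
        then show ?thesis using True that by force
      next
        case False
        \<comment> \<open>If z is within 1 of one point, its distance to the other exceeds norm (x -
          w) - 1, hence half of norm (x - w), because norm (x - w) > 2.\<close>
        have "norm (x - w) \<le> norm (z - w) + norm (z - x)"
          using norm_triangle_ineq4[of "z - w" "z - x"] by simp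
        then show ?thesis
          using False that by (cases "z \<in> ?A") (auto simp: norm_minus_commute not_le)
      qed
      then show ?thesis
      proof cases
        case 1
        then have "?h (z - w) \<le> ?c * ?h (x - w)"
          by (rule capped_half[OF \<delta>(1)])
        then have "ennreal (?h (z - x)) * ennreal (?h (z - w)) \<le> ennreal (?h (z - x)) * ennreal (?c * ?h (x - w))"
          by (intro mult_left_mono ennreal_leI) auto
        then show ?thesis by (intro add_increasing2) (simp_all add: mult.commute)
      next
        case 2
        then have "?h (z - x) \<le> ?c * ?h (w - x)"
          by (intro capped_half[OF \<delta>(1)]) (auto simp: norm_minus_commute)
        then have "ennreal (?h (z - x)) * ennreal (?h (z - w)) \<le> ennreal (?c * ?h (x - w)) * ennreal (?h (z - w))"
          by (intro mult_right_mono ennreal_leI) (auto simp: capped_minus_commute)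
        then show ?thesis by (intro add_increasing2[OF _ add_increasing]) simp_all
      next
        case 3
        then have "?h (z - x) = jump_bound \<alpha> \<phi> (z - x)" "?h (z - w) = jump_bound \<alpha> \<phi> (w - z)"
          using \<delta> by (auto simp: norm_minus_commute capped_minus_commute[of \<delta> z w] intro!: capped_eq_jump_bound)
        then have "ennreal (?h (z - x)) * ennreal (?h (z - w)) = ?J z"
          using 3 by (simp add: ennreal_mult' jump_bound_nonneg mult.commute)
        then show ?thesis by (intro add_increasing) simp_all
      qed
    qed
    have J: "(\<integral>\<^sup>+z. ?J z \<partial>lborel) \<le> ennreal (max c3 0 * \<delta> powr - \<alpha> * ?h (x - w))"
    proof (cases "norm (x - w) > 2")
      case True
      then have "(\<integral>\<^sup>+z. ?J z \<partial>lborel) \<le> ennreal (c3 * jump_bound \<alpha> \<phi> (w - x))"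
        using conv[rule_format, OF True] by simp
      also have "jump_bound \<alpha> \<phi> (w - x) = ?h (x - w)"
        using True \<delta> by (simp add: capped_eq_jump_bound capped_minus_commute[of \<delta> x w] norm_minus_commute)
      \<comment> \<open>c3 might be negative, hence the maximum with 0; the factor
        \<delta>^-\<alpha> can be inserted since it is at least 1.\<close>
      also have "ennreal (c3 * ?h (x - w)) \<le> ennreal (max c3 0 * \<delta> powr - \<alpha> * ?h (x - w))"
      proof (intro ennreal_leI mult_right_mono)
        have "1 powr - \<alpha> \<le> \<delta> powr - \<alpha>"
          using \<delta> alpha_pos by (intro powr_mono2') auto
        then show "c3 \<le> max c3 0 * \<delta> powr - \<alpha>"
          by (smt (verit) mult_left_le mult_le_cancel_left1 powr_one_eq_one)
      qed auto
      finally show ?thesis .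
    qed simp
    have shift: "(\<integral>\<^sup>+z. ennreal (?h (z - y)) \<partial>lborel) \<le> ennreal (K0 * \<delta> powr - \<alpha>)" for y :: 'a
      using K0(2)[OF \<delta>(1)] by (subst nn_integral_lborel_shift) auto
    have "(\<integral>\<^sup>+z. ennreal (?h (z - x)) * ennreal (?h (z - w)) \<partial>lborel)
      \<le> (\<integral>\<^sup>+z. ennreal (?c * ?h (x - w)) * ennreal (?h (z - x))
        + ennreal (?c * ?h (x - w)) * ennreal (?h (z - w)) + ?J z \<partial>lborel)"
      by (intro nn_integral_mono pointwise)
    also have "\<dots> = ennreal (?c * ?h (x - w)) * (\<integral>\<^sup>+z. ennreal (?h (z - x)) \<partial>lborel)
        + ennreal (?c * ?h (x - w)) * (\<integral>\<^sup>+z. ennreal (?h (z - w)) \<partial>lborel) + (\<integral>\<^sup>+z. ?J z \<partial>lborel)"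
      by (subst nn_integral_add, measurable, subst nn_integral_add, measurable,
          subst nn_integral_cmult, measurable, subst nn_integral_cmult, measurable)
    also have "\<dots> \<le> ennreal (?c * ?h (x - w)) * ennreal (K0 * \<delta> powr - \<alpha>)
        + ennreal (?c * ?h (x - w)) * ennreal (K0 * \<delta> powr - \<alpha>)
        + ennreal (max c3 0 * \<delta> powr - \<alpha> * ?h (x - w))"
      by (intro add_mono mult_left_mono shift J) auto
    also have "\<dots> = ennreal (?c * ?h (x - w) * (K0 * \<delta> powr - \<alpha>) + ?c * ?h (x - w) * (K0 * \<delta> powr - \<alpha>)
        + max c3 0 * \<delta> powr - \<alpha> * ?h (x - w))"
    proof -
      have *: "ennreal A * ennreal B + ennreal A * ennreal B + ennreal D = ennreal (A * B + A * B + D)"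
        if "0 \<le> A" "0 \<le> B" "0 \<le> D" for A B D
        using that by (simp only: ennreal_mult[symmetric] ennreal_plus[symmetric] mult_nonneg_nonneg add_nonneg_nonneg)
      then show ?thesis using K0 c by (intro *) auto
    qed
    also have "\<dots> = ennreal ((2 * ?c * K0 + max c3 0) * \<delta> powr - \<alpha> * ?h (x - w))"
      by (simp add: algebra_simps)
    finally show "(\<integral>\<^sup>+z. ennreal (?h (z - x)) * ennreal (?h (z - w)) \<partial>lborel)
      \<le> ennreal ((2 * ?c * K0 + max c3 0) * \<delta> powr - \<alpha> * ?h (x - w))" .
  qed
qed

end

subsection \<open>Exponential tilting of small jumps\<close>

lemma exp_le_1_plus: "exp a \<le> 1 + \<bar>a\<bar> * exp \<bar>a\<bar>" for a :: real
proof (cases "a \<ge> 0")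
  case True
  have "1 + - a \<le> exp (- a)" by (rule exp_ge_add_one_self)
  then have "(1 - a) * exp a \<le> exp (- a) * exp a" by (intro mult_right_mono) auto
  then show ?thesis using True by (simp add: exp_minus algebra_simps)
next
  case False
  then have "exp a \<le> 1" by simp
  moreover have "0 \<le> \<bar>a\<bar> * exp \<bar>a\<bar>" by simp
  ultimately show ?thesis by linarith
qed

text \<open>With b = |a|, twice cosh b - 1 equals exp (- b) * (exp b - 1)^2, and
  \<open>exp_le_1_plus\<close> bounds exp b - 1 by b * exp b.\<close>

lemma cosh_le_1_plus: "cosh a \<le> 1 + a\<^sup>2 * exp \<bar>a\<bar>" for a :: real
proof -
  define b where "b = \<bar>a\<bar>"
  define X where "X = b\<^sup>2 * exp b"
  have "cosh a = cosh b" by (simp add: b_def cosh_def abs_if)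
  have b: "0 \<le> b" by (simp add: b_def)
  have "(exp b - 1)\<^sup>2 \<le> (b * exp b)\<^sup>2"
    using exp_le_1_plus[of b] b by (intro power_mono) auto
  then have "exp (- b) * (exp b - 1)\<^sup>2 \<le> exp (- b) * (b * exp b)\<^sup>2"
    by (intro mult_left_mono) auto
  moreover have "exp (- b) * (exp b - 1)\<^sup>2 = (exp (- b) * exp b) * exp b - 2 * (exp (- b) * exp b) + exp (- b)"
    by (simp only: power2_eq_square algebra_simps)
  moreover have "exp (- b) * (b * exp b)\<^sup>2 = (exp (- b) * exp b) * X"
    by (simp only: X_def power2_eq_square mult_ac)
  moreover have "exp (- b) * exp b = 1"
    by (simp flip: exp_add)
  ultimately have "exp b + exp (- b) - 2 \<le> X"
    by simp
  moreover have "0 \<le> X" by (simp add: X_def)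
  ultimately have "cosh b \<le> 1 + X"
    by (simp add: cosh_def)
  then show ?thesis unfolding X_def \<open>cosh a = cosh b\<close>[symmetric] by (simp add: b_def)
qed

text \<open>The effective deviation of the tilt from 1 has order p > \<alpha> in norm h / \<delta>,
  so it is integrable against the jump bound. Order 1 suffices for \<alpha> < 1; otherwise
  reflection symmetry cancels the odd part and leaves order 2. The constant is chosen before f, the
  scales, e and x.\<close>

lemma (in jump_profile) tilted_jumps:
  assumes "\<alpha> < 2" "0 < M" "0 \<le> \<kappa>"
  shows "\<exists>C>0. \<forall>(f :: 'a::euclidean_space \<times> 'a \<Rightarrow> ennreal) \<delta> \<epsilon> r e x.
    f \<in> borel_measurable borel \<longrightarrow>
    (\<forall>x y. x \<noteq> y \<longrightarrow> f (x, y) \<le> ennreal (M * jump_bound \<alpha> \<phi> (y - x))) \<longrightarrow>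
    (\<forall>x h. f (x, x + h) = f (x, x - h)) \<or> \<alpha> < 1 \<longrightarrow>
    0 < \<delta> \<longrightarrow> 0 < \<epsilon> \<longrightarrow> r \<le> \<delta> \<longrightarrow> norm e \<le> 1 \<longrightarrow>
    (\<integral>\<^sup>+y\<in>{y. \<epsilon> < norm (y - x) \<and> norm (y - x) \<le> r}.
        f (x, y) * ennreal (exp (\<kappa> / \<delta> * ((y - x) \<bullet> e))) \<partial>lborel)
      \<le> (\<integral>\<^sup>+y\<in>{y. \<epsilon> < norm (y - x) \<and> norm (y - x) \<le> r}. f (x, y) \<partial>lborel)
        + ennreal (C * \<delta> powr - \<alpha>)"
proof -
  define p :: real where "p = (if \<alpha> < 1 then 1 else 2)"
  let ?s = "\<alpha> + real DIM('a)"
  have p: "\<alpha> < p" using assms by (simp add: p_def)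
  obtain K where K: "0 < K" "\<And>\<delta>. 0 < \<delta> \<Longrightarrow> (\<integral>\<^sup>+h\<in>{h::'a. 0 < norm h \<and> norm h \<le> \<delta>}.
    ennreal (norm h powr (p - ?s)) \<partial>lborel) \<le> ennreal (K * \<delta> powr (p - \<alpha>))"
    using nn_integral_small_power[OF alpha_pos p, where 'a = 'a] by blast
  \<comment> \<open>One constant for both orders: the square dominates \<kappa> and its square, and
    exp \<kappa> bounds the remainder because the exponent is at most \<kappa> for jumps of length
    at most \<delta>.\<close>
  define K1 where "K1 = (1 + \<kappa>)\<^sup>2 * exp \<kappa>"
  have K1: "0 < K1" using assms by (simp add: K1_def)
  show ?thesis
  proof (intro exI[of _ "K1 * M * K"] conjI allI impI)
    show "0 < K1 * M * K" using K K1 assms by simp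
    fix f :: "'a \<times> 'a \<Rightarrow> ennreal" and \<delta> \<epsilon> r :: real and e x :: 'a
    assume [measurable]: "f \<in> borel_measurable borel"
      and bound: "\<forall>x y. x \<noteq> y \<longrightarrow> f (x, y) \<le> ennreal (M * jump_bound \<alpha> \<phi> (y - x))"
      and sym: "(\<forall>x h. f (x, x + h) = f (x, x - h)) \<or> \<alpha> < 1"
      and \<delta>: "0 < \<delta>" and \<epsilon>: "0 < \<epsilon>" and r: "r \<le> \<delta>" and e: "norm e \<le> 1"
    define A where "A = {h::'a. \<epsilon> < norm h \<and> norm h \<le> r}"
    define G where "G h = f (x, x + h) * indicator A h" for h
    define a where "a h = \<kappa> / \<delta> * (h \<bullet> e)" for h
    have [measurable]: "A \<in> sets borel"
      unfolding A_def by measurable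
    have "(\<lambda>h. f (x, x + h)) \<in> borel_measurable borel"
      by (rule measurable_compose[OF _ \<open>f \<in> _\<close>]) (simp add: borel_prod[symmetric])
    then have G [measurable]: "G \<in> borel_measurable borel"
      unfolding G_def by measurable
    have [measurable]: "a \<in> borel_measurable borel"
      unfolding a_def by measurable
    have a_le: "\<bar>a h\<bar> \<le> \<kappa> * (norm h / \<delta>)" for h
    proof -
      have "\<bar>h \<bullet> e\<bar> \<le> norm h * norm e" by (rule Cauchy_Schwarz_ineq2)
      also have "\<dots> \<le> norm h" using e by (simp add: mult_left_le)
      finally have "\<kappa> / \<delta> * \<bar>h \<bullet> e\<bar> \<le> \<kappa> / \<delta> * norm h"
        using assms \<delta> by (intro mult_left_mono) auto
      then show ?thesis using assms \<delta> by (simp add: a_def abs_mult)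
    qed
    have a_small: "\<bar>a h\<bar> \<le> \<kappa>" if "h \<in> A" for h
    proof -
      have "\<kappa> * (norm h / \<delta>) \<le> \<kappa> * 1"
        using that r \<delta> assms by (intro mult_left_mono) (auto simp: A_def)
      with a_le[of h] show ?thesis by simp
    qed
    have power_le: "(\<kappa> * (norm h / \<delta>)) ^ n * exp \<kappa> \<le> K1 * (norm h / \<delta>) powr p"
      if "h \<in> A" "p = real n" for h n
    proof -
      have h: "0 < norm h" using that \<epsilon> by (auto simp: A_def)
      have "\<kappa> ^ n \<le> (1 + \<kappa>) ^ n" using assms by (intro power_mono) auto
      also have "\<dots> \<le> (1 + \<kappa>) ^ 2"
        using assms that(2) by (intro power_increasing) (auto simp: p_def split: if_splits)
      finally have "(\<kappa> ^ n * exp \<kappa>) * (norm h / \<delta>) ^ n \<le> K1 * (norm h / \<delta>) ^ n"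
        unfolding K1_def using \<delta> by (intro mult_right_mono) auto
      moreover have "(norm h / \<delta>) powr p = (norm h / \<delta>) ^ n"
        using that h \<delta> by (simp add: powr_realpow)
      ultimately show ?thesis by (metis (no_types, lifting) mult.commute mult.left_commute power_mult_distrib)
    qed
    have tilt: "(\<integral>\<^sup>+h. G h * ennreal (exp (a h)) \<partial>lborel)
      \<le> (\<integral>\<^sup>+h. G h + G h * ennreal (K1 * (norm h / \<delta>) powr p) \<partial>lborel)"
    proof (cases "\<alpha> < 1")
      case True
      show ?thesis
      proof (intro nn_integral_mono)
        fix h
        show "G h * ennreal (exp (a h)) \<le> G h + G h * ennreal (K1 * (norm h / \<delta>) powr p)"
        proof (cases "h \<in> A")
          case h: True
          have "exp (a h) \<le> 1 + \<bar>a h\<bar> * exp \<bar>a h\<bar>" by (rule exp_le_1_plus)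
          also have "\<bar>a h\<bar> * exp \<bar>a h\<bar> \<le> (\<kappa> * (norm h / \<delta>)) ^ 1 * exp \<kappa>"
            using a_le[of h] a_small[OF h] \<delta> assms by (intro mult_mono) auto
          also have "\<dots> \<le> K1 * (norm h / \<delta>) powr p"
            using h True by (intro power_le) (auto simp: p_def)
          finally have "ennreal (exp (a h)) \<le> ennreal (1 + K1 * (norm h / \<delta>) powr p)"
            by (intro ennreal_leI) simp
          also have "\<dots> = 1 + ennreal (K1 * (norm h / \<delta>) powr p)"
            using K1 by (simp add: ennreal_plus)
          finally have "G h * ennreal (exp (a h)) \<le> G h * (1 + ennreal (K1 * (norm h / \<delta>) powr p))"
            by (intro mult_left_mono) auto
          then show ?thesis by (simp add: distrib_left)
        qed (simp add: G_def)
      qed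
    next
      case False
      \<comment> \<open>Averaging the integral with its reflected copy replaces the exponential by
        cosh, whose deviation from 1 is quadratic.\<close>
      have "G (- h) = G h" for h
        using sym False by (auto simp: G_def A_def indicator_def)
      then have "(\<integral>\<^sup>+h. G h * ennreal (exp (a h)) \<partial>lborel) = (\<integral>\<^sup>+h. G h * ennreal (exp (- a h)) \<partial>lborel)"
        by (subst nn_integral_lborel_reflect[symmetric]) (auto simp: a_def)
      moreover have "ennreal (1/2) + ennreal (1/2) = 1"
        by (subst ennreal_plus[symmetric]) simp_all
      ultimately have "(\<integral>\<^sup>+h. G h * ennreal (exp (a h)) \<partial>lborel)
          = ennreal (1/2) * (\<integral>\<^sup>+h. G h * ennreal (exp (a h)) \<partial>lborel)
            + ennreal (1/2) * (\<integral>\<^sup>+h. G h * ennreal (exp (- a h)) \<partial>lborel)"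
        by (simp only: distrib_right[symmetric] mult_1_left)
      also have "\<dots> = (\<integral>\<^sup>+h. ennreal (1/2) * (G h * ennreal (exp (a h)))
          + ennreal (1/2) * (G h * ennreal (exp (- a h))) \<partial>lborel)"
      proof -
        have "(\<lambda>h. G h * ennreal (exp (a h))) \<in> borel_measurable lborel"
          "(\<lambda>h. G h * ennreal (exp (- a h))) \<in> borel_measurable lborel"
          by measurable
        then show ?thesis
          by (simp only: nn_integral_add nn_integral_cmult borel_measurable_times_ennreal borel_measurable_const)
      qed
      also have "\<dots> \<le> (\<integral>\<^sup>+h. G h + G h * ennreal (K1 * (norm h / \<delta>) powr p) \<partial>lborel)"
      proof (intro nn_integral_mono)
        fix h
        have "ennreal (1/2) * (G h * ennreal (exp (a h))) + ennreal (1/2) * (G h * ennreal (exp (- a h)))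
            = G h * (ennreal (1/2) * ennreal (exp (a h)) + ennreal (1/2) * ennreal (exp (- a h)))"
          by (simp add: distrib_left mult_ac)
        also have "ennreal (1/2) * ennreal (exp (a h)) + ennreal (1/2) * ennreal (exp (- a h)) = ennreal (cosh (a h))"
        proof -
          have "cosh (a h) = 1/2 * exp (a h) + 1/2 * exp (- a h)"
            by (simp add: cosh_def add_divide_distrib)
          then show ?thesis
            by (simp only: ennreal_plus ennreal_mult exp_ge_zero mult_nonneg_nonneg
                zero_le_divide_1_iff zero_le_numeral)
        qed
        also have "G h * ennreal (cosh (a h)) \<le> G h + G h * ennreal (K1 * (norm h / \<delta>) powr p)"
        proof (cases "h \<in> A")
          case h: True
          have "cosh (a h) \<le> 1 + \<bar>a h\<bar> ^ 2 * exp \<bar>a h\<bar>" unfolding power2_abs by (rule cosh_le_1_plus)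
          also have "\<bar>a h\<bar> ^ 2 * exp \<bar>a h\<bar> \<le> (\<kappa> * (norm h / \<delta>)) ^ 2 * exp \<kappa>"
            using a_le[of h] a_small[OF h] \<delta> assms by (intro mult_mono power_mono) auto
          also have "\<dots> \<le> K1 * (norm h / \<delta>) powr p"
            using h False by (intro power_le) (auto simp: p_def)
          finally have "ennreal (cosh (a h)) \<le> ennreal (1 + K1 * (norm h / \<delta>) powr p)"
            by (intro ennreal_leI) simp
          also have "\<dots> = 1 + ennreal (K1 * (norm h / \<delta>) powr p)"
            using K1 by (simp add: ennreal_plus)
          finally have "G h * ennreal (cosh (a h)) \<le> G h * (1 + ennreal (K1 * (norm h / \<delta>) powr p))"
            by (intro mult_left_mono) auto
          then show ?thesis by (simp add: distrib_left)
        qed (simp add: G_def)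
        finally show "ennreal (1/2) * (G h * ennreal (exp (a h))) + ennreal (1/2) * (G h * ennreal (exp (- a h)))
          \<le> G h + G h * ennreal (K1 * (norm h / \<delta>) powr p)" .
      qed
      finally show ?thesis .
    qed
    have "(\<integral>\<^sup>+h. G h * ennreal (K1 * (norm h / \<delta>) powr p) \<partial>lborel)
      \<le> (\<integral>\<^sup>+(h::'a). ennreal (K1 * M * \<delta> powr - p) * (ennreal (norm h powr (p - ?s))
          * indicator {h. 0 < norm h \<and> norm h \<le> \<delta>} h) \<partial>lborel)"
    proof (intro nn_integral_mono)
      fix h
      show "G h * ennreal (K1 * (norm h / \<delta>) powr p) \<le> ennreal (K1 * M * \<delta> powr - p)
        * (ennreal (norm h powr (p - ?s)) * indicator {h. 0 < norm h \<and> norm h \<le> \<delta>} h)"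
      proof (cases "h \<in> A")
        case True
        then have h: "0 < norm h" "norm h \<le> \<delta>" using \<epsilon> r by (auto simp: A_def)
        have "f (x, x + h) \<le> ennreal (M * jump_bound \<alpha> \<phi> h)"
          using bound[rule_format, of x "x + h"] h by auto
        also have "\<dots> \<le> ennreal (M * norm h powr - ?s)"
          using assms jump_bound_le_powr[of h] by (intro ennreal_leI mult_left_mono) auto
        finally have "G h * ennreal (K1 * (norm h / \<delta>) powr p)
            \<le> ennreal (M * norm h powr - ?s) * ennreal (K1 * (norm h / \<delta>) powr p)"
          using True by (auto simp: G_def intro: mult_right_mono)
        also have "\<dots> = ennreal (M * norm h powr - ?s * (K1 * (norm h / \<delta>) powr p))"
          using assms by (simp add: ennreal_mult')
        also have "M * norm h powr - ?s * (K1 * (norm h / \<delta>) powr p)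
            = (K1 * M * \<delta> powr - p) * (norm h powr (p + - ?s))"
          using h \<delta> by (subst powr_add) (simp add: powr_divide powr_minus field_simps)
        also have "ennreal \<dots> = ennreal (K1 * M * \<delta> powr - p) * ennreal (norm h powr (p + - ?s))"
          using K1 assms by (intro ennreal_mult) auto
        also have "p + - ?s = p - ?s" by simp
        finally show ?thesis using h by simp
      qed (simp add: G_def)
    qed
    also have "\<dots> = ennreal (K1 * M * \<delta> powr - p) * (\<integral>\<^sup>+h\<in>{h::'a. 0 < norm h \<and> norm h \<le> \<delta>}.
        ennreal (norm h powr (p - ?s)) \<partial>lborel)"
    proof (rule nn_integral_cmult)
      have [measurable]: "{h::'a. 0 < norm h \<and> norm h \<le> \<delta>} \<in> sets borel" by measurable
      show "(\<lambda>h::'a. ennreal (norm h powr (p - ?s)) * indicator {h. 0 < norm h \<and> norm h \<le> \<delta>} h)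
        \<in> borel_measurable lborel"
        by measurable
    qed
    also have "\<dots> \<le> ennreal (K1 * M * \<delta> powr - p) * ennreal (K * \<delta> powr (p - \<alpha>))"
      by (rule mult_left_mono[OF K(2)[OF \<delta>]]) simp
    also have "\<dots> = ennreal (K1 * M * \<delta> powr - p * (K * \<delta> powr (p - \<alpha>)))"
      using K K1 assms by (intro ennreal_mult[symmetric]) auto
    also have "K1 * M * \<delta> powr - p * (K * \<delta> powr (p - \<alpha>)) = K1 * M * K * \<delta> powr - \<alpha>"
      using powr_add[of \<delta> "- p" "p - \<alpha>"] by simp
    finally have small: "(\<integral>\<^sup>+h. G h * ennreal (K1 * (norm h / \<delta>) powr p) \<partial>lborel)
      \<le> ennreal (K1 * M * K * \<delta> powr - \<alpha>)" .
    have "(\<integral>\<^sup>+y\<in>{y. \<epsilon> < norm (y - x) \<and> norm (y - x) \<le> r}.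
        f (x, y) * ennreal (exp (\<kappa> / \<delta> * ((y - x) \<bullet> e))) \<partial>lborel)
      = (\<integral>\<^sup>+y. G (y - x) * ennreal (exp (a (y - x))) \<partial>lborel)"
      by (intro nn_integral_cong) (auto simp: G_def a_def A_def indicator_def)
    also have "\<dots> = (\<integral>\<^sup>+h. G h * ennreal (exp (a h)) \<partial>lborel)"
      by (rule nn_integral_lborel_shift) measurable
    also have "\<dots> \<le> (\<integral>\<^sup>+h. G h \<partial>lborel) + (\<integral>\<^sup>+h. G h * ennreal (K1 * (norm h / \<delta>) powr p) \<partial>lborel)"
      using tilt by (subst (asm) nn_integral_add) auto
    also have "\<dots> \<le> (\<integral>\<^sup>+h. G h \<partial>lborel) + ennreal (K1 * M * K * \<delta> powr - \<alpha>)"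
      by (intro add_left_mono small)
    also have "(\<integral>\<^sup>+h. G h \<partial>lborel) = (\<integral>\<^sup>+y. G (y - x) \<partial>lborel)"
      by (rule nn_integral_lborel_shift[symmetric]) measurable
    also have "\<dots> = (\<integral>\<^sup>+y\<in>{y. \<epsilon> < norm (y - x) \<and> norm (y - x) \<le> r}. f (x, y) \<partial>lborel)"
      by (intro nn_integral_cong) (auto simp: G_def A_def indicator_def)
    finally show "(\<integral>\<^sup>+y\<in>{y. \<epsilon> < norm (y - x) \<and> norm (y - x) \<le> r}.
        f (x, y) * ennreal (exp (\<kappa> / \<delta> * ((y - x) \<bullet> e))) \<partial>lborel)
      \<le> (\<integral>\<^sup>+y\<in>{y. \<epsilon> < norm (y - x) \<and> norm (y - x) \<le> r}. f (x, y) \<partial>lborel)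
        + ennreal (K1 * M * K * \<delta> powr - \<alpha>)" .
  qed
qed

subsection \<open>Truncation of the jumps\<close>

text \<open>Strict lower and weak upper bounds on the length, in accordance with
  \<open>b_eps\<close>, let kernels over adjacent ranges add up exactly. For r \<le> \<epsilon>
  nothing is left.\<close>

definition jump_kernel :: "('a::euclidean_space \<times> 'a \<Rightarrow> ennreal) \<Rightarrow> real \<Rightarrow> real \<Rightarrow> 'a \<Rightarrow> 'a \<Rightarrow> ennreal"
  where "jump_kernel f \<epsilon> r x y = f (x, y) * indicator {y. \<epsilon> < norm (y - x) \<and> norm (y - x) \<le> r} y"

definition far_kernel :: "('a::euclidean_space \<times> 'a \<Rightarrow> ennreal) \<Rightarrow> real \<Rightarrow> 'a \<Rightarrow> 'a \<Rightarrow> ennreal"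
  where "far_kernel f r x y = f (x, y) * indicator {y. r < norm (y - x)} y"

lemma borel_measurable_lborel_pair:
  "borel_measurable ((lborel :: 'a::euclidean_space measure) \<Otimes>\<^sub>M (lborel :: 'a measure))
    = borel_measurable (borel :: ('a \<times> 'a) measure)"
  by (simp add: borel_prod[symmetric] cong: measurable_cong_sets sets_pair_measure_cong)

lemma jump_kernel_measurable [measurable]:
  assumes "f \<in> borel_measurable borel"
  shows "case_prod (jump_kernel f \<epsilon> r) \<in> borel_measurable (lborel \<Otimes>\<^sub>M lborel)"
proof -
  have [measurable]: "f \<in> borel_measurable (lborel \<Otimes>\<^sub>M lborel)"
    using assms by (simp add: borel_measurable_lborel_pair)
  have "case_prod (jump_kernel f \<epsilon> r)
      = (\<lambda>z. f z * indicator {z. \<epsilon> < norm (snd z - fst z) \<and> norm (snd z - fst z) \<le> r} z)"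
    by (auto simp: jump_kernel_def indicator_def fun_eq_iff)
  also have "\<dots> \<in> borel_measurable (lborel \<Otimes>\<^sub>M lborel)"
    by measurable
  finally show ?thesis .
qed

lemma far_kernel_measurable [measurable]:
  assumes "f \<in> borel_measurable borel"
  shows "case_prod (far_kernel f r) \<in> borel_measurable (lborel \<Otimes>\<^sub>M lborel)"
proof -
  have [measurable]: "f \<in> borel_measurable (lborel \<Otimes>\<^sub>M lborel)"
    using assms by (simp add: borel_measurable_lborel_pair)
  have "case_prod (far_kernel f r) = (\<lambda>z. f z * indicator {z. r < norm (snd z - fst z)} z)"
    by (auto simp: far_kernel_def indicator_def fun_eq_iff)
  also have "\<dots> \<in> borel_measurable (lborel \<Otimes>\<^sub>M lborel)"
    by measurable
  finally show ?thesis .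
qed

lemma b_eps_eq_far_kernel: "b_eps f r x = (\<integral>\<^sup>+y. far_kernel f r x y \<partial>lborel)"
  by (simp add: b_eps_def far_kernel_def)

lemma b_eps_measurable [measurable]:
  assumes [measurable]: "f \<in> borel_measurable borel"
  shows "b_eps f r \<in> borel_measurable borel"
proof -
  have "b_eps f r \<in> borel_measurable lborel"
    unfolding b_eps_eq_far_kernel[abs_def]
    by (rule lborel.borel_measurable_nn_integral) measurable
  then show ?thesis by simp
qed

lemma ennreal_le_diff:
  assumes "X + ennreal c \<le> ennreal a" "0 \<le> c"
  shows "X \<le> ennreal (a - c)"
proof (cases X)
  case (real x)
  show ?thesis
  proof (cases "0 \<le> a")
    case True
    then show ?thesis
      using assms real by (simp add: ennreal_le_iff flip: ennreal_plus)
  next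
    case False
    then have "ennreal a = 0" by (simp add: ennreal_neg)
    with assms show ?thesis by simp
  qed
next
  case top
  with assms show ?thesis by (simp add: top_unique)
qed

text \<open>Fixes one kernel, cut-off and scale \<delta>. The assumptions \<open>tilt\<close> and
  \<open>conv\<close> are instances of \<open>tilted_jumps\<close> and
  \<open>nn_integral_capped_convolution\<close>, whose constants C and K do not depend on these
  choices.\<close>

locale dominated_kernel = jump_profile \<alpha> c1 \<phi>
  for \<alpha> c1 :: real and \<phi> :: "real \<Rightarrow> real" +
  fixes f :: "'a::euclidean_space \<times> 'a \<Rightarrow> ennreal" and M C K c6 \<epsilon> \<delta> \<Lambda> :: real
  assumes f_borel [measurable]: "f \<in> borel_measurable borel"
    and f_bound: "\<And>x y. x \<noteq> y \<Longrightarrow> f (x, y) \<le> ennreal (M * jump_bound \<alpha> \<phi> (y - x))"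
    and f_sym: "\<And>x y. f (x, y) = f (y, x)"
    and tilt: "\<And>r e x. r \<le> \<delta> \<Longrightarrow> norm e \<le> 1 \<Longrightarrow>
      (\<integral>\<^sup>+y. jump_kernel f \<epsilon> r x y *
        ennreal (exp (real DIM('a) * (ln c1 + (\<alpha> + real DIM('a))) / \<delta> * ((y - x) \<bullet> e))) \<partial>lborel)
      \<le> (\<integral>\<^sup>+y. jump_kernel f \<epsilon> r x y \<partial>lborel) + ennreal (C * \<delta> powr - \<alpha>)"
    and conv: "\<And>x w. (\<integral>\<^sup>+(z::'a). ennreal (capped \<delta> (z - x)) * ennreal (capped \<delta> (z - w)) \<partial>lborel)
      \<le> ennreal (K * \<delta> powr - \<alpha> * capped \<delta> (x - w))"
    and lower: "\<And>r x. 0 < r \<Longrightarrow> r \<le> \<delta> \<Longrightarrow> ennreal (c6 * r powr - \<alpha>) \<le> b_eps f r x"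
    and total: "\<And>x. b_eps f \<epsilon> x \<le> ennreal \<Lambda>"
    and pos: "0 < M" "0 < C" "0 < K" "0 < c6" "0 < \<epsilon>" "0 < \<delta>" "\<delta> \<le> 1" "0 \<le> \<Lambda>"
begin

section \<open>Growth rates of the truncated operators\<close>

definition hold_rate :: "'a \<Rightarrow> ennreal"
  where "hold_rate x = ennreal \<Lambda> - b_eps f \<epsilon> x"

text \<open>The hold rate is that of the full operator for every r. Truncation therefore loses mass,
  and this deficit is the source of the decay in r.\<close>

definition truncated_op :: "real \<Rightarrow> ('a \<Rightarrow> ennreal) \<Rightarrow> 'a \<Rightarrow> ennreal"
  where "truncated_op r = jump_op (jump_kernel f \<epsilon> r) hold_rate"

definition capped_kernel :: "'a \<Rightarrow> 'a \<Rightarrow> ennreal"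
  where "capped_kernel x y = ennreal (capped \<delta> (x - y))"

definition potential :: "('a \<Rightarrow> ennreal) \<Rightarrow> 'a \<Rightarrow> ennreal"
  where "potential g x = (\<integral>\<^sup>+w. capped_kernel x w * g w \<partial>lborel)"

text \<open>The prefactor from \<open>jump_op_pow_tempered\<close>: at most 2 d directions times the
  tempering constant c1.\<close>

definition c_h :: real
  where "c_h = 2 * DIM('a) * c1"

lemma c_h_pos: "0 < c_h"
  using c1_ge_1 by (simp add: c_h_def)

lemma hold_rate_measurable [measurable]: "hold_rate \<in> borel_measurable borel"
  unfolding hold_rate_def[abs_def] by measurable

lemma hold_rate_plus_b: "hold_rate x + b_eps f \<epsilon> x = ennreal \<Lambda>"
  unfolding hold_rate_def by (rule diff_add_cancel_ennreal[OF total])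

lemma capped_kernel_commute: "capped_kernel x y = capped_kernel y x"
  by (simp add: capped_kernel_def capped_minus_commute)

lemma capped_kernel_measurable [measurable]: "case_prod capped_kernel \<in> borel_measurable (lborel \<Otimes>\<^sub>M lborel)"
  unfolding capped_kernel_def[abs_def] by measurable

lemma potential_measurable [measurable]:
  assumes [measurable]: "g \<in> borel_measurable borel"
  shows "potential g \<in> borel_measurable borel"
proof -
  have "potential g \<in> borel_measurable lborel"
    unfolding potential_def[abs_def] by (rule lborel.borel_measurable_nn_integral) measurable
  then show ?thesis by simp
qed

lemma capped_kernel_tempered:
  "capped_kernel z w \<le> ennreal c1 * ennreal (exp ((ln c1 + (\<alpha> + real DIM('a))) / \<delta> * norm (z - x))) * capped_kernel x w"
proof -
  have "capped \<delta> (z - w) \<le> c1 * exp ((ln c1 + (\<alpha> + real DIM('a))) / \<delta> * norm (z - x)) * capped \<delta> (x - w)"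
    using capped_tempered[of \<delta> "z - w" "x - w"] pos by simp
  then show ?thesis
    unfolding capped_kernel_def using c1_ge_1 by (simp add: ennreal_leI flip: ennreal_mult)
qed

lemma capped_kernel_tempered_right:
  "capped_kernel w z \<le> ennreal c1 * ennreal (exp ((ln c1 + (\<alpha> + real DIM('a))) / \<delta> * norm (z - x))) * capped_kernel w x"
  using capped_kernel_tempered[of z w x] by (simp only: capped_kernel_commute[of w])

text \<open>The factor in \<open>capped_kernel_tempered\<close> does not involve w, so it comes out
  of the integral and the potential inherits the bound.\<close>

lemma potential_tempered:
  assumes [measurable]: "g \<in> borel_measurable borel"
  shows "potential g z \<le> ennreal c1 * ennreal (exp ((ln c1 + (\<alpha> + real DIM('a))) / \<delta> * norm (z - x))) * potential g x"
    (is "_ \<le> ?c * _")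
proof -
  note [measurable] = measurable_kernel_section[OF capped_kernel_measurable]
  have "potential g z \<le> (\<integral>\<^sup>+w. ?c * (capped_kernel x w * g w) \<partial>lborel)"
    unfolding potential_def using capped_kernel_tempered
    by (intro nn_integral_mono) (simp only: mult.assoc[symmetric] mult_right_mono zero_le)
  also have "\<dots> = ?c * potential g x"
    unfolding potential_def by (rule nn_integral_cmult) measurable
  finally show ?thesis .
qed

text \<open>An exponential is multiplicative, so applying the operator amounts to integrating the
  tilt around z. By \<open>tilt\<close> this exceeds the jump mass by at most C \<delta>^-\<alpha>;
  together with the hold rate the jump mass is at most \<Lambda> - c, where c is a lower bound for
  the rate of the discarded jumps.\<close>

lemma truncated_op_exp_le:
  assumes r: "r \<le> \<delta>" and e: "e \<in> directions" and "0 \<le> c"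
    and c: "\<And>x. (\<integral>\<^sup>+y. jump_kernel f \<epsilon> r x y \<partial>lborel) + ennreal c \<le> b_eps f \<epsilon> x"
  defines "\<theta> \<equiv> real DIM('a) * (ln c1 + (\<alpha> + real DIM('a))) / \<delta>"
  shows "truncated_op r (\<lambda>z. ennreal (exp (\<theta> * ((z - x) \<bullet> e)))) z
    \<le> ennreal (\<Lambda> + C * \<delta> powr - \<alpha> - c) * ennreal (exp (\<theta> * ((z - x) \<bullet> e)))"
proof -
  define u where "u z = ennreal (exp (\<theta> * ((z - x) \<bullet> e)))" for z
  note [measurable] = measurable_kernel_section[OF jump_kernel_measurable[OF f_borel]]
  have "norm e \<le> 1" using e by auto
  have u: "u y = u z * ennreal (exp (\<theta> * ((y - z) \<bullet> e)))" for y
    unfolding u_def by (simp add: inner_diff_left algebra_simps flip: ennreal_mult exp_add)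
  have "truncated_op r u z = (\<integral>\<^sup>+y. u z * (jump_kernel f \<epsilon> r z y * ennreal (exp (\<theta> * ((y - z) \<bullet> e)))) \<partial>lborel) + hold_rate z * u z"
    unfolding truncated_op_def jump_op_def by (subst u) (simp add: mult_ac)
  also have "\<dots> = u z * (\<integral>\<^sup>+y. jump_kernel f \<epsilon> r z y * ennreal (exp (\<theta> * ((y - z) \<bullet> e))) \<partial>lborel) + hold_rate z * u z"
    by (subst nn_integral_cmult) auto
  also have "\<dots> \<le> u z * ((\<integral>\<^sup>+y. jump_kernel f \<epsilon> r z y \<partial>lborel) + ennreal (C * \<delta> powr - \<alpha>)) + hold_rate z * u z"
    using tilt[OF r \<open>norm e \<le> 1\<close>, of z] unfolding \<theta>_def by (intro add_right_mono mult_left_mono) auto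
  also have "\<dots> = ((\<integral>\<^sup>+y. jump_kernel f \<epsilon> r z y \<partial>lborel) + hold_rate z + ennreal (C * \<delta> powr - \<alpha>)) * u z"
    by (simp add: distrib_left distrib_right mult_ac add_ac)
  also have "\<dots> \<le> ennreal (\<Lambda> + C * \<delta> powr - \<alpha> - c) * u z"
  proof (intro mult_right_mono ennreal_le_diff)
    have "(\<integral>\<^sup>+y. jump_kernel f \<epsilon> r z y \<partial>lborel) + hold_rate z + ennreal (C * \<delta> powr - \<alpha>) + ennreal c
        = ((\<integral>\<^sup>+y. jump_kernel f \<epsilon> r z y \<partial>lborel) + ennreal c) + hold_rate z + ennreal (C * \<delta> powr - \<alpha>)"
      by (simp add: add_ac)
    also have "\<dots> \<le> b_eps f \<epsilon> z + hold_rate z + ennreal (C * \<delta> powr - \<alpha>)"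
      by (intro add_right_mono c)
    also have "\<dots> = ennreal (\<Lambda> + C * \<delta> powr - \<alpha>)"
      using hold_rate_plus_b[of z] pos by (simp add: add.commute)
    finally show "(\<integral>\<^sup>+y. jump_kernel f \<epsilon> r z y \<partial>lborel) + hold_rate z + ennreal (C * \<delta> powr - \<alpha>) + ennreal c
      \<le> ennreal (\<Lambda> + C * \<delta> powr - \<alpha>)" .
  qed (use assms in auto)
  finally show ?thesis unfolding u_def .
qed

lemma truncated_op_pow_tempered:
  assumes r: "r \<le> \<delta>" and "0 \<le> c"
    and c: "\<And>x. (\<integral>\<^sup>+y. jump_kernel f \<epsilon> r x y \<partial>lborel) + ennreal c \<le> b_eps f \<epsilon> x"
    and W: "\<And>x z. W z \<le> ennreal c1 * ennreal (exp ((ln c1 + (\<alpha> + real DIM('a))) / \<delta> * norm (z - x))) * W x"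
  shows "(truncated_op r ^^ n) W x \<le> ennreal c_h * ennreal (\<Lambda> + C * \<delta> powr - \<alpha> - c) ^ n * W x"
proof -
  have "ennreal c_h = of_nat (2 * DIM('a)) * ennreal c1"
    unfolding c_h_def ennreal_of_nat_eq_real_of_nat using c1_ge_1 by (simp flip: ennreal_mult)
  moreover have "(truncated_op r ^^ n) W x \<le> of_nat (2 * DIM('a)) * ennreal c1 * ennreal (\<Lambda> + C * \<delta> powr - \<alpha> - c) ^ n * W x"
    unfolding truncated_op_def
  proof (rule jump_op_pow_tempered)
    fix e x z :: 'a assume "e \<in> directions"
    from truncated_op_exp_le[OF r this \<open>0 \<le> c\<close> c]
    show "jump_op (jump_kernel f \<epsilon> r) hold_rate
        (\<lambda>z. ennreal (exp (real DIM('a) * (ln c1 + (\<alpha> + real DIM('a))) / \<delta> * ((z - x) \<bullet> e)))) z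
      \<le> ennreal (\<Lambda> + C * \<delta> powr - \<alpha> - c) *
        ennreal (exp (real DIM('a) * (ln c1 + (\<alpha> + real DIM('a))) / \<delta> * ((z - x) \<bullet> e)))"
      unfolding truncated_op_def .
  next
    show "0 \<le> real DIM('a) * (ln c1 + (\<alpha> + real DIM('a))) / \<delta>"
      using c1_ge_1 alpha_pos pos by (intro divide_nonneg_nonneg mult_nonneg_nonneg add_nonneg_nonneg) auto
    show "W z \<le> ennreal c1 * ennreal (exp (real DIM('a) * (ln c1 + (\<alpha> + real DIM('a))) / \<delta> / real DIM('a) * norm (z - x))) * W x"
      for x z using W[of z x] by simp
  qed measurable
  ultimately show ?thesis by simp
qed

text \<open>The trivial gap 0, for use at r = \<delta>, where \<epsilon> may be larger than
  \<delta>.\<close>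

lemma jump_kernel_le_total:
  "(\<integral>\<^sup>+y. jump_kernel f \<epsilon> r x y \<partial>lborel) + ennreal 0 \<le> b_eps f \<epsilon> x"
  by (auto simp: b_eps_eq_far_kernel jump_kernel_def far_kernel_def indicator_def intro!: nn_integral_mono)

text \<open>The jumps longer than r are missing from the truncation, and their rate
  \<open>b_eps f r\<close> is at least c6 r^-\<alpha>.\<close>

lemma jump_kernel_le_gap:
  assumes "\<epsilon> < r" "r \<le> \<delta>"
  shows "(\<integral>\<^sup>+y. jump_kernel f \<epsilon> r x y \<partial>lborel) + ennreal (c6 * r powr - \<alpha>) \<le> b_eps f \<epsilon> x"
proof -
  note [measurable] = measurable_kernel_section[OF jump_kernel_measurable[OF f_borel]]
    measurable_kernel_section[OF far_kernel_measurable[OF f_borel]]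
  have "(\<integral>\<^sup>+y. jump_kernel f \<epsilon> r x y \<partial>lborel) + ennreal (c6 * r powr - \<alpha>)
      \<le> (\<integral>\<^sup>+y. jump_kernel f \<epsilon> r x y \<partial>lborel) + b_eps f r x"
    using assms pos by (intro add_left_mono lower) auto
  also have "\<dots> = (\<integral>\<^sup>+y. jump_kernel f \<epsilon> r x y + far_kernel f r x y \<partial>lborel)"
    unfolding b_eps_eq_far_kernel by (rule nn_integral_add[symmetric]) auto
  also have "\<dots> = b_eps f \<epsilon> x"
    unfolding b_eps_eq_far_kernel using assms
    by (intro nn_integral_cong) (auto simp: jump_kernel_def far_kernel_def indicator_def)
  finally show ?thesis .
qed

section \<open>Removal of the long jumps and of the dyadic shells\<close>

lemma f_le_capped:
  assumes "\<delta> < norm (y - x)"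
  shows "f (x, y) \<le> ennreal M * capped_kernel x y"
proof -
  have "x \<noteq> y" using assms pos by auto
  then have "f (x, y) \<le> ennreal (M * jump_bound \<alpha> \<phi> (y - x))" by (rule f_bound)
  also have "jump_bound \<alpha> \<phi> (y - x) = capped \<delta> (y - x)"
    using assms pos by (intro capped_eq_jump_bound[symmetric]) auto
  finally show ?thesis
    unfolding capped_kernel_def using pos by (simp add: ennreal_mult' capped_minus_commute[of \<delta> x y])
qed

text \<open>The removed jumps are longer than r' and at most \<delta>. There \<open>capped\<close>
  has the constant value \<delta>^-(\<alpha>+d), so the removed kernel is below a multiple of
  \<open>capped_kernel\<close> with the factor (\<delta>/r')^(\<alpha>+d). The term - c6 r^-\<alpha>
  in the rate will outweigh this factor.\<close>

lemma near_step:
  assumes [measurable]: "g \<in> borel_measurable borel"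
    and r: "0 < r'" "r' \<le> r" "\<epsilon> < r" "r \<le> \<delta>"
  defines "q \<equiv> \<Lambda> + C * \<delta> powr - \<alpha> - c6 * r powr - \<alpha>"
  shows "(truncated_op r ^^ n) g x \<le> (truncated_op r' ^^ n) g x + of_nat n *
    (ennreal (M * (\<delta> / r') powr (\<alpha> + real DIM('a))) * (ennreal c_h)\<^sup>2 * ennreal q ^ (n - 1) * potential g x)"
  unfolding truncated_op_def potential_def
proof (rule jump_op_pow_split_le)
  let ?s = "\<alpha> + real DIM('a)"
  let ?b = "jump_kernel f (max \<epsilon> r') r"
  show "jump_kernel f \<epsilon> r x y = jump_kernel f \<epsilon> r' x y + ?b x y" for x y
    using r by (auto simp: jump_kernel_def indicator_def)
  show "jump_kernel f \<epsilon> r x y = jump_kernel f \<epsilon> r y x" for x y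
    using f_sym[of x y] by (simp add: jump_kernel_def indicator_def norm_minus_commute)
  show "?b x y \<le> ennreal (M * (\<delta> / r') powr ?s) * capped_kernel x y" for x y
  proof (cases "max \<epsilon> r' < norm (y - x) \<and> norm (y - x) \<le> r")
    case True
    then have "x \<noteq> y" using pos by auto
    then have "?b x y \<le> ennreal (M * jump_bound \<alpha> \<phi> (y - x))"
      using f_bound[of x y] True by (simp add: jump_kernel_def)
    also have "\<dots> \<le> ennreal (M * (\<delta> / r') powr ?s * \<delta> powr - ?s)"
    proof (intro ennreal_leI)
      have "jump_bound \<alpha> \<phi> (y - x) \<le> norm (y - x) powr - ?s"
        by (rule jump_bound_le_powr)
      also have "\<dots> \<le> r' powr - ?s"
        using True r alpha_pos by (intro powr_mono2') auto
      also have "\<dots> = (\<delta> / r') powr ?s * \<delta> powr - ?s"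
        using r pos powr_add[of \<delta> ?s "- ?s"] powr_add[of r' ?s "- ?s"] by (simp add: powr_divide field_simps)
      finally show "M * jump_bound \<alpha> \<phi> (y - x) \<le> M * (\<delta> / r') powr ?s * \<delta> powr - ?s"
        using pos by (simp add: mult.assoc)
    qed
    also have "\<delta> powr - ?s = capped \<delta> (x - y)"
      using True r pos by (intro capped_small[symmetric]) (auto simp: norm_minus_commute)
    also have "ennreal (M * (\<delta> / r') powr ?s * capped \<delta> (x - y)) = ennreal (M * (\<delta> / r') powr ?s) * capped_kernel x y"
      unfolding capped_kernel_def using pos by (intro ennreal_mult) auto
    finally show ?thesis .
  qed (auto simp: jump_kernel_def indicator_def)
  have c6: "0 \<le> c6 * r powr - \<alpha>" using pos by simp
  have gap: "(\<integral>\<^sup>+y. jump_kernel f \<epsilon> r x y \<partial>lborel) + ennreal (c6 * r powr - \<alpha>) \<le> b_eps f \<epsilon> x" for x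
    using r by (intro jump_kernel_le_gap)
  show "(jump_op (jump_kernel f \<epsilon> r) hold_rate ^^ n) (capped_kernel x) y \<le> ennreal c_h * ennreal q ^ n * capped_kernel x y" for n x y
    unfolding truncated_op_def[symmetric] q_def using r
    by (intro truncated_op_pow_tempered c6 gap capped_kernel_tempered_right) auto
  show "(jump_op (jump_kernel f \<epsilon> r') hold_rate ^^ n) (\<lambda>z. \<integral>\<^sup>+w. capped_kernel z w * g w \<partial>lborel) x
      \<le> ennreal c_h * ennreal q ^ n * (\<integral>\<^sup>+w. capped_kernel x w * g w \<partial>lborel)" for n x
  proof -
    \<comment> \<open>The gap lemma at r' would ask for \<epsilon> < r', which may fail; by
      monotonicity in the radius the rate at r serves both operators.\<close>
    have "(truncated_op r' ^^ n) (potential g) x \<le> (truncated_op r ^^ n) (potential g) x"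
      unfolding truncated_op_def using r by (intro jump_op_pow_mono) (auto simp: jump_kernel_def indicator_def)
    also have "\<dots> \<le> ennreal c_h * ennreal q ^ n * potential g x"
      unfolding q_def using r by (intro truncated_op_pow_tempered c6 gap potential_tempered) auto
    finally show ?thesis unfolding truncated_op_def potential_def[abs_def] .
  qed
qed measurable

text \<open>The long jumps have a kernel below M times \<open>capped_kernel\<close>. On this kernel
  the truncation grows with rate \<Lambda> + C \<delta>^-\<alpha>, and by the convolution bound the
  long jumps act with rate M K \<delta>^-\<alpha>; \<open>jump_op_pow_perturbed\<close> combines the
  two into Q.\<close>

lemma far_step:
  assumes [measurable]: "g \<in> borel_measurable borel"
  defines "Q \<equiv> \<Lambda> + (C + c_h * M * K) * \<delta> powr - \<alpha>"
  shows "(jump_op (far_kernel f \<epsilon>) hold_rate ^^ n) g x \<le> (truncated_op \<delta> ^^ n) g x + of_nat n *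
    (ennreal M * (ennreal c_h)\<^sup>2 * ennreal Q ^ (n - 1) * potential g x)"
  unfolding truncated_op_def potential_def
proof (rule jump_op_pow_split_le)
  let ?b = "far_kernel f (max \<epsilon> \<delta>)"
  let ?q = "\<Lambda> + C * \<delta> powr - \<alpha> - 0"
  note [measurable] = measurable_kernel_section[OF capped_kernel_measurable]
  show split: "far_kernel f \<epsilon> x y = jump_kernel f \<epsilon> \<delta> x y + ?b x y" for x y
    by (auto simp: jump_kernel_def far_kernel_def indicator_def)
  show "far_kernel f \<epsilon> x y = far_kernel f \<epsilon> y x" for x y
    using f_sym[of x y] by (simp add: far_kernel_def indicator_def norm_minus_commute)
  show b_le: "?b x y \<le> ennreal M * capped_kernel x y" for x y
    using f_le_capped[of y x] by (auto simp: far_kernel_def indicator_def)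
  have le: "(truncated_op \<delta> ^^ n) W x \<le> ennreal c_h * ennreal ?q ^ n * W x"
    if "\<And>x z. W z \<le> ennreal c1 * ennreal (exp ((ln c1 + (\<alpha> + real DIM('a))) / \<delta> * norm (z - x))) * W x"
    for W n x
    using jump_kernel_le_total that by (intro truncated_op_pow_tempered) auto
  have Q: "ennreal Q = ennreal ?q + ennreal c_h * (ennreal M * ennreal (K * \<delta> powr - \<alpha>))"
    unfolding Q_def using pos c_h_pos
    by (simp add: distrib_right mult.assoc flip: ennreal_mult ennreal_plus)
  show "(jump_op (far_kernel f \<epsilon>) hold_rate ^^ n) (capped_kernel x) y \<le> ennreal c_h * ennreal Q ^ n * capped_kernel x y" for n x y
    unfolding Q
  proof (rule jump_op_pow_perturbed[OF _ _ _ _ split])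
    show "(jump_op (jump_kernel f \<epsilon> \<delta>) hold_rate ^^ n) (capped_kernel x) y \<le> ennreal c_h * ennreal ?q ^ n * capped_kernel x y" for n y
      unfolding truncated_op_def[symmetric] by (rule le) (rule capped_kernel_tempered_right)
    show "(\<integral>\<^sup>+w. ?b y w * capped_kernel x w \<partial>lborel) \<le> ennreal M * ennreal (K * \<delta> powr - \<alpha>) * capped_kernel x y" for y
    proof -
      have "(\<integral>\<^sup>+w. ?b y w * capped_kernel x w \<partial>lborel) \<le> (\<integral>\<^sup>+w. ennreal M * (capped_kernel w x * capped_kernel w y) \<partial>lborel)"
      proof (intro nn_integral_mono)
        fix w
        have "?b y w * capped_kernel x w \<le> ennreal M * capped_kernel y w * capped_kernel x w"
          by (intro mult_right_mono b_le) auto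
        then show "?b y w * capped_kernel x w \<le> ennreal M * (capped_kernel w x * capped_kernel w y)"
          by (simp add: capped_kernel_commute[of w] mult_ac)
      qed
      also have "\<dots> = ennreal M * (\<integral>\<^sup>+w. capped_kernel w x * capped_kernel w y \<partial>lborel)"
        by (rule nn_integral_cmult) measurable
      also have "\<dots> \<le> ennreal M * ennreal (K * \<delta> powr - \<alpha> * capped \<delta> (x - y))"
        unfolding capped_kernel_def by (intro mult_left_mono conv) auto
      also have "\<dots> = ennreal M * ennreal (K * \<delta> powr - \<alpha>) * capped_kernel x y"
        unfolding capped_kernel_def using pos by (simp add: ennreal_mult mult.assoc)
      finally show ?thesis .
    qed
  qed measurable
  show "(jump_op (jump_kernel f \<epsilon> \<delta>) hold_rate ^^ n) (\<lambda>z. \<integral>\<^sup>+w. capped_kernel z w * g w \<partial>lborel) x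
      \<le> ennreal c_h * ennreal Q ^ n * (\<integral>\<^sup>+w. capped_kernel x w * g w \<partial>lborel)" for n x
  proof -
    have "(truncated_op \<delta> ^^ n) (potential g) x \<le> ennreal c_h * ennreal ?q ^ n * potential g x"
      by (intro le potential_tempered) measurable
    also have "\<dots> \<le> ennreal c_h * ennreal Q ^ n * potential g x"
      unfolding Q by (intro mult_left_mono mult_right_mono power_mono) auto
    finally show ?thesis unfolding truncated_op_def potential_def[abs_def] .
  qed
qed measurable

text \<open>\<open>far_step\<close> followed by \<open>near_step\<close> along the radii
  \<delta>/2^j, until the radius is below \<epsilon>. The first conclusion on J is kept because it
  will give q j \<ge> 0.\<close>

lemma jump_op_pow_le:
  assumes [measurable]: "g \<in> borel_measurable borel"
  defines "a \<equiv> (\<lambda>j::nat. M * 2 powr (real (Suc j) * (\<alpha> + real DIM('a))))"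
    and "q \<equiv> (\<lambda>j::nat. \<Lambda> + C * \<delta> powr - \<alpha> - c6 * (\<delta> / 2 ^ j) powr - \<alpha>)"
    and "Q \<equiv> \<Lambda> + (C + c_h * M * K) * \<delta> powr - \<alpha>"
  obtains J where "\<And>j. j < J \<Longrightarrow> \<epsilon> < \<delta> / 2 ^ j"
    "\<And>n x. (jump_op (far_kernel f \<epsilon>) hold_rate ^^ n) g x \<le> hold_rate x ^ n * g x
      + of_nat n * (ennreal M * (ennreal c_h)\<^sup>2 * ennreal Q ^ (n - 1) * potential g x)
      + (\<Sum>j<J. of_nat n * (ennreal (a j) * (ennreal c_h)\<^sup>2 * ennreal (q j) ^ (n - 1) * potential g x))"
proof -
  \<comment> \<open>J is 0 when \<delta> \<le> \<epsilon>; then there is no shell to remove.\<close>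
  define J where "J = (LEAST j. \<delta> / 2 ^ j \<le> \<epsilon>)"
  obtain k where "\<delta> / \<epsilon> < 2 ^ k" using real_arch_pow[of 2] by auto
  then have "\<delta> / 2 ^ k \<le> \<epsilon>" using pos by (simp add: field_simps)
  then have J: "\<delta> / 2 ^ J \<le> \<epsilon>" unfolding J_def by (rule LeastI)
  have less: "\<epsilon> < \<delta> / 2 ^ j" if "j < J" for j
    using not_less_Least[of j "\<lambda>j. \<delta> / 2 ^ j \<le> \<epsilon>"] that by (auto simp: J_def not_le)
  have step: "(truncated_op (\<delta> / 2 ^ j) ^^ n) g x \<le> (truncated_op (\<delta> / 2 ^ Suc j) ^^ n) g x
      + of_nat n * (ennreal (a j) * (ennreal c_h)\<^sup>2 * ennreal (q j) ^ (n - 1) * potential g x)" if "j < J" for j n x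
  proof -
    have "(\<delta> / (\<delta> / 2 ^ Suc j)) powr (\<alpha> + real DIM('a)) = 2 powr (real (Suc j) * (\<alpha> + real DIM('a)))"
      using pos by (simp add: powr_powr[symmetric] powr_realpow del: of_nat_Suc power_Suc)
    then show ?thesis
      using near_step[of g "\<delta> / 2 ^ Suc j" "\<delta> / 2 ^ j" n x] less[OF that] pos
      by (simp add: a_def q_def field_simps del: of_nat_Suc)
  qed
  have iter: "(truncated_op \<delta> ^^ n) g x \<le> (truncated_op (\<delta> / 2 ^ i) ^^ n) g x
      + (\<Sum>j<i. of_nat n * (ennreal (a j) * (ennreal c_h)\<^sup>2 * ennreal (q j) ^ (n - 1) * potential g x))"
    if "i \<le> J" for i n x
    using that
  proof (induction i)
    case (Suc i)
    have "(truncated_op \<delta> ^^ n) g x \<le> (truncated_op (\<delta> / 2 ^ i) ^^ n) g x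
      + (\<Sum>j<i. of_nat n * (ennreal (a j) * (ennreal c_h)\<^sup>2 * ennreal (q j) ^ (n - 1) * potential g x))"
      using Suc by simp
    also have "\<dots> \<le> ((truncated_op (\<delta> / 2 ^ Suc i) ^^ n) g x
      + of_nat n * (ennreal (a i) * (ennreal c_h)\<^sup>2 * ennreal (q i) ^ (n - 1) * potential g x))
      + (\<Sum>j<i. of_nat n * (ennreal (a j) * (ennreal c_h)\<^sup>2 * ennreal (q j) ^ (n - 1) * potential g x))"
      using Suc.prems by (intro add_right_mono step) simp
    finally show ?case by (simp add: add_ac)
  qed simp
  \<comment> \<open>Below \<epsilon> only multiplication by the hold rate survives, and its powers
    are explicit.\<close>
  have "jump_kernel f \<epsilon> (\<delta> / 2 ^ J) = (\<lambda>_ _. 0)"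
    using J by (auto simp: jump_kernel_def indicator_def fun_eq_iff)
  then have "truncated_op (\<delta> / 2 ^ J) u = (\<lambda>x. hold_rate x * u x)" for u
    by (simp add: truncated_op_def jump_op_def fun_eq_iff)
  then have no_jump: "(truncated_op (\<delta> / 2 ^ J) ^^ n) g x = hold_rate x ^ n * g x" for n x
    by (induction n) (simp_all add: mult.assoc)
  show thesis
  proof (rule that)
    show "\<epsilon> < \<delta> / 2 ^ j" if "j < J" for j by (rule less[OF that])
    fix n x
    have "(jump_op (far_kernel f \<epsilon>) hold_rate ^^ n) g x \<le> (truncated_op \<delta> ^^ n) g x + of_nat n *
      (ennreal M * (ennreal c_h)\<^sup>2 * ennreal Q ^ (n - 1) * potential g x)"
      unfolding Q_def by (rule far_step) measurable
    also have "\<dots> \<le> (hold_rate x ^ n * g x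
      + (\<Sum>j<J. of_nat n * (ennreal (a j) * (ennreal c_h)\<^sup>2 * ennreal (q j) ^ (n - 1) * potential g x))) + of_nat n *
      (ennreal M * (ennreal c_h)\<^sup>2 * ennreal Q ^ (n - 1) * potential g x)"
      using iter[of J n x] by (intro add_right_mono) (simp add: no_jump)
    finally show "(jump_op (far_kernel f \<epsilon>) hold_rate ^^ n) g x \<le> hold_rate x ^ n * g x
      + of_nat n * (ennreal M * (ennreal c_h)\<^sup>2 * ennreal Q ^ (n - 1) * potential g x)
      + (\<Sum>j<J. of_nat n * (ennreal (a j) * (ennreal c_h)\<^sup>2 * ennreal (q j) ^ (n - 1) * potential g x))"
      by (simp add: add_ac)
  qed
qed

end

subsection \<open>Uniformization\<close>

text \<open>Pascal's rule, arranged for the induction that expands the powers of an operator shifted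
  by the scalar c.\<close>

lemma binomial_transform_Suc:
  fixes c :: "'a::comm_ring_1" and \<tau> :: "nat \<Rightarrow> 'a"
  shows "(\<Sum>k\<le>Suc n. of_nat (Suc n choose k) * c ^ (Suc n - k) * \<tau> k)
    = (\<Sum>k\<le>n. of_nat (n choose k) * c ^ (n - k) * \<tau> (Suc k))
      + c * (\<Sum>k\<le>n. of_nat (n choose k) * c ^ (n - k) * \<tau> k)"
proof -
  have "(\<Sum>k\<le>Suc n. of_nat (n choose k) * c ^ (Suc n - k) * \<tau> k)
      = (\<Sum>k\<le>n. of_nat (n choose k) * c ^ (Suc n - k) * \<tau> k)"
    by (simp add: binomial_eq_0)
  also have "\<dots> = c * (\<Sum>k\<le>n. of_nat (n choose k) * c ^ (n - k) * \<tau> k)"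
    unfolding sum_distrib_left
    by (intro sum.cong) (simp_all add: Suc_diff_le mult_ac)
  finally have "c * (\<Sum>k\<le>n. of_nat (n choose k) * c ^ (n - k) * \<tau> k)
      = c ^ Suc n * \<tau> 0 + (\<Sum>k\<le>n. of_nat (n choose Suc k) * c ^ (n - k) * \<tau> (Suc k))"
    by (subst (asm) sum.atMost_Suc_shift) simp
  then show ?thesis
    by (subst sum.atMost_Suc_shift) (simp add: algebra_simps sum.distrib)
qed

text \<open>The factor n, which counts Duhamel terms, cancels against the factorial and shifts the
  exponential series by one; the term n = 0 vanishes.\<close>

lemma sums_exp_derivative:
  fixes t q :: real
  shows "(\<lambda>n. t ^ n / fact n * (real n * q ^ (n - 1))) sums (t * exp (t * q))"
proof -
  have "(\<lambda>n. (t * q) ^ n /\<^sub>R fact n) sums exp (t * q)"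
    by (rule exp_converges)
  then have "(\<lambda>n. t * ((t * q) ^ n /\<^sub>R fact n)) sums (t * exp (t * q))"
    by (rule sums_mult)
  moreover have "t * ((t * q) ^ n /\<^sub>R fact n) = t ^ Suc n / fact (Suc n) * (real (Suc n) * q ^ (Suc n - 1))" for n
    by (simp add: power_mult_distrib divide_simps)
  ultimately have "(\<lambda>n. t ^ Suc n / fact (Suc n) * (real (Suc n) * q ^ (Suc n - 1))) sums (t * exp (t * q))"
    by simp
  from sums_Suc[OF this] show ?thesis by simp
qed

context dominated_kernel
begin

section \<open>The generator on real functions and its positive shift\<close>

definition jump_density :: "'a \<Rightarrow> 'a \<Rightarrow> real"
  where "jump_density x y = enn2real (f_eps f \<epsilon> (x, y))"

definition exit_rate :: "'a \<Rightarrow> real"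
  where "exit_rate x = enn2real (b_eps f \<epsilon> x)"

abbreviation generator :: "('a \<Rightarrow> real) \<Rightarrow> 'a \<Rightarrow> real"
  where "generator \<equiv> A_eps f \<epsilon>"

text \<open>\<Lambda> dominates every exit rate, so the shift makes the generator a positive
  operator, to which the \<open>ennreal\<close> estimates apply.\<close>

definition uniformized :: "('a \<Rightarrow> real) \<Rightarrow> 'a \<Rightarrow> real"
  where "uniformized g x = generator g x + \<Lambda> * g x"

abbreviation uniformized_ennreal :: "('a \<Rightarrow> ennreal) \<Rightarrow> 'a \<Rightarrow> ennreal"
  where "uniformized_ennreal \<equiv> jump_op (far_kernel f \<epsilon>) hold_rate"

lemma f_section_measurable [measurable]: "(\<lambda>y. f (x, y)) \<in> borel_measurable borel"
  by (rule measurable_compose[OF _ f_borel]) (simp add: borel_prod[symmetric])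

lemma jump_density_measurable [measurable]: "jump_density x \<in> borel_measurable borel"
  unfolding jump_density_def[abs_def] f_eps_def prod.case by measurable

lemma jump_density_nonneg: "0 \<le> jump_density x y"
  by (simp add: jump_density_def)

lemma ennreal_jump_density: "ennreal (jump_density x y) = f (x, y) * indicator {y. \<epsilon> \<le> norm (y - x)} y"
proof (cases "\<epsilon> \<le> norm (y - x)")
  case True
  then have "x \<noteq> y" using pos by auto
  then have "f (x, y) \<le> ennreal (M * jump_bound \<alpha> \<phi> (y - x))" by (rule f_bound)
  then have "f (x, y) < top" by (rule le_less_trans) simp
  then show ?thesis using True by (simp add: jump_density_def f_eps_def)
qed (simp add: jump_density_def f_eps_def)

lemma AE_not_sphere: "AE y in lborel. norm (y - x) \<noteq> \<epsilon>" for x :: 'a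
proof -
  have "negligible (sphere x \<epsilon>)" by (rule negligible_sphere)
  then have "sphere x \<epsilon> \<in> null_sets lborel"
    by (simp add: negligible_iff_null_sets null_sets_completion_iff)
  then show ?thesis
    by (rule AE_mp[OF AE_not_in]) (auto simp: dist_norm norm_minus_commute)
qed

text \<open>\<open>f_eps\<close> keeps the jumps of length exactly \<epsilon> and
  \<open>b_eps\<close> drops them; the two kernels differ on a sphere, which is a null set.\<close>

lemma nn_integral_jump_density:
  "(\<integral>\<^sup>+y. ennreal (jump_density x y) * u y \<partial>lborel) = (\<integral>\<^sup>+y. far_kernel f \<epsilon> x y * u y \<partial>lborel)"
proof (rule nn_integral_cong_AE)
  show "AE y in lborel. ennreal (jump_density x y) * u y = far_kernel f \<epsilon> x y * u y"
    using AE_not_sphere[of x]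
    by eventually_elim (auto simp: ennreal_jump_density far_kernel_def indicator_def)
qed

lemma ennreal_exit_rate: "ennreal (exit_rate x) = b_eps f \<epsilon> x"
  unfolding exit_rate_def using le_less_trans[OF total[of x] ennreal_less_top] by simp

lemma exit_rate_nonneg: "0 \<le> exit_rate x"
  by (simp add: exit_rate_def)

lemma exit_rate_le: "exit_rate x \<le> \<Lambda>"
  using total[of x] pos unfolding ennreal_exit_rate[symmetric] by (simp add: ennreal_le_iff)

lemma hold_rate_eq: "hold_rate x = ennreal (\<Lambda> - exit_rate x)"
  unfolding hold_rate_def ennreal_exit_rate[symmetric] by (simp add: ennreal_minus exit_rate_nonneg)

lemma nn_integral_jump_density_total: "(\<integral>\<^sup>+y. ennreal (jump_density x y) \<partial>lborel) = ennreal (exit_rate x)"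
  using nn_integral_jump_density[of x "\<lambda>_. 1"] unfolding ennreal_exit_rate b_eps_eq_far_kernel by simp

lemma jump_density_integrable: "integrable lborel (jump_density x)"
  by (rule integrableI_nonneg) (auto simp: nn_integral_jump_density_total jump_density_nonneg)

lemma integral_jump_density: "(\<integral>y. jump_density x y \<partial>lborel) = exit_rate x"
  by (subst integral_eq_nn_integral) (auto simp: nn_integral_jump_density_total jump_density_nonneg exit_rate_nonneg)

lemma mult_jump_density_integrable:
  assumes [measurable]: "g \<in> borel_measurable borel" and "\<And>y. \<bar>g y\<bar> \<le> G"
  shows "integrable lborel (\<lambda>y. g y * jump_density x y)"
proof (rule Bochner_Integration.integrable_bound)
  show "integrable lborel (\<lambda>y. G * jump_density x y)" using jump_density_integrable by simp
  show "AE y in lborel. norm (g y * jump_density x y) \<le> norm (G * jump_density x y)"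
  proof (rule AE_I2)
    fix y
    have "\<bar>g y\<bar> * jump_density x y \<le> G * jump_density x y"
      using assms(2) jump_density_nonneg by (intro mult_right_mono)
    also have "G * jump_density x y \<le> norm (G * jump_density x y)"
      unfolding real_norm_def by (rule abs_ge_self)
    finally show "norm (g y * jump_density x y) \<le> norm (G * jump_density x y)"
      using jump_density_nonneg[of x y] by (simp add: abs_mult)
  qed
qed measurable

text \<open>The density has finite integral and g is bounded, so the difference under the integral
  may be split.\<close>

lemma generator_eq:
  assumes [measurable]: "g \<in> borel_measurable borel" and "\<And>y. \<bar>g y\<bar> \<le> G"
  shows "generator g x = (\<integral>y. g y * jump_density x y \<partial>lborel) - exit_rate x * g x"
proof -
  have "generator g x = (\<integral>y. g y * jump_density x y - g x * jump_density x y \<partial>lborel)"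
    unfolding A_eps_def jump_density_def[symmetric] by (simp add: left_diff_distrib)
  also have "\<dots> = (\<integral>y. g y * jump_density x y \<partial>lborel) - (\<integral>y. g x * jump_density x y \<partial>lborel)"
    using mult_jump_density_integrable[OF assms] jump_density_integrable by (intro Bochner_Integration.integral_diff) auto
  finally show ?thesis by (simp add: integral_jump_density mult.commute)
qed

lemma generator_sum:
  assumes "finite I" and u: "\<And>i. i \<in> I \<Longrightarrow> u i \<in> borel_measurable borel"
    and G: "\<And>i y. i \<in> I \<Longrightarrow> \<bar>u i y\<bar> \<le> G i"
  shows "generator (\<lambda>y. \<Sum>i\<in>I. c i * u i y) x = (\<Sum>i\<in>I. c i * generator (u i) x)"
proof -
  have "\<bar>\<Sum>i\<in>I. c i * u i y\<bar> \<le> (\<Sum>i\<in>I. \<bar>c i\<bar> * G i)" for y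
    using G by (intro order_trans[OF sum_abs] sum_mono) (auto simp: abs_mult intro: mult_left_mono)
  moreover have "(\<lambda>y. \<Sum>i\<in>I. c i * u i y) \<in> borel_measurable borel"
    using u by measurable
  ultimately have "generator (\<lambda>y. \<Sum>i\<in>I. c i * u i y) x
      = (\<integral>y. (\<Sum>i\<in>I. c i * u i y) * jump_density x y \<partial>lborel) - exit_rate x * (\<Sum>i\<in>I. c i * u i x)"
    by (intro generator_eq)
  also have "(\<integral>y. (\<Sum>i\<in>I. c i * u i y) * jump_density x y \<partial>lborel) = (\<integral>y. (\<Sum>i\<in>I. c i * (u i y * jump_density x y)) \<partial>lborel)"
    by (simp add: sum_distrib_right mult.assoc)
  also have "\<dots> = (\<Sum>i\<in>I. c i * (\<integral>y. u i y * jump_density x y \<partial>lborel))"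
    using mult_jump_density_integrable[OF u G] by (subst Bochner_Integration.integral_sum) auto
  also have "\<dots> - exit_rate x * (\<Sum>i\<in>I. c i * u i x) = (\<Sum>i\<in>I. c i * ((\<integral>y. u i y * jump_density x y \<partial>lborel) - exit_rate x * u i x))"
    by (simp add: sum_distrib_left right_diff_distrib sum_subtractf mult_ac)
  also have "\<dots> = (\<Sum>i\<in>I. c i * generator (u i) x)"
    using generator_eq[OF u G] by (intro sum.cong) auto
  finally show ?thesis .
qed

lemma ennreal_uniformized:
  assumes [measurable]: "g \<in> borel_measurable borel" and g: "\<And>y. 0 \<le> g y" "\<And>y. g y \<le> G"
  shows "0 \<le> uniformized g x" "ennreal (uniformized g x) = uniformized_ennreal (\<lambda>y. ennreal (g y)) x"
proof -
  have abs: "\<bar>g y\<bar> \<le> G" for y using g[of y] by simp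
  have uniformized_x: "uniformized g x = (\<integral>y. g y * jump_density x y \<partial>lborel) + (\<Lambda> - exit_rate x) * g x"
    using generator_eq[OF assms(1) abs] by (simp add: uniformized_def algebra_simps)
  have 1: "0 \<le> (\<integral>y. g y * jump_density x y \<partial>lborel)"
    using g jump_density_nonneg by (intro integral_nonneg_AE) auto
  have 2: "0 \<le> (\<Lambda> - exit_rate x) * g x" using g exit_rate_le[of x] by simp
  show "0 \<le> uniformized g x" using 1 2 uniformized_x by simp
  have "ennreal (uniformized g x) = ennreal (\<integral>y. g y * jump_density x y \<partial>lborel) + ennreal ((\<Lambda> - exit_rate x) * g x)"
    unfolding uniformized_x using 1 2 by (rule ennreal_plus)
  also have "ennreal ((\<Lambda> - exit_rate x) * g x) = hold_rate x * ennreal (g x)"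
    unfolding hold_rate_eq using exit_rate_le[of x] by (intro ennreal_mult') simp
  also have "ennreal (\<integral>y. g y * jump_density x y \<partial>lborel) = (\<integral>\<^sup>+y. ennreal (g y * jump_density x y) \<partial>lborel)"
    using mult_jump_density_integrable[OF assms(1) abs] g jump_density_nonneg by (intro nn_integral_eq_integral[symmetric]) auto
  also have "\<dots> = (\<integral>\<^sup>+y. ennreal (jump_density x y) * ennreal (g y) \<partial>lborel)"
    using g jump_density_nonneg by (simp add: ennreal_mult mult.commute)
  also have "\<dots> = (\<integral>\<^sup>+y. far_kernel f \<epsilon> x y * ennreal (g y) \<partial>lborel)"
    by (rule nn_integral_jump_density)
  finally show "ennreal (uniformized g x) = uniformized_ennreal (\<lambda>y. ennreal (g y)) x"
    by (simp add: jump_op_def)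
qed

text \<open>Jump mass and hold rate add up to \<Lambda> at every point. This yields the factor
  \<Lambda> per application in the supremum norm.\<close>

lemma uniformized_ennreal_const: "uniformized_ennreal (\<lambda>_. c) x = ennreal \<Lambda> * c"
proof -
  note [measurable] = measurable_kernel_section[OF far_kernel_measurable[OF f_borel]]
  have "uniformized_ennreal (\<lambda>_. c) x = (b_eps f \<epsilon> x + hold_rate x) * c"
    by (simp add: jump_op_def nn_integral_multc b_eps_eq_far_kernel distrib_right)
  then show ?thesis using hold_rate_plus_b[of x] by (simp add: add.commute)
qed

lemma uniformized_measurable:
  assumes [measurable]: "g \<in> borel_measurable borel" and g: "\<And>y. 0 \<le> g y" "\<And>y. g y \<le> G"
  shows "uniformized g \<in> borel_measurable borel"
proof -
  have "uniformized g x = enn2real (uniformized_ennreal (\<lambda>y. ennreal (g y)) x)" for x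
    using ennreal_uniformized[OF assms, of x] by (metis enn2real_ennreal)
  then have "uniformized g = (\<lambda>x. enn2real (uniformized_ennreal (\<lambda>y. ennreal (g y)) x))" by auto
  also have "\<dots> \<in> borel_measurable borel" by measurable
  finally show ?thesis .
qed

lemma uniformized_le:
  assumes [measurable]: "g \<in> borel_measurable borel" and g: "\<And>y. 0 \<le> g y" "\<And>y. g y \<le> G"
  shows "uniformized g x \<le> \<Lambda> * G"
proof -
  have "0 \<le> G" using g by (rule order_trans)
  have "ennreal (uniformized g x) \<le> uniformized_ennreal (\<lambda>_. ennreal G) x"
    unfolding ennreal_uniformized[OF assms] using g by (intro jump_op_mono ennreal_leI) auto
  also have "\<dots> = ennreal (\<Lambda> * G)"
    using pos \<open>0 \<le> G\<close> by (simp add: uniformized_ennreal_const ennreal_mult)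
  finally show ?thesis using pos \<open>0 \<le> G\<close> by (simp add: ennreal_le_iff)
qed

text \<open>The four claims go through one induction: passing to the next power, and identifying it
  with the \<open>ennreal\<close> power, takes measurability, sign and bound of the previous
  one.\<close>

lemma uniformized_pow:
  assumes [measurable]: "g \<in> borel_measurable borel" and g: "\<And>y. 0 \<le> g y" "\<And>y. g y \<le> G"
  shows "(uniformized ^^ n) g \<in> borel_measurable borel"
    "\<And>x. 0 \<le> (uniformized ^^ n) g x" "\<And>x. (uniformized ^^ n) g x \<le> \<Lambda> ^ n * G"
    "\<And>x. ennreal ((uniformized ^^ n) g x) = (uniformized_ennreal ^^ n) (\<lambda>y. ennreal (g y)) x"
proof (induction n)
  case (Suc n)
  {
    case 1
    show ?case using uniformized_measurable[OF Suc(1-3)] by simp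
  next
    case (2 x)
    show ?case using ennreal_uniformized(1)[OF Suc(1-3)] by simp
  next
    case (3 x)
    show ?case using uniformized_le[OF Suc(1-3)] by (simp add: mult.assoc)
  next
    case (4 x)
    show ?case using ennreal_uniformized(2)[OF Suc(1-3)] Suc(4) by simp
  }
qed (use assms in auto)

section \<open>From powers to the exponential series\<close>

lemma generator_pow:
  assumes "g \<in> borel_measurable borel" and g: "\<And>y. 0 \<le> g y" "\<And>y. g y \<le> G"
  shows "(generator ^^ n) g x = (\<Sum>k\<le>n. real (n choose k) * (- \<Lambda>) ^ (n - k) * (uniformized ^^ k) g x)"
proof (induction n arbitrary: x)
  case (Suc n)
  note uniformized_props = uniformized_pow[OF assms]
  have "(generator ^^ Suc n) g x = generator (\<lambda>x. \<Sum>k\<le>n. real (n choose k) * (- \<Lambda>) ^ (n - k) * (uniformized ^^ k) g x) x"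
    using ext[of "(generator ^^ n) g", OF Suc.IH] by simp
  \<comment> \<open>Linearity of the Bochner integral needs integrable summands; the bounds
    \<Lambda>^k G provide them.\<close>
  also have "\<dots> = (\<Sum>k\<le>n. real (n choose k) * (- \<Lambda>) ^ (n - k) * generator ((uniformized ^^ k) g) x)"
    using uniformized_props by (intro generator_sum[where G = "\<lambda>k. \<Lambda> ^ k * G"]) auto
  also have "\<dots> = (\<Sum>k\<le>n. real (n choose k) * (- \<Lambda>) ^ (n - k) * (uniformized ^^ Suc k) g x)
      + (- \<Lambda>) * (\<Sum>k\<le>n. real (n choose k) * (- \<Lambda>) ^ (n - k) * (uniformized ^^ k) g x)"
    unfolding sum_distrib_left sum.distrib[symmetric]
    by (intro sum.cong) (simp_all add: uniformized_def[of "(uniformized ^^ k) g" for k] algebra_simps)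
  finally show ?case
    by (simp only: binomial_transform_Suc)
qed simp

text \<open>By \<open>generator_pow\<close> the series of the generator is the Cauchy product of the
  series of exp (- \<Lambda> t) with that of the shifted operator. Both converge absolutely, the
  latter because its powers are at most \<Lambda>^n G.\<close>

lemma exp_op_eq:
  assumes "g \<in> borel_measurable borel" and g: "\<And>y. 0 \<le> g y" "\<And>y. g y \<le> G"
  shows "summable (\<lambda>n. t ^ n / fact n * (uniformized ^^ n) g x)"
    "exp_op t generator g x = exp (- \<Lambda> * t) * (\<Sum>n. t ^ n / fact n * (uniformized ^^ n) g x)"
proof -
  let ?a = "\<lambda>n. (- \<Lambda> * t) ^ n /\<^sub>R fact n" and ?b = "\<lambda>n. t ^ n / fact n * (uniformized ^^ n) g x"
  note uniformized_props = uniformized_pow[OF assms]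
  have b: "summable (\<lambda>n. norm (?b n))"
  proof (rule summable_comparison_test')
    show "summable (\<lambda>n. G * ((\<bar>t\<bar> * \<Lambda>) ^ n /\<^sub>R fact n))"
      by (intro summable_mult summable_exp_generic)
    show "norm (norm (?b n)) \<le> G * ((\<bar>t\<bar> * \<Lambda>) ^ n /\<^sub>R fact n)" for n
    proof -
      have "norm (norm (?b n)) = \<bar>t\<bar> ^ n / fact n * (uniformized ^^ n) g x"
        using uniformized_props(2)[of n x] by (simp add: abs_mult power_abs)
      also have "\<dots> \<le> \<bar>t\<bar> ^ n / fact n * (\<Lambda> ^ n * G)"
        using uniformized_props(3)[of n x] by (intro mult_left_mono) auto
      finally show ?thesis by (simp add: power_mult_distrib divide_inverse mult_ac)
    qed
  qed
  show "summable ?b" using b by (rule summable_norm_cancel)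
  have "exp_op t generator g x = (\<Sum>n. \<Sum>k\<le>n. ?b k * ?a (n - k))"
    unfolding exp_op_def
  proof (intro suminf_cong)
    fix n
    have "t ^ n * (generator ^^ n) g x / fact n
        = (\<Sum>k\<le>n. t ^ n / fact n * (real (n choose k) * (- \<Lambda>) ^ (n - k) * (uniformized ^^ k) g x))"
      by (simp add: generator_pow[OF assms] sum_distrib_left sum_divide_distrib)
    also have "\<dots> = (\<Sum>k\<le>n. ?b k * ?a (n - k))"
    proof (intro sum.cong refl)
      fix k assume "k \<in> {..n}"
      then have k: "k \<le> n" by simp
      have "t ^ n = t ^ k * t ^ (n - k)" using k by (simp flip: power_add)
      then show "t ^ n / fact n * (real (n choose k) * (- \<Lambda>) ^ (n - k) * (uniformized ^^ k) g x) = ?b k * ?a (n - k)"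
        using k by (simp only: binomial_fact[OF k] power_mult_distrib scaleR_conv_of_real)
          (simp add: field_simps)
    qed
    finally show "t ^ n * (generator ^^ n) g x / fact n = (\<Sum>k\<le>n. ?b k * ?a (n - k))" .
  qed
  also have "\<dots> = suminf ?b * suminf ?a"
    using b summable_norm_exp by (rule Cauchy_product[symmetric])
  also have "suminf ?a = exp (- \<Lambda> * t)"
    by (simp only: exp_def)
  finally show "exp_op t generator g x = exp (- \<Lambda> * t) * suminf ?b"
    by (simp only: mult.commute)
qed

end

subsection \<open>The bound for the exponential\<close>

lemma ennreal_affine_le:
  fixes u w :: real
  assumes "0 \<le> u" "0 \<le> w" "\<And>j. j \<in> I \<Longrightarrow> 0 \<le> z j" "finite I"
    and "ennreal y \<le> ennreal u + ennreal w + (\<Sum>j\<in>I. ennreal (z j))"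
  shows "y \<le> u + w + (\<Sum>j\<in>I. z j)"
proof -
  have "(\<Sum>j\<in>I. ennreal (z j)) = ennreal (\<Sum>j\<in>I. z j)"
    using assms by (intro sum_ennreal)
  moreover have "0 \<le> (\<Sum>j\<in>I. z j)" using assms by (intro sum_nonneg)
  ultimately show ?thesis
    using assms(1,2,5) by (simp add: ennreal_le_iff flip: ennreal_plus)
qed

lemma (in jump_profile) capped_integrable:
  fixes g :: "'a::euclidean_space \<Rightarrow> real"
  assumes "0 < \<delta>" "g \<in> borel_measurable borel" "\<And>y. \<bar>g y\<bar> \<le> G"
  shows "integrable lborel (\<lambda>y. g y * capped \<delta> (y - x))"
proof (rule Bochner_Integration.integrable_bound)
  obtain K' where "\<And>\<delta>. 0 < \<delta> \<Longrightarrow>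
      (\<integral>\<^sup>+(h::'a). ennreal (capped \<delta> h) \<partial>lborel) \<le> ennreal (K' * \<delta> powr - \<alpha>)"
    using nn_integral_capped[where 'a = 'a] by blast
  from this[OF assms(1)] have "(\<integral>\<^sup>+(y::'a). ennreal (capped \<delta> (y - x)) \<partial>lborel) \<le> ennreal (K' * \<delta> powr - \<alpha>)"
    by (subst nn_integral_lborel_shift) auto
  then have "(\<integral>\<^sup>+(y::'a). ennreal (capped \<delta> (y - x)) \<partial>lborel) < \<infinity>"
    by (rule le_less_trans) simp
  then have "integrable lborel (\<lambda>y::'a. capped \<delta> (y - x))"
    by (intro integrableI_nonneg) auto
  then show "integrable lborel (\<lambda>y::'a. G * capped \<delta> (y - x))" by simp
  show "AE y in lborel. norm (g y * capped \<delta> (y - x)) \<le> norm (G * capped \<delta> (y - x))"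
  proof (rule AE_I2)
    fix y
    have "\<bar>g y\<bar> * capped \<delta> (y - x) \<le> G * capped \<delta> (y - x)"
      using assms(3) by (intro mult_right_mono) auto
    also have "G * capped \<delta> (y - x) \<le> norm (G * capped \<delta> (y - x))"
      unfolding real_norm_def by (rule abs_ge_self)
    finally show "norm (g y * capped \<delta> (y - x)) \<le> norm (G * capped \<delta> (y - x))"
      by (simp add: abs_mult)
  qed
  show "(\<lambda>y. g y * capped \<delta> (y - x)) \<in> borel_measurable lborel"
    using assms(2) by measurable
qed

context dominated_kernel
begin

lemma potential_eq:
  assumes [measurable]: "g \<in> borel_measurable borel" and g: "\<And>y. 0 \<le> g y" "\<And>y. g y \<le> G"
  shows "potential (\<lambda>y. ennreal (g y)) x = ennreal (\<integral>y. g y * capped \<delta> (y - x) \<partial>lborel)"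
proof -
  have "potential (\<lambda>y. ennreal (g y)) x = (\<integral>\<^sup>+y. ennreal (g y * capped \<delta> (y - x)) \<partial>lborel)"
    unfolding potential_def capped_kernel_def using g
    by (intro nn_integral_cong) (simp add: capped_minus_commute[of \<delta> x] ennreal_mult mult.commute)
  also have "\<dots> = ennreal (\<integral>y. g y * capped \<delta> (y - x) \<partial>lborel)"
    using g pos by (intro nn_integral_eq_integral capped_integrable[where G = G]) (auto simp: abs_le_iff intro: order_trans)
  finally show ?thesis .
qed

lemma uniformized_pow_le:
  assumes [measurable]: "g \<in> borel_measurable borel" and g: "\<And>y. 0 \<le> g y" "\<And>y. g y \<le> G"
  defines "v \<equiv> (\<lambda>x. \<integral>y. g y * capped \<delta> (y - x) \<partial>lborel)"
    and "a \<equiv> (\<lambda>j::nat. M * 2 powr (real (Suc j) * (\<alpha> + real DIM('a))))"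
    and "q \<equiv> (\<lambda>j::nat. \<Lambda> + C * \<delta> powr - \<alpha> - c6 * (\<delta> / 2 ^ j) powr - \<alpha>)"
    and "Q \<equiv> \<Lambda> + (C + c_h * M * K) * \<delta> powr - \<alpha>"
  obtains J where "\<And>n x. (uniformized ^^ n) g x \<le> (\<Lambda> - exit_rate x) ^ n * g x
      + M * c_h\<^sup>2 * v x * (real n * Q ^ (n - 1))
      + (\<Sum>j<J. a j * c_h\<^sup>2 * v x * (real n * q j ^ (n - 1)))"
proof -
  have gm: "(\<lambda>y. ennreal (g y)) \<in> borel_measurable borel" by measurable
  obtain J where J: "\<And>j. j < J \<Longrightarrow> \<epsilon> < \<delta> / 2 ^ j"
    "\<And>n x. (uniformized_ennreal ^^ n) (\<lambda>y. ennreal (g y)) x \<le> hold_rate x ^ n * ennreal (g x)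
      + of_nat n * (ennreal M * (ennreal c_h)\<^sup>2 * ennreal Q ^ (n - 1) * potential (\<lambda>y. ennreal (g y)) x)
      + (\<Sum>j<J. of_nat n * (ennreal (a j) * (ennreal c_h)\<^sup>2 * ennreal (q j) ^ (n - 1) * potential (\<lambda>y. ennreal (g y)) x))"
    unfolding a_def q_def Q_def
    by (rule jump_op_pow_le[OF gm]) blast
  have a: "0 \<le> a j" for j using pos by (simp add: a_def)
  have Q: "0 \<le> Q" using pos c_h_pos by (simp add: Q_def)
  have v: "0 \<le> v x" for x unfolding v_def using g by (intro integral_nonneg_AE) auto
  \<comment> \<open>\<open>ennreal\<close> sends negative numbers to 0, so the bounds return to real
    powers only for nonnegative rates. For j < J the gap at \<delta>/2^j is part of the exit rate at
    any point, here \<open>undefined\<close>, and hence at most \<Lambda>.\<close>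
  have q: "0 \<le> q j" if "j < J" for j
  proof -
    have "\<delta> / 2 ^ j \<le> \<delta>" using pos by (simp add: field_simps)
    then have "ennreal (c6 * (\<delta> / 2 ^ j) powr - \<alpha>) \<le> b_eps f \<epsilon> undefined"
      using jump_kernel_le_gap[OF J(1)[OF that], of undefined] by (auto intro: order_trans[rotated] simp: add_increasing)
    also have "\<dots> \<le> ennreal \<Lambda>" by (rule total)
    finally have "c6 * (\<delta> / 2 ^ j) powr - \<alpha> \<le> \<Lambda>"
      using pos by (simp add: ennreal_le_iff)
    moreover have "0 \<le> C * \<delta> powr - \<alpha>" using pos by simp
    ultimately show ?thesis by (simp add: q_def)
  qed
  have summand: "of_nat n * (ennreal c * (ennreal c_h)\<^sup>2 * ennreal r ^ (n - 1) * ennreal (v x))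
      = ennreal (c * c_h\<^sup>2 * v x * (real n * r ^ (n - 1)))" if "0 \<le> c" "0 \<le> r" for c r n x
    using that c_h_pos v[of x]
    by (simp add: ennreal_of_nat_eq_real_of_nat ennreal_power ennreal_mult mult_ac)
  show thesis
  proof (rule that)
    fix n x
    note uniformized_props = uniformized_pow[OF assms(1) g]
    have mg: "hold_rate x ^ n * ennreal (g x) = ennreal ((\<Lambda> - exit_rate x) ^ n * g x)"
      unfolding hold_rate_eq using exit_rate_le[of x] g by (simp add: ennreal_power ennreal_mult)
    have "ennreal ((uniformized ^^ n) g x) \<le> ennreal ((\<Lambda> - exit_rate x) ^ n * g x)
      + ennreal (M * c_h\<^sup>2 * v x * (real n * Q ^ (n - 1)))
      + (\<Sum>j<J. ennreal (a j * c_h\<^sup>2 * v x * (real n * q j ^ (n - 1))))"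
    proof -
      have potential_x: "potential (\<lambda>y. ennreal (g y)) x = ennreal (v x)"
        unfolding v_def by (rule potential_eq[OF assms(1) g])
      have "(\<Sum>j<J. of_nat n * (ennreal (a j) * (ennreal c_h)\<^sup>2 * ennreal (q j) ^ (n - 1) * ennreal (v x)))
          = (\<Sum>j<J. ennreal (a j * c_h\<^sup>2 * v x * (real n * q j ^ (n - 1))))"
        using a q by (intro sum.cong refl summand) auto
      then show ?thesis
        using J(2)[of n x] unfolding uniformized_props(4) potential_x mg summand[OF less_imp_le[OF pos(1)] Q] by (simp only:)
    qed
    then show "(uniformized ^^ n) g x \<le> (\<Lambda> - exit_rate x) ^ n * g x
      + M * c_h\<^sup>2 * v x * (real n * Q ^ (n - 1))
      + (\<Sum>j<J. a j * c_h\<^sup>2 * v x * (real n * q j ^ (n - 1)))"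
      using g exit_rate_le[of x] pos v[of x] Q a q c_h_pos
      by (intro ennreal_affine_le) auto
  qed
qed

text \<open>Summation of the bound for the powers against t^n / n!. The holding term gives the
  exponential of the exit rate, the long jumps give the summand 1 in D + 1, and the shells give D,
  which is independent of their number and hence of \<epsilon>.\<close>

lemma exp_op_le:
  assumes [measurable]: "g \<in> borel_measurable borel" and g: "\<And>y. 0 \<le> g y" "\<And>y. g y \<le> G"
    and t: "0 < t" "1 \<le> t * \<delta> powr - \<alpha>"
    and D: "\<And>J. (\<Sum>j<J. 2 powr (real (Suc j) * (\<alpha> + real DIM('a))) * exp (- c6 * 2 powr (real j * \<alpha>))) \<le> D"
  shows "exp_op t (A_eps f \<epsilon>) g x \<le> exp (- t * enn2real (b_eps f \<epsilon> x)) * g x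
    + M * c_h\<^sup>2 * (D + 1) * (t * exp ((C + c_h * M * K) * (t * \<delta> powr - \<alpha>)))
      * (\<integral>y. g y * capped \<delta> (y - x) \<partial>lborel)"
proof -
  define v where "v = (\<integral>y. g y * capped \<delta> (y - x) \<partial>lborel)"
  define a where "a j = M * 2 powr (real (Suc j) * (\<alpha> + real DIM('a)))" for j
  define q where "q j = \<Lambda> + C * \<delta> powr - \<alpha> - c6 * (\<delta> / 2 ^ j) powr - \<alpha>" for j :: nat
  define Q where "Q = \<Lambda> + (C + c_h * M * K) * \<delta> powr - \<alpha>"
  let ?\<tau> = "t * \<delta> powr - \<alpha>"
  obtain J where J: "\<And>n. (uniformized ^^ n) g x \<le> (\<Lambda> - exit_rate x) ^ n * g x
      + M * c_h\<^sup>2 * v * (real n * Q ^ (n - 1))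
      + (\<Sum>j<J. a j * c_h\<^sup>2 * v * (real n * q j ^ (n - 1)))"
    unfolding v_def a_def q_def Q_def by (rule uniformized_pow_le[OF assms(1) g]) blast
  have v: "0 \<le> v" unfolding v_def using g by (intro integral_nonneg_AE) auto
  have "(\<lambda>n. t ^ n / fact n * ((\<Lambda> - exit_rate x) ^ n * g x)) sums (exp (t * (\<Lambda> - exit_rate x)) * g x)"
    using sums_mult2[OF exp_converges[of "t * (\<Lambda> - exit_rate x)"], of "g x"]
    by (simp add: power_mult_distrib divide_inverse mult_ac)
  moreover have series: "(\<lambda>n. t ^ n / fact n * (c * (real n * r ^ (n - 1)))) sums (c * (t * exp (t * r)))" for c r
    using sums_mult[OF sums_exp_derivative[of t r], of c] by (simp add: mult_ac)
  ultimately have sums: "(\<lambda>n. t ^ n / fact n * ((\<Lambda> - exit_rate x) ^ n * g x)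
      + t ^ n / fact n * (M * c_h\<^sup>2 * v * (real n * Q ^ (n - 1)))
      + (\<Sum>j<J. t ^ n / fact n * (a j * c_h\<^sup>2 * v * (real n * q j ^ (n - 1)))))
    sums (exp (t * (\<Lambda> - exit_rate x)) * g x + M * c_h\<^sup>2 * v * (t * exp (t * Q))
      + (\<Sum>j<J. a j * c_h\<^sup>2 * v * (t * exp (t * q j))))"
    by (intro sums_add sums_sum series)
  have "(\<Sum>n. t ^ n / fact n * (uniformized ^^ n) g x) \<le> exp (t * (\<Lambda> - exit_rate x)) * g x + M * c_h\<^sup>2 * v * (t * exp (t * Q))
      + (\<Sum>j<J. a j * c_h\<^sup>2 * v * (t * exp (t * q j)))"
  proof (rule sums_le[OF _ summable_sums[OF exp_op_eq(1)[OF assms(1) g]] sums])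
    fix n
    have "t ^ n / fact n * (uniformized ^^ n) g x \<le> t ^ n / fact n * ((\<Lambda> - exit_rate x) ^ n * g x
      + M * c_h\<^sup>2 * v * (real n * Q ^ (n - 1))
      + (\<Sum>j<J. a j * c_h\<^sup>2 * v * (real n * q j ^ (n - 1))))"
      using t by (intro mult_left_mono J) auto
    then show "t ^ n / fact n * (uniformized ^^ n) g x \<le> t ^ n / fact n * ((\<Lambda> - exit_rate x) ^ n * g x)
      + t ^ n / fact n * (M * c_h\<^sup>2 * v * (real n * Q ^ (n - 1)))
      + (\<Sum>j<J. t ^ n / fact n * (a j * c_h\<^sup>2 * v * (real n * q j ^ (n - 1))))"
      by (simp only: distrib_left sum_distrib_left)
  qed
  then have "exp_op t generator g x \<le> exp (- \<Lambda> * t) * (exp (t * (\<Lambda> - exit_rate x)) * g x + M * c_h\<^sup>2 * v * (t * exp (t * Q))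
      + (\<Sum>j<J. a j * c_h\<^sup>2 * v * (t * exp (t * q j))))"
    unfolding exp_op_eq(2)[OF assms(1) g] by (intro mult_left_mono) auto
  also have "\<dots> = exp (- t * exit_rate x) * g x + M * c_h\<^sup>2 * v * (t * exp (t * Q - \<Lambda> * t))
      + (\<Sum>j<J. a j * c_h\<^sup>2 * v * (t * exp (t * q j - \<Lambda> * t)))"
    by (simp add: distrib_left sum_distrib_left exp_diff exp_minus right_diff_distrib field_simps)
  \<comment> \<open>The prefactor exp (- \<Lambda> t) removes \<Lambda> from every exponent.\<close>
  also have "t * Q - \<Lambda> * t = (C + c_h * M * K) * ?\<tau>"
    by (simp add: Q_def algebra_simps)
  also have "(\<Sum>j<J. a j * c_h\<^sup>2 * v * (t * exp (t * q j - \<Lambda> * t)))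
      \<le> (\<Sum>j<J. M * c_h\<^sup>2 * v * (t * exp ((C + c_h * M * K) * ?\<tau>)) *
        (2 powr (real (Suc j) * (\<alpha> + real DIM('a))) * exp (- c6 * 2 powr (real j * \<alpha>))))"
  proof (intro sum_mono)
    fix j
    have "(\<delta> / 2 ^ j) powr - \<alpha> = \<delta> powr - \<alpha> * 2 powr (real j * \<alpha>)"
    proof -
      have "(2 ^ j) powr - \<alpha> = 2 powr - (real j * \<alpha>)"
        by (simp add: powr_powr flip: powr_realpow)
      then show ?thesis using pos by (simp add: powr_divide powr_minus field_simps)
    qed
    then have eq: "t * q j - \<Lambda> * t = C * ?\<tau> - c6 * 2 powr (real j * \<alpha>) * ?\<tau>"
      by (simp add: q_def algebra_simps)
    have "C * ?\<tau> \<le> (C + c_h * M * K) * ?\<tau>"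
      using pos c_h_pos t by (intro mult_right_mono) auto
    \<comment> \<open>With t \<delta>^-\<alpha> \<ge> 1 the decay of shell j is bounded
      independently of t and \<delta>, so that D applies.\<close>
    moreover have "c6 * 2 powr (real j * \<alpha>) * 1 \<le> c6 * 2 powr (real j * \<alpha>) * ?\<tau>"
      using pos t by (intro mult_left_mono) auto
    ultimately have "exp (t * q j - \<Lambda> * t) \<le> exp ((C + c_h * M * K) * ?\<tau> + - c6 * 2 powr (real j * \<alpha>))"
      unfolding eq exp_le_cancel_iff by simp
    also have "\<dots> = exp ((C + c_h * M * K) * ?\<tau>) * exp (- c6 * 2 powr (real j * \<alpha>))"
      by (rule exp_add)
    finally have "a j * c_h\<^sup>2 * v * t * exp (t * q j - \<Lambda> * t)
        \<le> a j * c_h\<^sup>2 * v * t * (exp ((C + c_h * M * K) * ?\<tau>) * exp (- c6 * 2 powr (real j * \<alpha>)))"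
      using v t pos by (intro mult_left_mono) (auto simp: a_def)
    then show "a j * c_h\<^sup>2 * v * (t * exp (t * q j - \<Lambda> * t))
      \<le> M * c_h\<^sup>2 * v * (t * exp ((C + c_h * M * K) * ?\<tau>)) *
        (2 powr (real (Suc j) * (\<alpha> + real DIM('a))) * exp (- c6 * 2 powr (real j * \<alpha>)))"
      by (simp add: a_def mult_ac del: of_nat_Suc)
  qed
  also have "\<dots> \<le> M * c_h\<^sup>2 * v * (t * exp ((C + c_h * M * K) * ?\<tau>)) * D"
    unfolding sum_distrib_left[symmetric] using pos v t by (intro mult_left_mono D) auto
  finally show ?thesis
    unfolding exit_rate_def v_def[symmetric] by (simp add: algebra_simps)
qed

end

subsection \<open>The heat kernel bound\<close>

text \<open>The double exponential decay in j beats the growth 2^(j s): exp (- y) is at most (N /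
  y)^N for y > 0, and N \<alpha> \<ge> s + 1 leaves terms of order 2^-j.\<close>

lemma sum_powr_exp_bounded:
  fixes c s \<alpha> :: real
  assumes "0 < c" "0 < \<alpha>"
  shows "\<exists>D\<ge>0. \<forall>J. (\<Sum>j<J. 2 powr (real (Suc j) * s) * exp (- c * 2 powr (real j * \<alpha>))) \<le> D"
proof -
  define N where "N = Suc (nat \<lceil>(s + 1) / \<alpha>\<rceil>)"
  have "(s + 1) / \<alpha> \<le> real N" unfolding N_def by linarith
  then have N: "s + 1 \<le> real N * \<alpha>" using assms by (simp add: pos_divide_le_eq)
  have N_pos: "0 < N" by (simp add: N_def)
  define B where "B = 2 powr s * (real N / c) ^ N"
  have B: "0 \<le> B" using assms by (simp add: B_def)
  have "2 powr (real (Suc j) * s) * exp (- c * 2 powr (real j * \<alpha>)) \<le> B * (1 / 2) ^ j" for j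
  proof -
    define y where "y = c * 2 powr (real j * \<alpha>)"
    have y: "0 < y" using assms by (simp add: y_def)
    have "y / real N \<le> exp (y / real N)"
      using exp_ge_add_one_self[of "y / real N"] by linarith
    then have "(y / real N) ^ N \<le> exp (y / real N) ^ N"
      using y by (intro power_mono) auto
    also have "\<dots> = exp y"
      using N_pos by (simp flip: exp_of_nat_mult)
    finally have "inverse (exp y) \<le> inverse ((y / real N) ^ N)"
      using y N_pos by (intro le_imp_inverse_le) auto
    then have "exp (- y) \<le> (real N / c) ^ N * inverse (2 powr (real j * \<alpha>)) ^ N"
      by (simp add: exp_minus y_def power_divide power_mult_distrib power_inverse field_simps)
    also have "inverse (2 powr (real j * \<alpha>)) ^ N = 2 powr (- (real j * (real N * \<alpha>)))"
      by (simp add: powr_minus[symmetric] powr_power mult_ac)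
    also have "\<dots> \<le> 2 powr (- (real j * (s + 1)))"
      using N by (intro powr_mono) (auto intro: mult_left_mono)
    finally have "exp (- y) \<le> (real N / c) ^ N * 2 powr (- (real j * (s + 1)))"
      using assms by (simp add: mult_left_mono)
    then have "2 powr (real (Suc j) * s) * exp (- y)
        \<le> 2 powr (real (Suc j) * s) * ((real N / c) ^ N * 2 powr (- (real j * (s + 1))))"
      by (intro mult_left_mono) auto
    also have "\<dots> = (real N / c) ^ N * 2 powr (s + - real j)"
      by (simp add: algebra_simps flip: powr_add)
    also have "2 powr (s + - real j) = 2 powr s * (1 / 2) ^ j"
      by (simp only: powr_add powr_minus powr_realpow) (simp add: power_one_over inverse_eq_divide powr_realpow)
    finally show ?thesis by (simp add: B_def y_def mult_ac)
  qed
  then have "(\<Sum>j<J. 2 powr (real (Suc j) * s) * exp (- c * 2 powr (real j * \<alpha>)))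
      \<le> (\<Sum>j<J. B * (1 / 2) ^ j)" for J
    by (rule sum_mono)
  also have "(\<Sum>j<J. B * (1 / 2) ^ j) \<le> B * 2" for J
  proof -
    have "(\<Sum>j<J. (1 / 2 :: real) ^ j) \<le> (\<Sum>j. (1 / 2) ^ j)"
      by (rule sum_le_suminf) (auto intro: summable_geometric)
    also have "\<dots> = 2" by (simp add: suminf_geometric)
    finally show ?thesis unfolding sum_distrib_left[symmetric] using B by (rule mult_left_mono)
  qed
  finally show ?thesis using B by (intro exI[of _ "B * 2"]) auto
qed

lemma powr_le_exp:
  fixes t p :: real
  assumes "0 < t" "0 \<le> p"
  shows "t powr p \<le> exp (p * t)"
proof -
  have "ln t \<le> t" using ln_le_minus_one[of t] assms by simp
  then show ?thesis using assms by (simp add: powr_def mult_left_mono)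
qed

section \<open>Comparison with the heat kernel profile\<close>

context jump_profile
begin

text \<open>Beyond distance \<epsilon> the jump bound coincides with the bound capped at \<epsilon>,
  which has finite integral.\<close>

lemma b_eps_bounded:
  fixes f :: "'a::euclidean_space \<times> 'a \<Rightarrow> ennreal"
  assumes "0 < M" "0 < \<epsilon>"
    and bound: "\<And>x y. x \<noteq> y \<Longrightarrow> f (x, y) \<le> ennreal (M * jump_bound \<alpha> \<phi> (y - x))"
  shows "\<exists>\<Lambda>\<ge>0. \<forall>x. b_eps f \<epsilon> x \<le> ennreal \<Lambda>"
proof -
  obtain K where K: "0 < K" "\<And>\<delta>. 0 < \<delta> \<Longrightarrow>
      (\<integral>\<^sup>+(h::'a). ennreal (capped \<delta> h) \<partial>lborel) \<le> ennreal (K * \<delta> powr - \<alpha>)"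
    using nn_integral_capped[where 'a = 'a] by blast
  have "b_eps f \<epsilon> x \<le> ennreal (M * (K * \<epsilon> powr - \<alpha>))" for x
  proof -
    have "b_eps f \<epsilon> x \<le> (\<integral>\<^sup>+y. ennreal M * ennreal (capped \<epsilon> (y - x)) \<partial>lborel)"
      unfolding b_eps_def
    proof (intro nn_integral_mono)
      fix y
      show "f (x, y) * indicator {y. \<epsilon> < norm (y - x)} y \<le> ennreal M * ennreal (capped \<epsilon> (y - x))"
      proof (cases "\<epsilon> < norm (y - x)")
        case True
        then have "x \<noteq> y" using assms by auto
        then have "f (x, y) \<le> ennreal (M * jump_bound \<alpha> \<phi> (y - x))" by (rule bound)
        then show ?thesis
          using True assms by (simp add: capped_eq_jump_bound ennreal_mult')
      qed simp
    qed
    also have "\<dots> = ennreal M * (\<integral>\<^sup>+y. ennreal (capped \<epsilon> (y - x)) \<partial>lborel)"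
      by (rule nn_integral_cmult) measurable
    also have "(\<integral>\<^sup>+y. ennreal (capped \<epsilon> (y - x)) \<partial>lborel) = (\<integral>\<^sup>+y. ennreal (capped \<epsilon> (y :: 'a)) \<partial>lborel)"
      by (rule nn_integral_lborel_shift) measurable
    also have "ennreal M * (\<integral>\<^sup>+y. ennreal (capped \<epsilon> (y :: 'a)) \<partial>lborel) \<le> ennreal M * ennreal (K * \<epsilon> powr - \<alpha>)"
      by (rule mult_left_mono[OF K(2)[OF assms(2)]]) simp
    also have "\<dots> = ennreal (M * (K * \<epsilon> powr - \<alpha>))"
      using assms K by (intro ennreal_mult[symmetric]) auto
    finally show ?thesis .
  qed
  moreover have "0 \<le> M * (K * \<epsilon> powr - \<alpha>)" using assms K by simp
  ultimately show ?thesis by blast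
qed

text \<open>At the scale \<delta> = t^(1/\<alpha>) one has t \<delta>^-\<alpha> = 1 and t
  \<delta>^-(\<alpha>+d) = t^(-d/\<alpha>), which is the on-diagonal size of the heat kernel. When t
  is so large that \<delta> stays at \<delta>0, the excess is absorbed by the factor exponential in
  t.\<close>

lemma capped_heat_bound:
  fixes h :: "'a::euclidean_space"
  assumes "0 < \<delta>0" "\<delta>0 \<le> 1" "0 < t" "0 \<le> E" "h \<noteq> 0"
  defines "\<delta> \<equiv> min (t powr (1 / \<alpha>)) \<delta>0"
  shows "t * exp (E * (t * \<delta> powr - \<alpha>)) * capped \<delta> h
    \<le> exp E * \<delta>0 powr - (\<alpha> + real DIM('a)) * exp ((E * \<delta>0 powr - \<alpha> + (1 + real DIM('a) / \<alpha>)) * t)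
      * min (t powr - (real DIM('a) / \<alpha>)) (t * jump_bound \<alpha> \<phi> h)"
proof -
  let ?s = "\<alpha> + real DIM('a)" and ?d = "real DIM('a)"
  let ?p = "1 + ?d / \<alpha>"
  have \<delta>: "0 < \<delta>" "\<delta> \<le> 1" using assms by (auto simp: \<delta>_def)
  have \<delta>0: "1 \<le> \<delta>0 powr - ?s"
    using assms alpha_pos powr_mono2'[of "- ?s" \<delta>0 1] by simp
  have p: "0 \<le> ?p" using alpha_pos by simp
  have e: "1 \<le> exp (?p * t)" using p assms by simp
  have cases: "\<delta> = t powr (1 / \<alpha>) \<or> \<delta> = \<delta>0" by (auto simp: \<delta>_def min_def)
  have t\<alpha>: "t * (t powr (1 / \<alpha>)) powr - \<alpha> = 1"
    using assms alpha_pos by (simp add: powr_powr powr_minus)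
  have "t * \<delta> powr - \<alpha> \<le> 1 + \<delta>0 powr - \<alpha> * t"
    using cases
  proof
    assume "\<delta> = t powr (1 / \<alpha>)"
    then show ?thesis using t\<alpha> assms by simp
  qed simp
  then have "E * (t * \<delta> powr - \<alpha>) \<le> E * (1 + \<delta>0 powr - \<alpha> * t)"
    using assms by (intro mult_left_mono)
  then have exp_le: "exp (E * (t * \<delta> powr - \<alpha>)) \<le> exp E * exp (E * \<delta>0 powr - \<alpha> * t)"
    by (simp add: algebra_simps flip: exp_add)
  have on_diag: "t * \<delta> powr - ?s \<le> \<delta>0 powr - ?s * exp (?p * t) * t powr - (?d / \<alpha>)"
    using cases
  proof
    assume eq: "\<delta> = t powr (1 / \<alpha>)"
    have "t * \<delta> powr - ?s = t powr 1 * t powr ((1 / \<alpha>) * - ?s)"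
      unfolding eq powr_powr using assms by simp
    also have "\<dots> = t powr (1 + (1 / \<alpha>) * - ?s)"
      by (rule powr_add[symmetric])
    also have "1 + (1 / \<alpha>) * - ?s = - (?d / \<alpha>)"
      using alpha_pos by (simp add: field_simps)
    also have "t powr - (?d / \<alpha>) = 1 * 1 * t powr - (?d / \<alpha>)" by simp
    also have "\<dots> \<le> \<delta>0 powr - ?s * exp (?p * t) * t powr - (?d / \<alpha>)"
      using \<delta>0 e by (intro mult_right_mono mult_mono) auto
    finally show ?thesis .
  next
    assume eq: "\<delta> = \<delta>0"
    have "t = t powr ?p * t powr - (?d / \<alpha>)"
      using assms by (simp flip: powr_add)
    also have "\<dots> \<le> exp (?p * t) * t powr - (?d / \<alpha>)"
      using assms p by (intro mult_right_mono powr_le_exp) auto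
    finally have "t * \<delta>0 powr - ?s \<le> (exp (?p * t) * t powr - (?d / \<alpha>)) * \<delta>0 powr - ?s"
      by (intro mult_right_mono) auto
    then show ?thesis by (simp add: eq mult_ac)
  qed
  have "t * capped \<delta> h \<le> \<delta>0 powr - ?s * exp (?p * t) * t powr - (?d / \<alpha>)"
    using on_diag capped_le[OF \<delta>(1), of h] assms
    by (meson mult_left_mono order_trans less_imp_le)
  moreover have "t * capped \<delta> h \<le> \<delta>0 powr - ?s * exp (?p * t) * (t * jump_bound \<alpha> \<phi> h)"
  proof -
    have "t * capped \<delta> h \<le> 1 * 1 * (t * jump_bound \<alpha> \<phi> h)"
      using capped_le_jump_bound[OF \<delta> \<open>h \<noteq> 0\<close>] assms by simp
    also have "\<dots> \<le> \<delta>0 powr - ?s * exp (?p * t) * (t * jump_bound \<alpha> \<phi> h)"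
      using \<delta>0 e jump_bound_nonneg[of h] assms by (intro mult_right_mono mult_mono) auto
    finally show ?thesis .
  qed
  ultimately have main: "t * capped \<delta> h
      \<le> \<delta>0 powr - ?s * exp (?p * t) * min (t powr - (?d / \<alpha>)) (t * jump_bound \<alpha> \<phi> h)"
    by (auto simp: min_def)
  have "exp (E * (t * \<delta> powr - \<alpha>)) * (t * capped \<delta> h) \<le> (exp E * exp (E * \<delta>0 powr - \<alpha> * t)) *
      (\<delta>0 powr - ?s * exp (?p * t) * min (t powr - (?d / \<alpha>)) (t * jump_bound \<alpha> \<phi> h))"
    by (rule mult_mono[OF exp_le main]) (use assms in auto)
  also have "\<dots> = exp E * \<delta>0 powr - ?s * (exp (E * \<delta>0 powr - \<alpha> * t) * exp (?p * t))
      * min (t powr - (?d / \<alpha>)) (t * jump_bound \<alpha> \<phi> h)"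
    by (simp only: mult_ac)
  also have "exp (E * \<delta>0 powr - \<alpha> * t) * exp (?p * t) = exp ((E * \<delta>0 powr - \<alpha> + ?p) * t)"
    by (simp only: distrib_right exp_add)
  finally show ?thesis by (simp only: mult_ac)
qed

text \<open>The profile is at most t^(-d/\<alpha>) near x and is t times the jump bound at most
  elsewhere, so a multiple of capped 1 dominates it. Without integrability the Bochner integral in
  the final bound would be 0 by default.\<close>

lemma heat_bound_integrable:
  fixes g :: "'a::euclidean_space \<Rightarrow> real"
  assumes [measurable]: "g \<in> borel_measurable borel" and g: "\<And>y. \<bar>g y\<bar> \<le> G" and "0 < t"
  shows "integrable lborel (\<lambda>y. g y * min (t powr - (real DIM('a) / \<alpha>)) (t * jump_bound \<alpha> \<phi> (y - x)))"
proof (rule Bochner_Integration.integrable_bound)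
  let ?T = "t powr - (real DIM('a) / \<alpha>)"
  have [measurable]: "jump_bound \<alpha> \<phi> \<in> borel_measurable (borel :: 'a measure)"
    unfolding jump_bound_def[abs_def] by measurable
  show "(\<lambda>y. g y * min ?T (t * jump_bound \<alpha> \<phi> (y - x))) \<in> borel_measurable lborel"
    by measurable
  have G: "0 \<le> G" using g[of undefined] by simp
  show "integrable lborel (\<lambda>y::'a. (G * (?T + t)) * capped 1 (y - x))"
    by (rule capped_integrable[where G = "\<bar>G * (?T + t)\<bar>"]) auto
  show "AE y in lborel. norm (g y * min ?T (t * jump_bound \<alpha> \<phi> (y - x))) \<le> norm ((G * (?T + t)) * capped 1 (y - x))"
  proof (rule AE_I2)
    fix y
    let ?m = "min ?T (t * jump_bound \<alpha> \<phi> (y - x))"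
    have m: "0 \<le> ?m" using assms jump_bound_nonneg[of "y - x"] by simp
    have "?m \<le> (?T + t) * capped 1 (y - x)"
    proof (cases "norm (y - x) \<le> 1")
      case True
      then have "capped 1 (y - x) = 1" by (simp add: capped_small)
      then show ?thesis using assms by (simp add: min.coboundedI1)
    next
      case False
      then have "capped 1 (y - x) = jump_bound \<alpha> \<phi> (y - x)" by (intro capped_eq_jump_bound) auto
      then show ?thesis
        using jump_bound_nonneg[of "y - x"] by (simp add: distrib_right min.coboundedI2)
    qed
    then have "\<bar>g y\<bar> * ?m \<le> G * ((?T + t) * capped 1 (y - x))"
      using g[of y] m G by (intro mult_mono) auto
    then show "norm (g y * ?m) \<le> norm ((G * (?T + t)) * capped 1 (y - x))"
      using m G assms by (simp add: abs_mult mult.assoc)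
  qed
qed

end

section \<open>Choice of the constants and conclusion\<close>

theorem theorem1:
  fixes \<alpha> M c4 \<epsilon>0 c6 :: real
    and \<phi> :: "real \<Rightarrow> real"
  assumes alpha: "0 < \<alpha>" "\<alpha> < 2"
    and constants: "0 < M" "0 < c4" "0 < \<epsilon>0" "0 < c6"
    and phi_borel: "\<phi> \<in> borel_measurable (restrict_space borel {0..})"
    and phi_range: "\<forall>a\<ge>0. 0 < \<phi> a \<and> \<phi> a \<le> 1"
    and phi_a: "\<forall>a\<in>{0..1}. \<phi> a = 1"
      "\<exists>c1. \<forall>a\<ge>0. \<forall>b\<ge>0. \<bar>a - b\<bar> \<le> 1 \<longrightarrow> \<phi> a \<le> c1 * \<phi> b"
    and phi_b: "C2_on {1<..} \<phi>"
      "\<exists>c2. \<forall>a>1. max \<bar>deriv \<phi> a\<bar> \<bar>deriv (deriv \<phi>) a\<bar> \<le> c2 * \<phi> a"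
    and phi_c: "\<exists>c3. \<forall>x y :: 'a::euclidean_space. norm (x - y) > 2 \<longrightarrow>
      (\<integral>\<^sup>+z\<in>{z. norm (x - z) \<ge> 1 \<and> norm (y - z) \<ge> 1}.
          ennreal (jump_bound \<alpha> \<phi> (y - z) * jump_bound \<alpha> \<phi> (z - x)) \<partial>lborel)
        \<le> ennreal (c3 * jump_bound \<alpha> \<phi> (y - x))"
  shows "\<exists>C1>0. \<exists>C2>0. \<forall>f :: 'a \<times> 'a \<Rightarrow> ennreal.
    f \<in> borel_measurable borel \<longrightarrow>
    (\<forall>x y. x \<noteq> y \<longrightarrow> f (x, y) \<le> ennreal (M * jump_bound \<alpha> \<phi> (y - x))) \<longrightarrow>
    (\<forall>x h. f (x, x + h) = f (x, x - h)) \<or> \<alpha> < 1 \<longrightarrow>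
    (\<forall>x y. f (x, y) = f (y, x)) \<longrightarrow>
    (\<forall>\<epsilon>>0. (INF x. \<integral>\<^sup>+y\<in>{y. norm (y - x) > \<epsilon>}. f (x, y) / ennreal (\<phi> (norm (y - x))) \<partial>lborel)
              \<ge> ennreal (c4 * \<epsilon> powr - \<alpha>)) \<longrightarrow>
    (\<forall>\<epsilon>. 0 < \<epsilon> \<and> \<epsilon> \<le> \<epsilon>0 \<longrightarrow> (INF x. b_eps f \<epsilon> x) \<ge> ennreal (c6 * \<epsilon> powr - \<alpha>)) \<longrightarrow>
    (\<forall>g \<in> borel_measurable borel. bounded (range g) \<and> (\<forall>y. 0 \<le> g y) \<longrightarrow>
      (\<forall>\<epsilon>. 0 < \<epsilon> \<and> \<epsilon> < min \<epsilon>0 1 \<longrightarrow> (\<forall>t>0. \<forall>x.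
        exp_op t (A_eps f \<epsilon>) g x
          \<le> C1 * exp (C2 * t) *
              (\<integral>y. g y * min (t powr - (real DIM('a) / \<alpha>)) (t * jump_bound \<alpha> \<phi> (y - x)) \<partial>lborel)
            + exp (- t * enn2real (b_eps f \<epsilon> x)) * g x)))"
proof -
  obtain c1 where c1: "\<And>a b. 0 \<le> a \<Longrightarrow> 0 \<le> b \<Longrightarrow> \<bar>a - b\<bar> \<le> 1 \<Longrightarrow> \<phi> a \<le> c1 * \<phi> b"
    using phi_a(2) by blast
  obtain c3 where c3: "\<forall>x y :: 'a. norm (x - y) > 2 \<longrightarrow>
      (\<integral>\<^sup>+z\<in>{z. norm (x - z) \<ge> 1 \<and> norm (y - z) \<ge> 1}.
          ennreal (jump_bound \<alpha> \<phi> (y - z) * jump_bound \<alpha> \<phi> (z - x)) \<partial>lborel)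
        \<le> ennreal (c3 * jump_bound \<alpha> \<phi> (y - x))"
    using phi_c by (elim exE) (rule that)
  interpret jump_profile \<alpha> c1 \<phi>
    using alpha(1) phi_borel phi_range phi_a(1) c1 by unfold_locales auto
  let ?d = "real DIM('a)" and ?s = "\<alpha> + real DIM('a)"
  obtain K where K: "0 < K" and convolution: "\<forall>\<delta> x w. 0 < \<delta> \<longrightarrow> \<delta> \<le> 1 \<longrightarrow>
    (\<integral>\<^sup>+(z::'a). ennreal (capped \<delta> (z - x)) * ennreal (capped \<delta> (z - w)) \<partial>lborel)
      \<le> ennreal (K * \<delta> powr - \<alpha> * capped \<delta> (x - w))"
    using nn_integral_capped_convolution[OF c3] by (elim exE conjE) (rule that)
  \<comment> \<open>d times the tempering rate of \<open>capped\<close>, because a single direction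
    captures only the fraction 1/d of the norm.\<close>
  define \<kappa> where "\<kappa> = ?d * (ln c1 + ?s)"
  have \<kappa>: "0 \<le> \<kappa>" using c1_ge_1 alpha by (simp add: \<kappa>_def)
  obtain C where C: "0 < C" and tilted: "\<forall>(f :: 'a \<times> 'a \<Rightarrow> ennreal) \<delta> \<epsilon> r e x.
    f \<in> borel_measurable borel \<longrightarrow>
    (\<forall>x y. x \<noteq> y \<longrightarrow> f (x, y) \<le> ennreal (M * jump_bound \<alpha> \<phi> (y - x))) \<longrightarrow>
    (\<forall>x h. f (x, x + h) = f (x, x - h)) \<or> \<alpha> < 1 \<longrightarrow>
    0 < \<delta> \<longrightarrow> 0 < \<epsilon> \<longrightarrow> r \<le> \<delta> \<longrightarrow> norm e \<le> 1 \<longrightarrow>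
    (\<integral>\<^sup>+y\<in>{y. \<epsilon> < norm (y - x) \<and> norm (y - x) \<le> r}.
        f (x, y) * ennreal (exp (\<kappa> / \<delta> * ((y - x) \<bullet> e))) \<partial>lborel)
      \<le> (\<integral>\<^sup>+y\<in>{y. \<epsilon> < norm (y - x) \<and> norm (y - x) \<le> r}. f (x, y) \<partial>lborel)
        + ennreal (C * \<delta> powr - \<alpha>)"
    using tilted_jumps[OF alpha(2) constants(1) \<kappa>, where 'a = 'a] by (elim exE conjE) (rule that)
  note tilted = tilted[THEN spec, THEN spec, THEN spec, THEN spec, THEN spec, THEN spec,
      THEN mp, THEN mp, THEN mp, THEN mp, THEN mp, THEN mp, THEN mp]
  obtain D where D: "0 \<le> D" "\<forall>J. (\<Sum>j<J. 2 powr (real (Suc j) * ?s) * exp (- c6 * 2 powr (real j * \<alpha>))) \<le> D"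
    using sum_powr_exp_bounded[OF constants(4) alpha(1)] by blast
  \<comment> \<open>This is \<open>c_h\<close> written out: C1 and C2 must be fixed before f and t,
    hence before \<open>dominated_kernel\<close> is interpreted.\<close>
  define kh where "kh = 2 * DIM('a) * c1"
  have kh: "0 < kh" using c1_ge_1 by (simp add: kh_def)
  define E where "E = C + kh * M * K"
  have E: "0 \<le> E" using C K constants kh by (simp add: E_def)
  \<comment> \<open>Tempering and convolution estimates require scales up to 1, the lower bound for
    \<open>b_eps\<close> scales up to \<epsilon>0.\<close>
  define \<delta>0 where "\<delta>0 = min 1 \<epsilon>0"
  have \<delta>0: "0 < \<delta>0" "\<delta>0 \<le> 1" "\<delta>0 \<le> \<epsilon>0" using constants by (auto simp: \<delta>0_def)
  \<comment> \<open>B is the prefactor in \<open>exp_op_le\<close>; C1 and C2 add what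
    \<open>capped_heat_bound\<close> contributes.\<close>
  define B where "B = M * kh\<^sup>2 * (D + 1)"
  have B: "0 < B" using constants kh D by (simp add: B_def)
  define C1 where "C1 = B * (exp E * \<delta>0 powr - ?s)"
  define C2 where "C2 = E * \<delta>0 powr - \<alpha> + (1 + ?d / \<alpha>)"
  have C1: "0 < C1" using B \<delta>0 by (simp add: C1_def)
  have C2: "0 < C2"
  proof -
    have "0 \<le> E * \<delta>0 powr - \<alpha>" "0 \<le> ?d / \<alpha>" using E alpha by auto
    then show ?thesis by (simp add: C2_def)
  qed
  have main: "exp_op t (A_eps f \<epsilon>) g x \<le> C1 * exp (C2 * t) *
      (\<integral>y. g y * min (t powr - (?d / \<alpha>)) (t * jump_bound \<alpha> \<phi> (y - x)) \<partial>lborel)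
        + exp (- t * enn2real (b_eps f \<epsilon> x)) * g x"
    if f: "f \<in> borel_measurable borel"
      and bound: "\<forall>x y. x \<noteq> y \<longrightarrow> f (x, y) \<le> ennreal (M * jump_bound \<alpha> \<phi> (y - x))"
      and sym: "(\<forall>x h. f (x, x + h) = f (x, x - h)) \<or> \<alpha> < 1"
      and f_sym: "\<forall>x y. f (x, y) = f (y, x)"
      and lower: "\<forall>\<epsilon>. 0 < \<epsilon> \<and> \<epsilon> \<le> \<epsilon>0 \<longrightarrow> (INF x. b_eps f \<epsilon> x) \<ge> ennreal (c6 * \<epsilon> powr - \<alpha>)"
      and g_borel: "g \<in> borel_measurable borel" and g: "bounded (range g)" "\<forall>y. 0 \<le> g y"
      and \<epsilon>: "0 < \<epsilon>" and t: "0 < t"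
    for f :: "'a \<times> 'a \<Rightarrow> ennreal" and g :: "'a \<Rightarrow> real" and \<epsilon> t :: real and x :: 'a
  proof -
    obtain G where G: "\<And>y. \<bar>g y\<bar> \<le> G"
      using g(1) by (auto simp: bounded_iff)
    then have g': "\<And>y. 0 \<le> g y" "\<And>y. g y \<le> G"
      using g(2) abs_le_D1 by auto
    \<comment> \<open>\<Lambda> may depend on f and \<epsilon>, since it does not occur in the bound
      of \<open>exp_op_le\<close>.\<close>
    obtain \<Lambda> where \<Lambda>: "0 \<le> \<Lambda>" "\<And>x. b_eps f \<epsilon> x \<le> ennreal \<Lambda>"
      using b_eps_bounded[OF constants(1) \<epsilon>, of f] bound by blast
    define \<delta> where "\<delta> = min (t powr (1 / \<alpha>)) \<delta>0"
    have \<delta>: "0 < \<delta>" "\<delta> \<le> 1" "\<delta> \<le> \<epsilon>0" using \<delta>0 t by (auto simp: \<delta>_def)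
    interpret dominated_kernel \<alpha> c1 \<phi> f M C K c6 \<epsilon> \<delta> \<Lambda>
    proof unfold_locales
      show "(\<integral>\<^sup>+y. jump_kernel f \<epsilon> r x y * ennreal (exp (?d * (ln c1 + ?s) / \<delta> * ((y - x) \<bullet> e))) \<partial>lborel)
        \<le> (\<integral>\<^sup>+y. jump_kernel f \<epsilon> r x y \<partial>lborel) + ennreal (C * \<delta> powr - \<alpha>)"
        if "r \<le> \<delta>" "norm e \<le> 1" for r and e x :: 'a
        using tilted[OF f bound sym \<delta>(1) \<epsilon> that, of x] unfolding jump_kernel_def \<kappa>_def by (simp only: mult_ac)
      show "ennreal (c6 * r powr - \<alpha>) \<le> b_eps f r x" if "0 < r" "r \<le> \<delta>" for r x
        using lower[rule_format, of r] that \<delta>(3) by (auto intro: order_trans[OF _ INF_lower])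
      show "f (x, y) \<le> ennreal (M * jump_bound \<alpha> \<phi> (y - x))" if "x \<noteq> y" for x y
        using bound that by blast
      show "f (x, y) = f (y, x)" for x y
        using f_sym by blast
    qed (fact f convolution[rule_format, OF \<delta>(1,2)] \<Lambda> constants C K \<epsilon> \<delta>)+
    have c_h_eq: "c_h = kh"
      by (simp add: c_h_def kh_def)
    \<comment> \<open>From \<delta> \<le> t^(1/\<alpha>) comes the condition t \<delta>^-\<alpha>
      \<ge> 1 of \<open>exp_op_le\<close>.\<close>
    have "t powr - 1 \<le> \<delta> powr - \<alpha>"
    proof -
      have "(t powr (1 / \<alpha>)) powr - \<alpha> \<le> \<delta> powr - \<alpha>"
        using alpha \<delta> by (intro powr_mono2') (auto simp: \<delta>_def)
      then show ?thesis using alpha by (simp add: powr_powr)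
    qed
    then have \<tau>: "1 \<le> t * \<delta> powr - \<alpha>"
      using t by (simp add: powr_minus_divide field_simps)
    have "exp_op t (A_eps f \<epsilon>) g x \<le> exp (- t * enn2real (b_eps f \<epsilon> x)) * g x
        + B * (t * exp (E * (t * \<delta> powr - \<alpha>))) * (\<integral>y. g y * capped \<delta> (y - x) \<partial>lborel)"
      using exp_op_le[OF g_borel g' t \<tau> D(2)[rule_format]] unfolding B_def E_def c_h_eq .
    also have "B * (t * exp (E * (t * \<delta> powr - \<alpha>))) * (\<integral>y. g y * capped \<delta> (y - x) \<partial>lborel)
        = (\<integral>y. B * (t * exp (E * (t * \<delta> powr - \<alpha>))) * (g y * capped \<delta> (y - x)) \<partial>lborel)"
      by simp
    also have "\<dots> \<le> (\<integral>y. C1 * exp (C2 * t) *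
        (g y * min (t powr - (?d / \<alpha>)) (t * jump_bound \<alpha> \<phi> (y - x))) \<partial>lborel)"
    proof (rule integral_mono_AE)
      show "integrable lborel (\<lambda>y. B * (t * exp (E * (t * \<delta> powr - \<alpha>))) * (g y * capped \<delta> (y - x)))"
        using capped_integrable[OF \<delta>(1) g_borel G] by (intro integrable_mult_right)
      show "integrable lborel (\<lambda>y. C1 * exp (C2 * t) * (g y * min (t powr - (?d / \<alpha>)) (t * jump_bound \<alpha> \<phi> (y - x))))"
        using heat_bound_integrable[OF g_borel G t] by (intro integrable_mult_right)
      \<comment> \<open>At y = x the convention for division makes \<open>jump_bound\<close> 0 and
        the pointwise comparison can fail; that point is a null set.\<close>
      show "AE y in lborel. B * (t * exp (E * (t * \<delta> powr - \<alpha>))) * (g y * capped \<delta> (y - x))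
        \<le> C1 * exp (C2 * t) * (g y * min (t powr - (?d / \<alpha>)) (t * jump_bound \<alpha> \<phi> (y - x)))"
        using AE_lborel_singleton[of x]
      proof eventually_elim
        case (elim y)
        then have "t * exp (E * (t * \<delta> powr - \<alpha>)) * capped \<delta> (y - x)
          \<le> exp E * \<delta>0 powr - ?s * exp (C2 * t) * min (t powr - (?d / \<alpha>)) (t * jump_bound \<alpha> \<phi> (y - x))"
          unfolding \<delta>_def C2_def using \<delta>0 t E by (intro capped_heat_bound) auto
        then have "(B * g y) * (t * exp (E * (t * \<delta> powr - \<alpha>)) * capped \<delta> (y - x)) \<le> (B * g y) *
          (exp E * \<delta>0 powr - ?s * exp (C2 * t) * min (t powr - (?d / \<alpha>)) (t * jump_bound \<alpha> \<phi> (y - x)))"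
          using B g' by (intro mult_left_mono) auto
        then show ?case unfolding C1_def by (simp only: mult_ac)
      qed
    qed
    also have "\<dots> = C1 * exp (C2 * t) *
        (\<integral>y. g y * min (t powr - (?d / \<alpha>)) (t * jump_bound \<alpha> \<phi> (y - x)) \<partial>lborel)"
      by simp
    finally show ?thesis by simp
  qed
  show ?thesis
  proof (rule exI[of _ C1], rule conjI[OF C1], rule exI[of _ C2], rule conjI[OF C2],
      intro allI impI ballI, goal_cases)
    case (1 f g \<epsilon> t x)
    then show ?case by (elim conjE) (rule main)
  qed
qed

end
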